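(* Let $H$ be a maximal analytic Hardy field or a maximal smooth Hardy field. Then $H$ is dense in any Hardy field extension $K$ of $H$; that is, for every $f\in K$ and every $\varepsilon\in K$ with $\varepsilon>0$ there exists $h\in H$ with $|f-h|<\varepsilon$.
   Context: $\mathcal{C}$ denotes the ring of germs at $+\infty$ of continuous functions $(a,+\infty)\to\mathbb{R}$ ($a\in\mathbb R$). For $r\in\mathbb N\cup\{\infty\}$, $\mathcal C^r$ is the subring of germs of $r$ times continuously differentiable functions; $\mathcal C^{<\infty}:=\bigcap_n\mathcal C^n$ is a differential ring with the derivation induced by differentiation, and $\mathcal C^\omega$ is the subring of germs of real analytic functions. A Hardy field is a subfield of $\mathcal C^{<\infty}$ closed under the derivation; it is smooth if contained in $\mathcal C^\infty$ and analytic if contained in $\mathcal C^\omega$. A maximal analytic (resp. smooth) Hardy field is an analytic (resp. smooth) Hardy field not properly contained in any other analytic (resp. smooth) Hardy field. Hardy fields are totally ordered by $f<g$ iff $f(t)<g(t)$ eventually. *)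

theory Defs
  imports "HOL-Analysis.Analysis"
begin

section \<open>Germs at \<open>+\<infinity>\<close>\<close>

text \<open>
  Every germ of a function \<open>(a, +\<infinity>) \<rightarrow> \<real>\<close> is the germ of a total function, so germs are
  represented by total functions modulo equality near \<open>+\<infinity>\<close>. The type comprises the germs of
  arbitrary functions; regularity is imposed by the subsets below.
\<close>

quotient_type germ = "real \<Rightarrow> real" / "\<lambda>f g. eventually (\<lambda>t. f t = g t) at_top"
  morphisms rep_germ germ_of
proof (rule equivpI)
  show "reflp (\<lambda>f g :: real \<Rightarrow> real. eventually (\<lambda>t. f t = g t) at_top)"
    by (simp add: reflp_def)
  show "symp (\<lambda>f g :: real \<Rightarrow> real. eventually (\<lambda>t. f t = g t) at_top)"
    by (simp add: symp_def eq_commute)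
  show "transp (\<lambda>f g :: real \<Rightarrow> real. eventually (\<lambda>t. f t = g t) at_top)"
    unfolding transp_def by (auto elim: eventually_elim2)
qed

instantiation germ :: comm_ring_1
begin

lift_definition zero_germ :: germ is "\<lambda>_. 0" .

lift_definition one_germ :: germ is "\<lambda>_. 1" .

lift_definition plus_germ :: "germ \<Rightarrow> germ \<Rightarrow> germ" is "\<lambda>f g t. f t + g t"
  by (auto elim: eventually_elim2)

lift_definition minus_germ :: "germ \<Rightarrow> germ \<Rightarrow> germ" is "\<lambda>f g t. f t - g t"
  by (auto elim: eventually_elim2)

lift_definition uminus_germ :: "germ \<Rightarrow> germ" is "\<lambda>f t. - f t"
  by (auto elim: eventually_mono)

lift_definition times_germ :: "germ \<Rightarrow> germ \<Rightarrow> germ" is "\<lambda>f g t. f t * g t"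
  by (auto elim: eventually_elim2)

instance
  by standard (transfer; simp add: algebra_simps)+

end

text \<open>
  On all germs, \<open>f < g\<close> is stronger than \<open>f \<le> g \<and> f \<noteq> g\<close>; the two agree on Hardy fields, where
  \<open>\<le>\<close> is a total order and the pointwise absolute value is \<open>max f (- f)\<close>.
\<close>

instantiation germ :: "{ord, abs}"
begin

lift_definition less_germ :: "germ \<Rightarrow> germ \<Rightarrow> bool" is
  "\<lambda>f g. eventually (\<lambda>t. f t < g t) at_top"
proof -
  fix f f' g g' :: "real \<Rightarrow> real"
  assume "eventually (\<lambda>t. f t = f' t) at_top" "eventually (\<lambda>t. g t = g' t) at_top"
  then have "eventually (\<lambda>t. (f t < g t) = (f' t < g' t)) at_top"
    by eventually_elim simp
  then show "eventually (\<lambda>t. f t < g t) at_top = eventually (\<lambda>t. f' t < g' t) at_top"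
    by (rule eventually_subst)
qed

lift_definition less_eq_germ :: "germ \<Rightarrow> germ \<Rightarrow> bool" is
  "\<lambda>f g. eventually (\<lambda>t. f t \<le> g t) at_top"
proof -
  fix f f' g g' :: "real \<Rightarrow> real"
  assume "eventually (\<lambda>t. f t = f' t) at_top" "eventually (\<lambda>t. g t = g' t) at_top"
  then have "eventually (\<lambda>t. (f t \<le> g t) = (f' t \<le> g' t)) at_top"
    by eventually_elim simp
  then show "eventually (\<lambda>t. f t \<le> g t) at_top = eventually (\<lambda>t. f' t \<le> g' t) at_top"
    by (rule eventually_subst)
qed

lift_definition abs_germ :: "germ \<Rightarrow> germ" is "\<lambda>f t. \<bar>f t\<bar>"
  by (auto elim: eventually_mono)

instance ..

end

text \<open>Meaningful only for germs of eventually differentiable functions.\<close>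

lift_definition germ_deriv :: "germ \<Rightarrow> germ" is deriv
proof -
  fix f g :: "real \<Rightarrow> real"
  assume "eventually (\<lambda>t. f t = g t) at_top"
  then obtain a where a: "\<And>t. t \<ge> a \<Longrightarrow> f t = g t"
    by (auto simp: eventually_at_top_linorder)
  have "deriv f t = deriv g t" if "t > a" for t
  proof (rule deriv_cong_ev)
    show "eventually (\<lambda>x. f x = g x) (nhds t)"
      using eventually_nhds_in_open[of "{a<..}" t] that
      by (auto elim!: eventually_mono intro: a)
  qed simp
  then show "eventually (\<lambda>t. deriv f t = deriv g t) at_top"
    by (auto intro: eventually_mono[OF eventually_gt_at_top[of a]])
qed

section \<open>Regularity classes\<close>

text \<open>Intended for open \<open>S\<close>, where differentiability within \<open>S\<close> is differentiability at each point.\<close>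

definition cont_diff_on :: "enat \<Rightarrow> (real \<Rightarrow> real) \<Rightarrow> real set \<Rightarrow> bool" where
  "cont_diff_on r f S \<longleftrightarrow>
     (\<forall>k. enat k < r \<longrightarrow> (deriv ^^ k) f differentiable_on S) \<and>
     (\<forall>k. enat k \<le> r \<longrightarrow> continuous_on S ((deriv ^^ k) f))"

definition real_analytic_on :: "(real \<Rightarrow> real) \<Rightarrow> real set \<Rightarrow> bool" where
  "real_analytic_on f S \<longleftrightarrow>
     (\<forall>x\<in>S. \<exists>c. \<exists>e>0. \<forall>y. \<bar>y - x\<bar> < e \<longrightarrow> (\<lambda>n. c n * (y - x) ^ n) sums f y)"

text \<open>
  The half-line \<open>(a, +\<infinity>)\<close> is chosen uniformly in the order of differentiation, so the germs in
  \<open>germs_C \<infinity>\<close> have a single representative that is smooth on a half-line. In \<open>germs_C_fin\<close>,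
  the ring \<open>C\<^sup>n\<close> intersected over all finite \<open>n\<close>, the half-line may depend on \<open>n\<close>.
\<close>

definition germs_C :: "enat \<Rightarrow> germ set" where
  "germs_C r = {germ_of f |f. \<exists>a. cont_diff_on r f {a<..}}"

definition germs_C_fin :: "germ set" where
  "germs_C_fin = (\<Inter>n::nat. germs_C (enat n))"

definition germs_C_analytic :: "germ set" where
  "germs_C_analytic = {germ_of f |f. \<exists>a. real_analytic_on f {a<..}}"

section \<open>Hardy fields\<close>

definition germ_subfield :: "germ set \<Rightarrow> bool" where
  "germ_subfield H \<longleftrightarrow>
     1 \<in> H \<and> (\<forall>f\<in>H. \<forall>g\<in>H. f - g \<in> H) \<and> (\<forall>f\<in>H. \<forall>g\<in>H. f * g \<in> H) \<and>
     (\<forall>f\<in>H. f \<noteq> 0 \<longrightarrow> (\<exists>g\<in>H. f * g = 1))"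

definition hardy_field :: "germ set \<Rightarrow> bool" where
  "hardy_field H \<longleftrightarrow>
     H \<subseteq> germs_C_fin \<and> germ_subfield H \<and> (\<forall>f\<in>H. germ_deriv f \<in> H)"

definition smooth_hardy_field :: "germ set \<Rightarrow> bool" where
  "smooth_hardy_field H \<longleftrightarrow> hardy_field H \<and> H \<subseteq> germs_C \<infinity>"

definition analytic_hardy_field :: "germ set \<Rightarrow> bool" where
  "analytic_hardy_field H \<longleftrightarrow> hardy_field H \<and> H \<subseteq> germs_C_analytic"

definition maximal_smooth_hardy_field :: "germ set \<Rightarrow> bool" where
  "maximal_smooth_hardy_field H \<longleftrightarrow>
     smooth_hardy_field H \<and> \<not> (\<exists>K. smooth_hardy_field K \<and> H \<subset> K)"

definition maximal_analytic_hardy_field :: "germ set \<Rightarrow> bool" where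
  "maximal_analytic_hardy_field H \<longleftrightarrow>
     analytic_hardy_field H \<and> \<not> (\<exists>K. analytic_hardy_field K \<and> H \<subset> K)"

text \<open>Density of \<open>H\<close> in an extension \<open>K\<close>, with respect to the order topology of \<open>K\<close>.\<close>

definition dense_in_hardy_field :: "germ set \<Rightarrow> germ set \<Rightarrow> bool" where
  "dense_in_hardy_field H K \<longleftrightarrow>
     (\<forall>f\<in>K. \<forall>\<epsilon>\<in>K. 0 < \<epsilon> \<longrightarrow> (\<exists>h\<in>H. \<bar>f - h\<bar> < \<epsilon>))"

end

theory Submission
  imports Defs "HOL-Probability.Probability" "HOL-Complex_Analysis.Complex_Analysis"
begin

text \<open>
  Suppose some \<open>f \<in> K\<close> has distance at least \<open>\<epsilon> > 0\<close> from all elements of \<open>H\<close>. By induction on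
  a lexicographic complexity, every normalised differential polynomial \<open>P\<close> over \<open>H\<close> satisfies a
  lower bound for \<open>|P(f)|\<close> that depends only on the shape of \<open>P\<close>. For otherwise \<open>P(f)\<close> is tiny
  compared with the separant of \<open>P\<close> at \<open>f\<close>, which is bounded below by induction, and a contraction
  argument, integrating from \<open>+\<infinity>\<close>, produces a zero \<open>y\<close> of \<open>P\<close> close to \<open>f\<close>. No polynomial of
  smaller complexity vanishes at \<open>y\<close>, so \<open>y\<close> generates over \<open>H\<close> a Hardy field of the same
  regularity, whence \<open>y \<in> H\<close> by maximality: a contradiction.

  Only countably many shapes occur, so all these bounds dominate one tiny function. An analytic
  \<open>g\<close> approximating \<open>f\<close> together with all its derivatives within that function then also
  generates a Hardy field over \<open>H\<close>, so again \<open>g \<in> H\<close>, although \<open>|f - g| < \<epsilon>\<close>.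
\<close>

section \<open>Iterated real derivatives\<close>

text \<open>The obstacle is that countably many lower bounds need a common positive minorant, and
  \<open>K\<close> may contain none. Bounds may therefore lie outside \<open>K\<close> as long as
  they stay comparable with it; these are the gauges. If some continuous positive function lies
  below all positive elements of \<open>K\<close>, it can be shrunk freely without losing
  comparability; otherwise every countable family of gauges has a minorant in \<open>K\<close>
  itself. Tying the bound to the shape of P and not to its coefficients keeps the family countable
  although H need not be. The induction runs over the order r and then over the degree d in the r-th
  derivative, with the degree N in the lower ones left free: reduction modulo P lowers d but raises
  N without control. The contraction is a Newton step for the r-th derivative; the lower derivatives
  are recovered by integration from infinity. Integrating against a steeply decaying weight gains a
  factor \<rho>, and this gain pays for a Lipschitz constant of order 1/\<rho> in the lower
  derivatives. Hence all estimates end in one weight \<omega> with \<omega>' \<le> - \<omega>/\<rho>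
  that also lies below the bounds already obtained.\<close>

definition kdiff :: "nat \<Rightarrow> (real \<Rightarrow> real) \<Rightarrow> real set \<Rightarrow> bool" where
  "kdiff n f U \<longleftrightarrow> (\<forall>k<n. \<forall>x\<in>U. (deriv ^^ k) f field_differentiable (at x))"

lemma funpow_deriv_Suc: "(deriv ^^ Suc k) f = (deriv ^^ k) (deriv f)"
  by (simp add: funpow_swap1)

lemma kdiff_0 [simp]: "kdiff 0 f U"
  by (simp add: kdiff_def)

lemma kdiff_Suc:
  "kdiff (Suc n) f U \<longleftrightarrow> (\<forall>x\<in>U. f field_differentiable (at x)) \<and> kdiff n (deriv f) U"
  unfolding kdiff_def All_less_Suc2 funpow_deriv_Suc by simp

lemma kdiff_mono: "kdiff n f U \<Longrightarrow> m \<le> n \<Longrightarrow> V \<subseteq> U \<Longrightarrow> kdiff m f V"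
  by (auto simp: kdiff_def)

lemma deriv_funpow_cong:
  assumes "open U" "\<And>x. x \<in> U \<Longrightarrow> f x = g x" "x \<in> U"
  shows "(deriv ^^ k) f x = (deriv ^^ k) g x"
  using assms(3)
proof (induction k arbitrary: x)
  case (Suc k)
  have "eventually (\<lambda>y. (deriv ^^ k) f y = (deriv ^^ k) g y) (nhds x)"
    using eventually_nhds_in_open[OF assms(1) Suc.prems] by eventually_elim (rule Suc.IH)
  then show ?case by (auto intro: deriv_cong_ev)
qed (use assms in auto)

lemma field_differentiable_cong_open:
  assumes "open U" "\<And>x. x \<in> U \<Longrightarrow> f x = g x" "x \<in> U" "f field_differentiable (at x)"
  shows "g field_differentiable (at x)"
proof -
  obtain D where "(f has_field_derivative D) (at x)"
    using assms(4) unfolding field_differentiable_def by blast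
  then have "(g has_field_derivative D) (at x)"
    by (rule has_field_derivative_transform_within_open[OF _ assms(1,3)]) (rule assms(2))
  then show ?thesis unfolding field_differentiable_def by blast
qed

lemma kdiff_cong:
  assumes "open U" "\<And>x. x \<in> U \<Longrightarrow> f x = g x" "kdiff n f U"
  shows "kdiff n g U"
  unfolding kdiff_def
proof (intro allI impI ballI)
  fix k x assume k: "k < n" and x: "x \<in> U"
  show "(deriv ^^ k) g field_differentiable (at x)"
  proof (rule field_differentiable_cong_open[OF assms(1) _ x])
    show "(deriv ^^ k) f y = (deriv ^^ k) g y" if "y \<in> U" for y
      by (rule deriv_funpow_cong[OF assms(1,2) that])
    show "(deriv ^^ k) f field_differentiable (at x)"
      using assms(3) k x unfolding kdiff_def by blast
  qed
qed

text \<open>Most regularity inductions below enter through this rule: an explicitly known derivative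
  agrees with \<open>deriv f\<close> on the whole open set, so its class passes to \<open>f\<close>,
  one order higher.\<close>

lemma has_deriv_kdiff_Suc:
  assumes "open U" "\<And>x. x \<in> U \<Longrightarrow> (f has_real_derivative g x) (at x)" "kdiff n g U"
  shows "kdiff (Suc n) f U"
  unfolding kdiff_Suc
proof (intro conjI ballI)
  show "f field_differentiable (at x)" if "x \<in> U" for x
    using assms that field_differentiable_def by blast
  show "kdiff n (deriv f) U"
    by (rule kdiff_cong[OF assms(1) _ assms(3)]) (simp add: DERIV_imp_deriv[OF assms(2)])
qed

lemma kdiff_deriv: "kdiff (Suc n) f U \<Longrightarrow> x \<in> U \<Longrightarrow> (f has_real_derivative deriv f x) (at x)"
  by (simp add: kdiff_Suc DERIV_deriv_iff_field_differentiable)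

lemma kdiff_deriv_funpow:
  "kdiff n f U \<Longrightarrow> k < n \<Longrightarrow> x \<in> U \<Longrightarrow>
    ((deriv ^^ k) f has_real_derivative (deriv ^^ Suc k) f x) (at x)"
  by (simp add: kdiff_def DERIV_deriv_iff_field_differentiable)

lemma kdiff_continuous_on:
  assumes "kdiff n f U" "k < n"
  shows "continuous_on U ((deriv ^^ k) f)"
proof (rule continuous_at_imp_continuous_on, rule ballI)
  show "isCont ((deriv ^^ k) f) x" if "x \<in> U" for x
    using DERIV_isCont[OF kdiff_deriv_funpow[OF assms that]] .
qed

text \<open>General coefficients cover sums and differences at once; both claims come from the same
  hypothesis, applied to \<open>deriv f\<close> and \<open>deriv g\<close>.\<close>

lemma kdiff_add_aux:
  assumes "open U"
  shows "kdiff n f U \<Longrightarrow> kdiff n g U \<Longrightarrow> kdiff n (\<lambda>x. a * f x + b * g x) U \<and>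
    (\<forall>k\<le>n. \<forall>x\<in>U. (deriv ^^ k) (\<lambda>x. a * f x + b * g x) x = a * (deriv ^^ k) f x + b * (deriv ^^ k) g x)"
proof (induction n arbitrary: f g)
  case (Suc n)
  have d: "((\<lambda>x. a * f x + b * g x) has_real_derivative a * deriv f x + b * deriv g x) (at x)"
    if "x \<in> U" for x
    using Suc.prems that by (auto intro!: derivative_eq_intros dest: kdiff_deriv)
  have IH: "kdiff n (\<lambda>x. a * deriv f x + b * deriv g x) U"
    "\<forall>k\<le>n. \<forall>x\<in>U. (deriv ^^ k) (\<lambda>x. a * deriv f x + b * deriv g x) x =
      a * (deriv ^^ k) (deriv f) x + b * (deriv ^^ k) (deriv g) x"
    using Suc by (auto simp: kdiff_Suc)
  have "(deriv ^^ k) (\<lambda>x. a * f x + b * g x) x = a * (deriv ^^ k) f x + b * (deriv ^^ k) g x"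
    if "k \<le> Suc n" "x \<in> U" for k x
  proof (cases k)
    case (Suc j)
    have "(deriv ^^ j) (deriv (\<lambda>x. a * f x + b * g x)) x
        = (deriv ^^ j) (\<lambda>x. a * deriv f x + b * deriv g x) x"
      by (rule deriv_funpow_cong[OF assms _ that(2)]) (use d in \<open>auto intro: DERIV_imp_deriv\<close>)
    then show ?thesis using IH(2) that Suc by (simp del: funpow.simps add: funpow_deriv_Suc)
  qed auto
  then show ?case using has_deriv_kdiff_Suc[OF assms d IH(1)] by blast
qed auto

lemma kdiff_lincomb:
  assumes "open U" "kdiff n f U" "kdiff n g U"
  shows "kdiff n (\<lambda>x. a * f x + b * g x) U"
  using kdiff_add_aux[OF assms] by blast

lemma deriv_funpow_lincomb:
  assumes "open U" "kdiff n f U" "kdiff n g U" "k \<le> n" "x \<in> U"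
  shows "(deriv ^^ k) (\<lambda>x. a * f x + b * g x) x = a * (deriv ^^ k) f x + b * (deriv ^^ k) g x"
  using kdiff_add_aux[OF assms(1-3)] assms by blast

lemma kdiff_add: "open U \<Longrightarrow> kdiff n f U \<Longrightarrow> kdiff n g U \<Longrightarrow> kdiff n (\<lambda>x. f x + g x) U"
  using kdiff_lincomb[of U n f g 1 1] by simp

lemma kdiff_diff: "open U \<Longrightarrow> kdiff n f U \<Longrightarrow> kdiff n g U \<Longrightarrow> kdiff n (\<lambda>x. f x - g x) U"
  using kdiff_lincomb[of U n f g 1 "-1"] by simp

lemma deriv_funpow_add:
  assumes "open U" "kdiff n f U" "kdiff n g U" "k \<le> n" "x \<in> U"
  shows "(deriv ^^ k) (\<lambda>x. f x + g x) x = (deriv ^^ k) f x + (deriv ^^ k) g x"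
  using deriv_funpow_lincomb[OF assms, of 1 1] by simp

lemma deriv_funpow_diff:
  assumes "open U" "kdiff n f U" "kdiff n g U" "k \<le> n" "x \<in> U"
  shows "(deriv ^^ k) (\<lambda>x. f x - g x) x = (deriv ^^ k) f x - (deriv ^^ k) g x"
  using deriv_funpow_lincomb[OF assms, of 1 "-1"] by simp

lemma deriv_funpow_const: "(deriv ^^ k) (\<lambda>_. c) = (\<lambda>_. if k = 0 then c else (0::real))"
proof (induction k)
  case (Suc k)
  have "deriv (\<lambda>x. if k = 0 then c else 0) = (\<lambda>_. 0)"
    by (cases "k = 0") (auto simp: fun_eq_iff)
  with Suc show ?case by simp
qed auto

lemma kdiff_const [simp]: "kdiff n (\<lambda>_. c) U"
  unfolding kdiff_def deriv_funpow_const by auto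

lemma kdiff_mult:
  assumes "open U"
  shows "kdiff n f U \<Longrightarrow> kdiff n g U \<Longrightarrow> kdiff n (\<lambda>x. f x * g x) U"
proof (induction n arbitrary: f g)
  case (Suc n)
  have "((\<lambda>x. f x * g x) has_real_derivative f x * deriv g x + deriv f x * g x) (at x)"
    if "x \<in> U" for x
    using Suc.prems that by (auto intro!: derivative_eq_intros dest: kdiff_deriv)
  moreover have "kdiff n (\<lambda>x. f x * deriv g x) U" "kdiff n (\<lambda>x. deriv f x * g x) U"
    using Suc.IH[of f "deriv g"] Suc.IH[of "deriv f" g] Suc.prems kdiff_mono[of "Suc n" _ U n U]
    by (auto simp: kdiff_Suc)
  ultimately show ?case
    by (intro has_deriv_kdiff_Suc[OF assms _ kdiff_add[OF assms]])
qed auto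

lemma deriv_funpow_mult:
  assumes "open U"
  shows "kdiff n f U \<Longrightarrow> kdiff n g U \<Longrightarrow> k \<le> n \<Longrightarrow> x \<in> U \<Longrightarrow>
    (deriv ^^ k) (\<lambda>x. f x * g x) x = (\<Sum>i\<le>k. real (k choose i) * (deriv ^^ i) f x * (deriv ^^ (k - i)) g x)"
proof (induction k arbitrary: x)
  case (Suc k)
  have "(deriv ^^ Suc k) (\<lambda>x. f x * g x) x =
      deriv (\<lambda>y. \<Sum>i\<le>k. real (k choose i) * (deriv ^^ i) f y * (deriv ^^ (k - i)) g y) x"
    using eventually_nhds_in_open[OF assms \<open>x \<in> U\<close>] Suc
    by (auto intro!: deriv_cong_ev elim!: eventually_mono)
  also have "\<dots> = (\<Sum>i\<le>k. real (k choose i) * ((deriv ^^ Suc i) f x * (deriv ^^ (k - i)) g x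
      + (deriv ^^ i) f x * (deriv ^^ (Suc k - i)) g x))"
  proof (rule DERIV_imp_deriv, rule derivative_eq_intros)
    fix i assume "i \<in> {..k}"
    then have "((deriv ^^ i) f has_real_derivative (deriv ^^ Suc i) f x) (at x)"
      "((deriv ^^ (k - i)) g has_real_derivative (deriv ^^ (Suc k - i)) g x) (at x)"
      using kdiff_deriv_funpow[OF Suc.prems(1), of i x] kdiff_deriv_funpow[OF Suc.prems(2), of "k - i" x]
        Suc.prems by (auto simp: Suc_diff_le)
    then show "((\<lambda>y. real (k choose i) * (deriv ^^ i) f y * (deriv ^^ (k - i)) g y) has_real_derivative
      real (k choose i) * ((deriv ^^ Suc i) f x * (deriv ^^ (k - i)) g x
      + (deriv ^^ i) f x * (deriv ^^ (Suc k - i)) g x)) (at x)"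
      by (auto intro!: derivative_eq_intros simp: algebra_simps)
  qed auto
  also have "\<dots> = (\<Sum>i\<le>k. real (k choose i) * ((deriv ^^ Suc i) f x * (deriv ^^ (Suc k - Suc i)) g x))
      + (\<Sum>i\<le>k. real (k choose i) * ((deriv ^^ i) f x * (deriv ^^ (Suc k - i)) g x))"
    by (simp add: sum.distrib algebra_simps)
  \<comment> \<open>The added term i = Suc k vanishes with its binomial coefficient. After splitting
    off i = 0 both sums run over the same index and Pascal's rule joins them.\<close>
  also have "(\<Sum>i\<le>k. real (k choose i) * ((deriv ^^ i) f x * (deriv ^^ (Suc k - i)) g x)) =
     (\<Sum>i\<le>Suc k. real (k choose i) * ((deriv ^^ i) f x * (deriv ^^ (Suc k - i)) g x))"
    by simp
  also have "\<dots> = f x * (deriv ^^ Suc k) g x +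
     (\<Sum>i\<le>k. real (k choose Suc i) * ((deriv ^^ Suc i) f x * (deriv ^^ (Suc k - Suc i)) g x))"
    by (subst sum.atMost_Suc_shift) simp
  also have "(\<Sum>i\<le>k. real (k choose i) * ((deriv ^^ Suc i) f x * (deriv ^^ (Suc k - Suc i)) g x)) +
     (f x * (deriv ^^ Suc k) g x +
     (\<Sum>i\<le>k. real (k choose Suc i) * ((deriv ^^ Suc i) f x * (deriv ^^ (Suc k - Suc i)) g x))) =
     f x * (deriv ^^ Suc k) g x +
     (\<Sum>i\<le>k. real (Suc k choose Suc i) * (deriv ^^ Suc i) f x * (deriv ^^ (Suc k - Suc i)) g x)"
    by (simp add: sum.distrib algebra_simps)
  also have "\<dots> = (\<Sum>i\<le>Suc k. real (Suc k choose i) * (deriv ^^ i) f x * (deriv ^^ (Suc k - i)) g x)"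
    unfolding sum.atMost_Suc_shift[of _ k] by simp
  finally show ?case .
qed simp

section \<open>Regularity of solutions of polynomial systems\<close>

definition smooth_on :: "(real \<Rightarrow> real) \<Rightarrow> real set \<Rightarrow> bool" where
  "smooth_on f U \<longleftrightarrow> (\<forall>n. kdiff n f U)"

lemma cont_diff_on_iff_kdiff:
  assumes "open U"
  shows "cont_diff_on (enat n) f U \<longleftrightarrow> kdiff n f U \<and> continuous_on U ((deriv ^^ n) f)"
proof -
  have *: "g differentiable_on U \<longleftrightarrow> (\<forall>x\<in>U. g field_differentiable (at x))" for g :: "real \<Rightarrow> real"
    unfolding differentiable_on_def
    by (simp add: at_within_open[OF _ assms] real_differentiable_def field_differentiable_def)
  have "(\<forall>k. enat k < enat n \<longrightarrow> (deriv ^^ k) f differentiable_on U) \<longleftrightarrow> kdiff n f U"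
    by (simp add: * kdiff_def)
  then show ?thesis
    using kdiff_continuous_on[of n f U] unfolding cont_diff_on_def
    by (auto simp: order.order_iff_strict)
qed

lemma cont_diff_on_infinity_iff:
  assumes "open U"
  shows "cont_diff_on \<infinity> f U \<longleftrightarrow> smooth_on f U"
proof -
  have "cont_diff_on \<infinity> f U \<longleftrightarrow> (\<forall>n. cont_diff_on (enat n) f U)"
  proof
    show "cont_diff_on \<infinity> f U \<Longrightarrow> \<forall>n. cont_diff_on (enat n) f U"
      by (simp add: cont_diff_on_def)
    assume n: "\<forall>n. cont_diff_on (enat n) f U"
    have "(deriv ^^ k) f differentiable_on U" "continuous_on U ((deriv ^^ k) f)" for k
      using n[rule_format, of "Suc k"] by (simp_all add: cont_diff_on_def)
    then show "cont_diff_on \<infinity> f U" by (simp add: cont_diff_on_def)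
  qed
  also have "\<dots> \<longleftrightarrow> smooth_on f U"
    unfolding smooth_on_def cont_diff_on_iff_kdiff[OF assms]
    using kdiff_continuous_on[OF _ lessI] by blast
  finally show ?thesis .
qed

section \<open>Real analyticity through local holomorphic extensions\<close>

lemma deriv_funpow_of_real:
  fixes f :: "real \<Rightarrow> real"
  assumes "open V" "F holomorphic_on V" "open U"
    and "\<And>s. s \<in> U \<Longrightarrow> of_real s \<in> V \<and> F (of_real s) = of_real (f s)"
  shows "x \<in> U \<Longrightarrow> (deriv ^^ k) F (of_real x) = of_real ((deriv ^^ k) f x) \<and>
    (deriv ^^ k) f field_differentiable (at x)"
proof (induction k arbitrary: x)
  \<comment> \<open>On the real axis a complex derivative is the derivative in the real direction.
    Where the k-th derivative of F is real, its imaginary part is constantly 0, so the next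
    derivative is real as well and is carried by the real part.\<close>
  have step: "(\<And>s. s \<in> U \<Longrightarrow> (deriv ^^ k) F (of_real s) = of_real ((deriv ^^ k) f s)) \<Longrightarrow> x \<in> U \<Longrightarrow>
     ((deriv ^^ k) f has_real_derivative Re ((deriv ^^ Suc k) F (of_real x))) (at x) \<and>
     Im ((deriv ^^ Suc k) F (of_real x)) = 0" for k x
  proof -
    assume eq: "\<And>s. s \<in> U \<Longrightarrow> (deriv ^^ k) F (of_real s) = of_real ((deriv ^^ k) f s)" and x: "x \<in> U"
    have "(deriv ^^ k) F holomorphic_on V"
      using holomorphic_higher_deriv[OF assms(2,1)] .
    then have "((deriv ^^ k) F has_field_derivative (deriv ^^ Suc k) F (of_real x)) (at (of_real x))"
      using assms(1,4) x by (simp add: holomorphic_derivI)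
    then have v: "((\<lambda>s. (deriv ^^ k) F (of_real s)) has_vector_derivative (deriv ^^ Suc k) F (of_real x)) (at x)"
      by (rule has_vector_derivative_real_field)
    have re: "((\<lambda>s. Re ((deriv ^^ k) F (of_real s))) has_vector_derivative Re ((deriv ^^ Suc k) F (of_real x))) (at x)"
      using bounded_linear.has_vector_derivative[OF bounded_linear_Re v] .
    have im: "((\<lambda>s. Im ((deriv ^^ k) F (of_real s))) has_vector_derivative Im ((deriv ^^ Suc k) F (of_real x))) (at x)"
      using bounded_linear.has_vector_derivative[OF bounded_linear_Im v] .
    have "((deriv ^^ k) f has_vector_derivative Re ((deriv ^^ Suc k) F (of_real x))) (at x)"
      by (rule has_vector_derivative_transform_within_open[OF re \<open>open U\<close> x]) (simp add: eq)
    moreover have "((\<lambda>s. 0) has_vector_derivative Im ((deriv ^^ Suc k) F (of_real x))) (at x)"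
      by (rule has_vector_derivative_transform_within_open[OF im \<open>open U\<close> x]) (simp add: eq)
    then have "Im ((deriv ^^ Suc k) F (of_real x)) = 0"
      using vector_derivative_unique_at has_vector_derivative_const by blast
    ultimately show ?thesis by (simp add: has_real_derivative_iff_has_vector_derivative)
  qed
  {
    case 0
    then show ?case using step[of 0 x] assms(4) by (auto simp: field_differentiable_def)
  next
    case (Suc k)
    have 1: "((deriv ^^ k) f has_real_derivative Re ((deriv ^^ Suc k) F (of_real x))) (at x)"
      "Im ((deriv ^^ Suc k) F (of_real x)) = 0" if "x \<in> U" for x
      using step[of k x] Suc.IH that by auto
    have 2: "(deriv ^^ Suc k) F (of_real x) = of_real ((deriv ^^ Suc k) f x)" if "x \<in> U" for x
      using 1[OF that] by (simp add: DERIV_imp_deriv complex_eq_iff)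
    have "(deriv ^^ Suc k) f field_differentiable (at x)"
      using step[OF 2 Suc.prems] unfolding field_differentiable_def by blast
    with 2[OF Suc.prems] show ?case by blast
  }
qed

text \<open>A real power series converges on the complex disc of the same radius; conversely the
  Taylor coefficients of F at a real point are real, being derivatives along the real axis. In the
  complex form products and reciprocals are immediate.\<close>

lemma real_analytic_on_iff_holomorphic:
  "real_analytic_on f U \<longleftrightarrow> (\<forall>x\<in>U. \<exists>F. \<exists>e>0. F holomorphic_on ball (of_real x) e \<and>
     (\<forall>y. \<bar>y - x\<bar> < e \<longrightarrow> F (of_real y) = of_real (f y)))" (is "_ \<longleftrightarrow> (\<forall>x\<in>U. ?P x)")
proof -
  have "(\<exists>c. \<exists>e>0. \<forall>y. \<bar>y - x\<bar> < e \<longrightarrow> (\<lambda>n. c n * (y - x) ^ n) sums f y) \<longleftrightarrow> ?P x" (is "?L \<longleftrightarrow> _") for x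
  proof
    assume ?L
    then obtain c e where e: "e > 0" and c: "\<And>y. \<bar>y - x\<bar> < e \<Longrightarrow> (\<lambda>n. c n * (y - x) ^ n) sums f y"
      by (elim exE conjE) auto
    define F where "F = (\<lambda>z::complex. \<Sum>n. of_real (c n) * (z - of_real x) ^ n)"
    have "(\<lambda>n. of_real (c n) * (z - of_real x) ^ n) sums F z" if "z \<in> ball (of_real x) e" for z :: complex
    proof -
      have "norm (z - of_real x) < e" using that by (simp add: dist_norm norm_minus_commute)
      \<comment> \<open>The series converges at the real point x + \<rho>, hence at every complex z
        closer to x.\<close>
      then obtain \<rho> where \<rho>: "norm (z - of_real x) < \<rho>" "\<rho> < e" using dense by blast
      have "\<bar>\<rho>\<bar> < e" using \<rho> norm_ge_zero[of "z - of_real x"] by linarith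
      then have "summable (\<lambda>n. c n * \<rho> ^ n)" using c[of "x + \<rho>"] \<rho> by (auto simp: sums_iff)
      then have "summable (\<lambda>n. complex_of_real (c n) * of_real \<rho> ^ n)"
        using summable_of_real by fastforce
      then have "summable (\<lambda>n. complex_of_real (c n) * (z - of_real x) ^ n)"
        by (rule powser_inside) (use \<rho> in auto)
      then show ?thesis unfolding F_def by (rule summable_sums)
    qed
    then have "F holomorphic_on ball (of_real x) e"
      by (rule power_series_holomorphic)
    moreover have "F (of_real y) = of_real (f y)" if "\<bar>y - x\<bar> < e" for y
    proof -
      have "(\<lambda>n. complex_of_real (c n * (y - x) ^ n)) sums of_real (f y)"
        using c[OF that] by (simp only: sums_of_real_iff)
      then show ?thesis unfolding F_def by (simp add: sums_iff)
    qed
    ultimately show "?P x" using e by blast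
  next
    assume "?P x"
    then obtain F e where e: "e > 0" and F: "F holomorphic_on ball (of_real x) e"
      and eq: "\<And>y. \<bar>y - x\<bar> < e \<Longrightarrow> F (of_real y) = of_real (f y)"
      by blast
    have d: "(deriv ^^ k) F (of_real x) = of_real ((deriv ^^ k) f x)" for k
      using deriv_funpow_of_real[OF open_ball F open_ball[of x e], of f x k] e eq
      by (auto simp: dist_real_def abs_minus_commute)
    have "(\<lambda>n. (deriv ^^ n) f x / fact n * (y - x) ^ n) sums f y" if "\<bar>y - x\<bar> < e" for y
    proof -
      have "(\<lambda>n. (deriv ^^ n) F (of_real x) / fact n * (of_real y - of_real x) ^ n) sums F (of_real y)"
        by (rule holomorphic_power_series[OF F]) (use that in \<open>simp add: dist_real_def abs_minus_commute\<close>)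
      then have "(\<lambda>n. complex_of_real ((deriv ^^ n) f x / fact n * (y - x) ^ n)) sums of_real (f y)"
        by (simp add: d eq that)
      then show ?thesis by (simp only: sums_of_real_iff)
    qed
    with e show ?L by (intro exI[of _ "\<lambda>n. (deriv ^^ n) f x / fact n"] exI[of _ e]) simp
  qed
  then show ?thesis by (simp add: real_analytic_on_def)
qed

lemma real_analytic_on_cong:
  assumes "open U" "\<And>x. x \<in> U \<Longrightarrow> f x = g x" "real_analytic_on f U"
  shows "real_analytic_on g U"
  unfolding real_analytic_on_def
proof
  fix x assume x: "x \<in> U"
  obtain c e where "e > 0" "\<And>y. \<bar>y - x\<bar> < e \<Longrightarrow> (\<lambda>n. c n * (y - x) ^ n) sums f y"
    using bspec[OF assms(3)[unfolded real_analytic_on_def] x] by (elim exE conjE) auto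
  moreover obtain d where "d > 0" "ball x d \<subseteq> U" using assms(1) x openE by blast
  moreover have "f y = g y" if "\<bar>y - x\<bar> < d" for y
    using \<open>ball x d \<subseteq> U\<close> that by (intro assms(2)) (auto simp: subset_iff dist_real_def)
  ultimately have "min e d > 0 \<and> (\<forall>y. \<bar>y - x\<bar> < min e d \<longrightarrow> (\<lambda>n. c n * (y - x) ^ n) sums g y)"
    by (metis min_less_iff_conj)
  then show "\<exists>c. \<exists>e>0. \<forall>y. \<bar>y - x\<bar> < e \<longrightarrow> (\<lambda>n. c n * (y - x) ^ n) sums g y"
    by (intro exI[of _ c] exI[of _ "min e d"])
qed

lemma real_analytic_on_subset: "real_analytic_on f U \<Longrightarrow> V \<subseteq> U \<Longrightarrow> real_analytic_on f V"
  by (auto simp: real_analytic_on_def)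

lemma real_analytic_on_binop:
  assumes "real_analytic_on f U" "real_analytic_on g U"
    and hol: "\<And>F G S. F holomorphic_on S \<Longrightarrow> G holomorphic_on S \<Longrightarrow> (\<lambda>z. Op (F z) (G z)) holomorphic_on S"
    and real: "\<And>a b. Op (of_real a) (of_real b) = of_real (op a b)"
  shows "real_analytic_on (\<lambda>x. op (f x) (g x)) U"
  unfolding real_analytic_on_iff_holomorphic
proof
  fix x assume "x \<in> U"
  then obtain F d G e where F: "d > 0" "F holomorphic_on ball (of_real x) d"
      "\<forall>y. \<bar>y - x\<bar> < d \<longrightarrow> F (of_real y) = of_real (f y)"
    and G: "e > 0" "G holomorphic_on ball (of_real x) e"
      "\<forall>y. \<bar>y - x\<bar> < e \<longrightarrow> G (of_real y) = of_real (g y)"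
    using assms(1,2) unfolding real_analytic_on_iff_holomorphic by meson
  have "(\<lambda>z. Op (F z) (G z)) holomorphic_on ball (of_real x) (min d e)"
    using F(2) G(2) by (intro hol) (erule holomorphic_on_subset, simp add: subset_ball)+
  moreover have "\<forall>y. \<bar>y - x\<bar> < min d e \<longrightarrow> Op (F (of_real y)) (G (of_real y)) = of_real (op (f y) (g y))"
  proof (intro allI impI)
    fix y assume "\<bar>y - x\<bar> < min d e"
    then have "F (of_real y) = of_real (f y)" "G (of_real y) = of_real (g y)" using F(3) G(3) by auto
    then show "Op (F (of_real y)) (G (of_real y)) = of_real (op (f y) (g y))" by (simp only: real)
  qed
  moreover have "min d e > 0" using F G by simp
  ultimately show "\<exists>F. \<exists>e>0. F holomorphic_on ball (of_real x) e \<and>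
     (\<forall>y. \<bar>y - x\<bar> < e \<longrightarrow> F (of_real y) = of_real (op (f y) (g y)))"
    by (intro exI[of _ "\<lambda>z. Op (F z) (G z)"] exI[of _ "min d e"] conjI)
qed

lemma real_analytic_on_add:
  "real_analytic_on f U \<Longrightarrow> real_analytic_on g U \<Longrightarrow> real_analytic_on (\<lambda>x. f x + g x) U"
  by (rule real_analytic_on_binop[where Op = "(+)" and op = "(+)"]) (auto intro: holomorphic_on_add)

lemma real_analytic_on_mult:
  "real_analytic_on f U \<Longrightarrow> real_analytic_on g U \<Longrightarrow> real_analytic_on (\<lambda>x. f x * g x) U"
  by (rule real_analytic_on_binop[where Op = "(*)" and op = "(*)"]) (auto intro: holomorphic_on_mult)

lemma real_analytic_on_inverse:
  assumes "real_analytic_on f U" "\<And>x. x \<in> U \<Longrightarrow> f x \<noteq> 0"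
  shows "real_analytic_on (\<lambda>x. inverse (f x)) U"
  unfolding real_analytic_on_iff_holomorphic
proof
  fix x assume x: "x \<in> U"
  then obtain F d where F: "d > 0" "F holomorphic_on ball (of_real x) d"
      "\<forall>y. \<bar>y - x\<bar> < d \<longrightarrow> F (of_real y) = of_real (f y)"
    using assms(1) unfolding real_analytic_on_iff_holomorphic by meson
  have "isCont F (of_real x)"
    using F(1,2) by (metis centre_in_ball continuous_on_eq_continuous_at holomorphic_on_imp_continuous_on open_ball)
  moreover have "F (of_real x) \<noteq> 0" using F x assms(2) by simp
  ultimately obtain e where e: "e > 0" "\<And>z. dist (of_real x) z < e \<Longrightarrow> F z \<noteq> 0"
    using continuous_at_avoid by blast
  have "(\<lambda>z. inverse (F z)) holomorphic_on ball (of_real x) (min d e)"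
    using e by (intro holomorphic_on_inverse holomorphic_on_subset[OF F(2)]) (auto simp: subset_ball)
  moreover have "\<forall>y. \<bar>y - x\<bar> < min d e \<longrightarrow> inverse (F (of_real y)) = of_real (inverse (f y))"
  proof (intro allI impI)
    fix y assume "\<bar>y - x\<bar> < min d e"
    then have "F (of_real y) = of_real (f y)" using F(3) by simp
    then show "inverse (F (of_real y)) = of_real (inverse (f y))" by (simp only: of_real_inverse)
  qed
  moreover have "min d e > 0" using F e by simp
  ultimately show "\<exists>F. \<exists>e>0. F holomorphic_on ball (of_real x) e \<and>
     (\<forall>y. \<bar>y - x\<bar> < e \<longrightarrow> F (of_real y) = of_real (inverse (f y)))"
    by (intro exI[of _ "\<lambda>z. inverse (F z)"] exI[of _ "min d e"] conjI)
qed

text \<open>Points within e/4 of x carry discs of radius e/4 that stay in the closed disc of radius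
  e/2, where F is bounded by compactness. Cauchy's inequality then gives the ratio 4/e, uniformly in
  t and j. The last conclusion exports an extension of every derivative near every such t.\<close>

lemma real_analytic_on_bound:
  assumes "real_analytic_on f U" "x \<in> U"
  obtains s C r where "s > 0" "C \<ge> 0" "r \<ge> 1"
    "\<And>j t. \<bar>t - x\<bar> \<le> s \<Longrightarrow> \<bar>(deriv ^^ j) f t\<bar> \<le> C * fact j * r ^ j"
    "\<And>j t. \<bar>t - x\<bar> \<le> s \<Longrightarrow> (deriv ^^ j) f field_differentiable (at t)"
    "\<And>j t. \<bar>t - x\<bar> \<le> s \<Longrightarrow> \<exists>F e. e > 0 \<and> F holomorphic_on ball (of_real t) e \<and>
     (\<forall>y. \<bar>y - t\<bar> < e \<longrightarrow> F (of_real y) = of_real ((deriv ^^ j) f y))"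
proof -
  obtain F e where e: "e > 0" and F: "F holomorphic_on ball (of_real x) e"
    and eq: "\<And>y. \<bar>y - x\<bar> < e \<Longrightarrow> F (of_real y) = of_real (f y)"
    using assms unfolding real_analytic_on_iff_holomorphic by meson
  have d: "(deriv ^^ k) F (of_real t) = of_real ((deriv ^^ k) f t)"
      "(deriv ^^ k) f field_differentiable (at t)" if "\<bar>t - x\<bar> < e" for k t
    using deriv_funpow_of_real[OF open_ball F open_ball[of x e], of f t k] e eq that
    by (auto simp: dist_real_def abs_minus_commute)
  have "compact (F ` cball (of_real x) (e / 2))"
    by (intro compact_continuous_image holomorphic_on_imp_continuous_on holomorphic_on_subset[OF F])
       (use e in auto)
  then obtain B where B: "B > 0" "\<And>z. z \<in> cball (of_real x) (e / 2) \<Longrightarrow> norm (F z) \<le> B"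
    using compact_imp_bounded bounded_pos by (metis imageI)
  define r where "r = max 1 (4 / e)"
  have "\<bar>(deriv ^^ j) f t\<bar> \<le> B * fact j * r ^ j" if t: "\<bar>t - x\<bar> \<le> e / 4" for j t
  proof -
    have sub: "cball (of_real t) (e / 4) \<subseteq> cball (complex_of_real x) (e / 2)"
    proof
      fix z :: complex assume "z \<in> cball (of_real t) (e / 4)"
      then have "dist (of_real x) z \<le> dist (complex_of_real x) (of_real t) + e / 4"
        using dist_triangle[of "of_real x" z "of_real t"] by simp
      with t show "z \<in> cball (complex_of_real x) (e / 2)"
        by (simp add: dist_real_def abs_minus_commute)
    qed
    have "cball (complex_of_real x) (e/2) \<subseteq> ball (of_real x) e" using e by auto
    then have sub': "cball (of_real t) (e / 4) \<subseteq> ball (complex_of_real x) e" using sub by blast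
    have "norm ((deriv ^^ j) F (of_real t)) \<le> fact j * B / (e / 4) ^ j"
    proof (rule Cauchy_inequality)
      show "F holomorphic_on ball (of_real t) (e / 4)"
        using F by (rule holomorphic_on_subset) (use sub' ball_subset_cball in blast)
      show "continuous_on (cball (of_real t) (e / 4)) F"
        using holomorphic_on_imp_continuous_on[OF F] continuous_on_subset sub' by blast
      show "norm (F z) \<le> B" if "norm (of_real t - z) = e / 4" for z
        using sub that by (intro B) (auto simp: dist_norm subset_iff)
    qed (use e in auto)
    moreover have "norm ((deriv ^^ j) F (of_real t)) = \<bar>(deriv ^^ j) f t\<bar>"
      using d(1)[of t j] t e by simp
    moreover have "fact j * B / (e / 4) ^ j = B * fact j * (4 / e) ^ j" by (simp add: field_simps)
    moreover have "B * fact j * (4 / e) ^ j \<le> B * fact j * r ^ j"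
      using B(1) e by (intro mult_left_mono power_mono) (auto simp: r_def)
    ultimately show ?thesis by linarith
  qed
  moreover have "\<exists>F e. e > 0 \<and> F holomorphic_on ball (of_real t) e \<and>
     (\<forall>y. \<bar>y - t\<bar> < e \<longrightarrow> F (of_real y) = of_real ((deriv ^^ j) f y))" if t: "\<bar>t - x\<bar> \<le> e / 4" for j t
  proof -
    have "ball (of_real t) (e/2) \<subseteq> ball (complex_of_real x) e"
    proof
      fix z :: complex assume "z \<in> ball (of_real t) (e / 2)"
      then have "dist (of_real x) z < dist (complex_of_real x) (of_real t) + e / 2"
        using dist_triangle[of "of_real x" z "of_real t"] by simp
      with t e show "z \<in> ball (complex_of_real x) e"
        by (simp add: dist_real_def abs_minus_commute)
    qed
    then have "(deriv ^^ j) F holomorphic_on ball (of_real t) (e/2)"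
      using holomorphic_higher_deriv[OF F open_ball, of j] holomorphic_on_subset by blast
    moreover have "\<forall>y. \<bar>y - t\<bar> < e/2 \<longrightarrow> (deriv ^^ j) F (of_real y) = of_real ((deriv ^^ j) f y)"
      using d(1)[of _ j] t e by (auto simp: abs_if split: if_splits)
    ultimately show ?thesis using e by (metis half_gt_zero)
  qed
  moreover have "(deriv ^^ j) f field_differentiable (at t)" if "\<bar>t - x\<bar> \<le> e / 4" for j t
    using d(2) that e by simp
  moreover have "e / 4 > 0" "B \<ge> 0" "r \<ge> 1" using e B(1) by (auto simp: r_def)
  ultimately show ?thesis by (intro that[of "e / 4" B r])
qed

lemma real_analytic_on_imp_smooth: "real_analytic_on f U \<Longrightarrow> smooth_on f U"
  unfolding smooth_on_def kdiff_def
proof safe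
  fix k x assume "real_analytic_on f U" "x \<in> U"
  then show "(deriv ^^ k) f field_differentiable (at x)"
  proof (rule real_analytic_on_bound)
    fix s C r :: real
    assume "s > 0" and *: "\<And>j t. \<bar>t - x\<bar> \<le> s \<Longrightarrow> (deriv ^^ j) f field_differentiable (at t)"
    have "\<bar>x - x\<bar> \<le> s" using \<open>s > 0\<close> by simp
    from *[OF this] show ?thesis .
  qed
qed

lemma real_analytic_on_deriv: "real_analytic_on f U \<Longrightarrow> real_analytic_on (deriv f) U"
  unfolding real_analytic_on_iff_holomorphic[of "deriv f"]
proof
  fix x assume "real_analytic_on f U" "x \<in> U"
  then obtain s where "s > 0" and *: "\<And>j t. \<bar>t - x\<bar> \<le> s \<Longrightarrow> \<exists>F e. e > 0 \<and> F holomorphic_on ball (of_real t) e \<and>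
     (\<forall>y. \<bar>y - t\<bar> < e \<longrightarrow> F (of_real y) = of_real ((deriv ^^ j) f y))"
    by (rule real_analytic_on_bound) (rule that)
  from *[of x 1] \<open>s > 0\<close> show "\<exists>F. \<exists>e>0. F holomorphic_on ball (of_real x) e \<and>
     (\<forall>y. \<bar>y - x\<bar> < e \<longrightarrow> F (of_real y) = of_real (deriv f y))" by auto
qed

text \<open>Lagrange's form of the remainder; the bound is asked uniformly near x because the
  intermediate point is unknown.\<close>

lemma real_analytic_onI_bound:
  assumes "open U" "smooth_on f U"
    and "\<And>x. x \<in> U \<Longrightarrow> \<exists>s>0. \<exists>C\<ge>0. \<exists>r\<ge>1. \<forall>j t. \<bar>t - x\<bar> \<le> s \<longrightarrow> \<bar>(deriv ^^ j) f t\<bar> \<le> C * fact j * r ^ j"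
  shows "real_analytic_on f U"
  unfolding real_analytic_on_def
proof
  fix x assume x: "x \<in> U"
  obtain s C r where s: "s > 0" and C: "C \<ge> 0" and r: "r \<ge> 1"
    and b: "\<And>j t. \<bar>t - x\<bar> \<le> s \<Longrightarrow> \<bar>(deriv ^^ j) f t\<bar> \<le> C * fact j * r ^ j"
    using assms(3)[OF x] by blast
  obtain d where d: "d > 0" "ball x d \<subseteq> U" using assms(1) x openE by blast
  \<comment> \<open>The radius 1/(2r) bounds the n-th remainder by C/2^n.\<close>
  define e where "e = Min {s, d, 1 / (2 * r)}"
  have e: "e > 0" "e \<le> s" "e \<le> d" "e \<le> 1 / (2 * r)" using s d r by (auto simp: e_def)
  have "(\<lambda>n. (deriv ^^ n) f x / fact n * (y - x) ^ n) sums f y" if y: "\<bar>y - x\<bar> < e" for y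
  proof (cases "y = x")
    case True
    then show ?thesis using powser_sums_zero[of "\<lambda>n. (deriv ^^ n) f x / fact n"] by simp
  next
    case False
    have bd: "\<bar>f y - (\<Sum>m<n. (deriv ^^ m) f x / fact m * (y - x) ^ m)\<bar> \<le> C * (1/2) ^ n" if "n > 0" for n
    proof -
      define e' where "e' = \<bar>y - x\<bar>"
      have "\<forall>m t. m < n \<and> x - e' \<le> t \<and> t \<le> x + e' \<longrightarrow> DERIV ((deriv ^^ m) f) t :> (deriv ^^ Suc m) f t"
      proof safe
        fix m t assume t: "x - e' \<le> t" "t \<le> x + e'" and "m < n"
        then have "\<bar>t - x\<bar> < e" using y e'_def by linarith
        then have "t \<in> U" using d e by (auto simp: subset_iff dist_real_def abs_minus_commute)
        then show "DERIV ((deriv ^^ m) f) t :> (deriv ^^ Suc m) f t"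
          using assms(2) kdiff_deriv_funpow[of "Suc m" f U m t] by (auto simp: smooth_on_def)
      qed
      then have "\<exists>t. (if y < x then y < t \<and> t < x else x < t \<and> t < y) \<and>
        f y = (\<Sum>m<n. (deriv ^^ m) f x / fact m * (y - x) ^ m) + (deriv ^^ n) f t / fact n * (y - x) ^ n"
        by (intro Taylor[OF \<open>n > 0\<close>]) (use False in \<open>auto simp: e'_def\<close>)
      then obtain t where t: "if y < x then y < t \<and> t < x else x < t \<and> t < y"
        "f y = (\<Sum>m<n. (deriv ^^ m) f x / fact m * (y - x) ^ m) + (deriv ^^ n) f t / fact n * (y - x) ^ n"
        by (elim exE conjE)
      have "\<bar>t - x\<bar> \<le> s" using t(1) y e by (auto split: if_splits)
      have "\<bar>(deriv ^^ n) f t / fact n * (y - x) ^ n\<bar> \<le> (C * fact n * r ^ n) / fact n * \<bar>y - x\<bar> ^ n"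
      proof -
        have "\<bar>(deriv ^^ n) f t / fact n * (y - x) ^ n\<bar> = \<bar>(deriv ^^ n) f t\<bar> / fact n * \<bar>y - x\<bar> ^ n"
          by (simp add: abs_mult power_abs)
        then show ?thesis using b[OF \<open>\<bar>t - x\<bar> \<le> s\<close>]
          by (simp only:) (intro mult_right_mono divide_right_mono; simp)
      qed
      also have "\<dots> = C * (r * \<bar>y - x\<bar>) ^ n" by (simp add: power_mult_distrib)
      also have "\<dots> \<le> C * (1/2) ^ n"
      proof (intro mult_left_mono power_mono)
        have "\<bar>y - x\<bar> \<le> 1 / (2 * r)" using y e by linarith
        then show "r * \<bar>y - x\<bar> \<le> 1/2" using r by (simp add: field_simps)
      qed (use C r in auto)
      finally show ?thesis using t(2) by simp
    qed
    have lim: "(\<lambda>n. C * (1/2::real) ^ n) \<longlonglongrightarrow> 0"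
      by (intro tendsto_mult_right_zero LIMSEQ_power_zero) auto
    have "(\<lambda>n. f y - (\<Sum>m<n. (deriv ^^ m) f x / fact m * (y - x) ^ m)) \<longlonglongrightarrow> 0"
    proof (rule Lim_null_comparison[OF _ lim])
      show "\<forall>\<^sub>F n in sequentially. norm (f y - (\<Sum>m<n. (deriv ^^ m) f x / fact m * (y - x) ^ m)) \<le> C * (1/2) ^ n"
        using eventually_gt_at_top[of 0] by eventually_elim (use bd in simp)
    qed
    from tendsto_diff[OF tendsto_const[of "f y"] this] show ?thesis unfolding sums_def by simp
  qed
  with e(1) show "\<exists>c. \<exists>e>0. \<forall>y. \<bar>y - x\<bar> < e \<longrightarrow> (\<lambda>n. c n * (y - x) ^ n) sums f y"
    by (intro exI[of _ "\<lambda>n. (deriv ^^ n) f x / fact n"] exI[of _ e]) simp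
qed

section \<open>Solutions of polynomial systems: smooth, and analytic by majorants\<close>

inductive_set rgen :: "(real \<Rightarrow> real) set \<Rightarrow> (real \<Rightarrow> real) set" for B where
  base: "b \<in> B \<Longrightarrow> b \<in> rgen B"
| add: "f \<in> rgen B \<Longrightarrow> g \<in> rgen B \<Longrightarrow> (\<lambda>t. f t + g t) \<in> rgen B"
| mult: "f \<in> rgen B \<Longrightarrow> g \<in> rgen B \<Longrightarrow> (\<lambda>t. f t * g t) \<in> rgen B"

lemma rgen_deriv:
  assumes "\<And>b. b \<in> B \<Longrightarrow> \<exists>e\<in>rgen B. \<forall>t\<in>U. (b has_real_derivative e t) (at t)"
  shows "h \<in> rgen B \<Longrightarrow> \<exists>e\<in>rgen B. \<forall>t\<in>U. (h has_real_derivative e t) (at t)"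
proof (induction rule: rgen.induct)
  case (add f g)
  then obtain d e where "d \<in> rgen B" "e \<in> rgen B" "\<forall>t\<in>U. (f has_real_derivative d t) (at t)"
    "\<forall>t\<in>U. (g has_real_derivative e t) (at t)" by blast
  then show ?case
    by (intro bexI[of _ "\<lambda>t. d t + e t"]) (auto intro: rgen.add DERIV_add)
next
  case (mult f g)
  then obtain d e where "d \<in> rgen B" "e \<in> rgen B" "\<forall>t\<in>U. (f has_real_derivative d t) (at t)"
    "\<forall>t\<in>U. (g has_real_derivative e t) (at t)" by blast
  with mult show ?case
    by (intro bexI[of _ "\<lambda>t. d t * g t + e t * f t"] ballI rgen.add rgen.mult DERIV_mult) auto
qed (rule assms)

text \<open>\<open>rgen B\<close> is closed under differentiation on U, so the induction on the
  order treats all its elements at once and never writes down a higher derivative.\<close>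

lemma rgen_smooth:
  assumes "open U" "\<And>b. b \<in> B \<Longrightarrow> \<exists>e\<in>rgen B. \<forall>t\<in>U. (b has_real_derivative e t) (at t)"
    and "h \<in> rgen B"
  shows "smooth_on h U"
proof -
  have "\<forall>h\<in>rgen B. kdiff n h U" for n
  proof (induction n)
    case (Suc n)
    show ?case
    proof
      fix h assume "h \<in> rgen B"
      then obtain e where "e \<in> rgen B" "\<forall>t\<in>U. (h has_real_derivative e t) (at t)"
        using rgen_deriv[OF assms(2)] by meson
      then show "kdiff (Suc n) h U" using Suc by (intro has_deriv_kdiff_Suc[OF assms(1)]) auto
    qed
  qed auto
  with assms(3) show ?thesis by (simp add: smooth_on_def)
qed

lemma polynomial_system_smooth:
  assumes "open U" "\<And>y. y \<in> Y \<Longrightarrow> \<exists>e\<in>rgen ({c. smooth_on c U} \<union> Y). \<forall>t\<in>U. (y has_real_derivative e t) (at t)"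
    and "y \<in> Y"
  shows "smooth_on y U"
proof (rule rgen_smooth[OF assms(1)])
  fix b assume "b \<in> {c. smooth_on c U} \<union> Y"
  then show "\<exists>e\<in>rgen ({c. smooth_on c U} \<union> Y). \<forall>t\<in>U. (b has_real_derivative e t) (at t)"
  proof
    assume "b \<in> {c. smooth_on c U}"
    then have "kdiff (Suc n) b U" for n by (simp add: smooth_on_def)
    then have "smooth_on (deriv b) U" "\<forall>t\<in>U. (b has_real_derivative deriv b t) (at t)"
      using kdiff_deriv[of 0 b U] by (auto simp: smooth_on_def kdiff_Suc)
    then show ?thesis by (intro bexI[of _ "deriv b"] rgen.base) auto
  qed (rule assms(2))
qed (use assms in \<open>auto intro: rgen.base\<close>)

text \<open>
  The weight \<open>1 / (j + 1)\<^sup>2\<close> makes this majorant stable under products up to a constant factor.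
\<close>

definition deriv_bd :: "real \<Rightarrow> real \<Rightarrow> nat \<Rightarrow> (real \<Rightarrow> real) \<Rightarrow> real \<Rightarrow> real \<Rightarrow> bool" where
  "deriv_bd x s k h C r \<longleftrightarrow>
    (\<forall>j\<le>k. \<forall>t. \<bar>t - x\<bar> \<le> s \<longrightarrow> \<bar>(deriv ^^ j) h t\<bar> \<le> C * fact j * r ^ j / (real j + 1)\<^sup>2)"

text \<open>Telescoping: the correction term 1/(k + 1) is what the induction step feeds on.\<close>

lemma sum_inverse_squares_le: "(\<Sum>i\<le>k. 1 / (real i + 1)\<^sup>2) \<le> 2 - 1 / (real k + 1)"
proof (induction k)
  case (Suc k)
  have "1 / (real k + 2)\<^sup>2 \<le> 1 / (real k + 1) - 1 / (real k + 2)"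
    by (simp add: divide_simps) (simp add: power2_eq_square algebra_simps)
  with Suc show ?case by (simp add: add_ac)
qed simp

text \<open>With a = i + 1 and b = k - i + 1 one has k + 1 \<le> a + b, so (k + 1)^2 \<le> 2 a^2 + 2
  b^2. Dividing by a^2 b^2 leaves two sums of inverse squares, each at most 2 and each with factor
  2, whence the 8.\<close>

lemma weight_convolution:
  "(\<Sum>i\<le>k. 1 / ((real i + 1)\<^sup>2 * (real (k - i) + 1)\<^sup>2)) \<le> 8 / (real k + 1)\<^sup>2"
proof -
  have "1 / ((real i + 1)\<^sup>2 * (real (k - i) + 1)\<^sup>2) \<le>
      (2 / (real i + 1)\<^sup>2 + 2 / (real (k - i) + 1)\<^sup>2) / (real k + 1)\<^sup>2" if "i \<le> k" for i
  proof -
    define a b where "a = real i + 1" and "b = real (k - i) + 1"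
    have ab: "a > 0" "b > 0" "real k + 1 \<le> a + b" "real k + 1 > 0"
      using that by (auto simp: a_def b_def of_nat_diff)
    have "(real k + 1)\<^sup>2 \<le> (a + b)\<^sup>2" using ab by (intro power_mono) auto
    also have "\<dots> \<le> 2 * a\<^sup>2 + 2 * b\<^sup>2" using sum_squares_bound[of a b] by (simp add: power2_sum)
    finally have "(real k + 1)\<^sup>2 / (a\<^sup>2 * b\<^sup>2) \<le> (2 * a\<^sup>2 + 2 * b\<^sup>2) / (a\<^sup>2 * b\<^sup>2)"
      by (rule divide_right_mono) auto
    also have "\<dots> = 2 / a\<^sup>2 + 2 / b\<^sup>2" using ab by (simp add: field_simps)
    finally show ?thesis using ab unfolding a_def[symmetric] b_def[symmetric]
      by (simp add: pos_le_divide_eq)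
  qed
  then have "(\<Sum>i\<le>k. 1 / ((real i + 1)\<^sup>2 * (real (k - i) + 1)\<^sup>2)) \<le>
      (\<Sum>i\<le>k. (2 / (real i + 1)\<^sup>2 + 2 / (real (k - i) + 1)\<^sup>2) / (real k + 1)\<^sup>2)"
    by (intro sum_mono) auto
  also have "\<dots> = (2 * (\<Sum>i\<le>k. 1 / (real i + 1)\<^sup>2) + 2 * (\<Sum>i\<le>k. 1 / (real (k - i) + 1)\<^sup>2)) / (real k + 1)\<^sup>2"
    by (simp add: sum.distrib sum_distrib_left flip: sum_divide_distrib)
  also have "(\<Sum>i\<le>k. 1 / (real (k - i) + 1)\<^sup>2) = (\<Sum>i\<le>k. 1 / (real i + 1)\<^sup>2)"
    using sum.nat_diff_reindex[of "\<lambda>i. 1 / (real i + 1)\<^sup>2" "Suc k"] by (simp only: lessThan_Suc_atMost diff_Suc_Suc)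
  also have "(2 * (\<Sum>i\<le>k. 1 / (real i + 1)\<^sup>2) + 2 * (\<Sum>i\<le>k. 1 / (real i + 1)\<^sup>2)) / (real k + 1)\<^sup>2 \<le> 8 / (real k + 1)\<^sup>2"
  proof (rule divide_right_mono)
    have "1 / (real k + 1) > 0" by simp
    then show "2 * (\<Sum>i\<le>k. 1 / (real i + 1)\<^sup>2) + 2 * (\<Sum>i\<le>k. 1 / (real i + 1)\<^sup>2) \<le> 8"
      using sum_inverse_squares_le[of k] by linarith
  qed simp
  finally show ?thesis .
qed

lemma deriv_bd_add:
  assumes "open U" "smooth_on f U" "smooth_on g U" "\<And>t. \<bar>t - x\<bar> \<le> s \<Longrightarrow> t \<in> U"
    and f: "deriv_bd x s k f C r" and g: "deriv_bd x s k g D r"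
  shows "deriv_bd x s k (\<lambda>t. f t + g t) (C + D) r"
  unfolding deriv_bd_def
proof (intro allI impI)
  fix j t assume j: "j \<le> k" and t: "\<bar>t - x\<bar> \<le> s"
  have "(deriv ^^ j) (\<lambda>t. f t + g t) t = (deriv ^^ j) f t + (deriv ^^ j) g t"
    using assms t by (intro deriv_funpow_add[where n = j]) (auto simp: smooth_on_def)
  also have "\<bar>\<dots>\<bar> \<le> C * fact j * r ^ j / (real j + 1)\<^sup>2 + D * fact j * r ^ j / (real j + 1)\<^sup>2"
    using f g j t unfolding deriv_bd_def by (intro order_trans[OF abs_triangle_ineq] add_mono) auto
  also have "\<dots> = (C + D) * fact j * r ^ j / (real j + 1)\<^sup>2" by (simp add: field_simps)
  finally show "\<bar>(deriv ^^ j) (\<lambda>t. f t + g t) t\<bar> \<le> (C + D) * fact j * r ^ j / (real j + 1)\<^sup>2" .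
qed

text \<open>Leibniz's formula turns the two majorants into \<open>fact j * r ^ j\<close> times the
  convolution of the weights, which costs only the factor 8.\<close>

lemma deriv_bd_mult:
  assumes "open U" "smooth_on f U" "smooth_on g U" "\<And>t. \<bar>t - x\<bar> \<le> s \<Longrightarrow> t \<in> U" "C \<ge> 0" "D \<ge> 0" "r \<ge> 0"
    and f: "deriv_bd x s k f C r" and g: "deriv_bd x s k g D r"
  shows "deriv_bd x s k (\<lambda>t. f t * g t) (8 * C * D) r"
  unfolding deriv_bd_def
proof (intro allI impI)
  fix j t assume j: "j \<le> k" and t: "\<bar>t - x\<bar> \<le> s"
  have "(deriv ^^ j) (\<lambda>t. f t * g t) t =
      (\<Sum>i\<le>j. real (j choose i) * (deriv ^^ i) f t * (deriv ^^ (j - i)) g t)"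
    using assms t by (intro deriv_funpow_mult[where n = j]) (auto simp: smooth_on_def)
  then have "\<bar>(deriv ^^ j) (\<lambda>t. f t * g t) t\<bar> =
      \<bar>\<Sum>i\<le>j. real (j choose i) * (deriv ^^ i) f t * (deriv ^^ (j - i)) g t\<bar>"
    by (rule arg_cong)
  also have "\<dots> \<le> (\<Sum>i\<le>j. C * D * fact j * r ^ j * (1 / ((real i + 1)\<^sup>2 * (real (j - i) + 1)\<^sup>2)))"
  proof (rule order_trans[OF sum_abs sum_mono])
    fix i assume "i \<in> {..j}"
    then have i: "i \<le> j" by simp
    have "\<bar>real (j choose i) * (deriv ^^ i) f t * (deriv ^^ (j - i)) g t\<bar> =
        real (j choose i) * (\<bar>(deriv ^^ i) f t\<bar> * \<bar>(deriv ^^ (j - i)) g t\<bar>)"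
      by (simp add: abs_mult)
    also have "\<dots> \<le> real (j choose i) * ((C * fact i * r ^ i / (real i + 1)\<^sup>2) *
        (D * fact (j - i) * r ^ (j - i) / (real (j - i) + 1)\<^sup>2))"
      using f g i j t assms(5-7) unfolding deriv_bd_def by (intro mult_left_mono mult_mono) (auto simp del: of_nat_diff)
    also have "\<dots> = C * D * (real (j choose i) * fact i * fact (j - i)) * (r ^ i * r ^ (j - i)) *
        (1 / ((real i + 1)\<^sup>2 * (real (j - i) + 1)\<^sup>2))"
      by (simp add: field_simps)
    also have "real (j choose i) * fact i * fact (j - i) = fact j"
      using binomial_fact_lemma[OF i] by (metis (no_types) mult.assoc mult.commute of_nat_fact of_nat_mult)
    also have "r ^ i * r ^ (j - i) = r ^ j" using i by (simp flip: power_add)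
    finally show "\<bar>real (j choose i) * (deriv ^^ i) f t * (deriv ^^ (j - i)) g t\<bar> \<le>
      C * D * fact j * r ^ j * (1 / ((real i + 1)\<^sup>2 * (real (j - i) + 1)\<^sup>2))" .
  qed
  also have "\<dots> = C * D * fact j * r ^ j * (\<Sum>i\<le>j. 1 / ((real i + 1)\<^sup>2 * (real (j - i) + 1)\<^sup>2))"
    by (rule sum_distrib_left[symmetric])
  also have "\<dots> \<le> C * D * fact j * r ^ j * (8 / (real j + 1)\<^sup>2)"
    using assms(5-7) by (intro mult_left_mono weight_convolution) auto
  also have "\<dots> = 8 * C * D * fact j * r ^ j / (real j + 1)\<^sup>2" by simp
  finally show "\<bar>(deriv ^^ j) (\<lambda>t. f t * g t) t\<bar> \<le> 8 * C * D * fact j * r ^ j / (real j + 1)\<^sup>2" .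
qed

lemma real_analytic_on_deriv_bd:
  assumes "real_analytic_on c U" "x \<in> U"
  obtains s0 C r0 where "s0 > 0" "C \<ge> 0" "r0 \<ge> 1"
    "\<And>s r k. s \<le> s0 \<Longrightarrow> r \<ge> r0 \<Longrightarrow> deriv_bd x s k c C r"
proof -
  obtain s0 C r where s0: "s0 > 0" and C: "C \<ge> 0" and r: "r \<ge> 1"
    and b: "\<And>j t. \<bar>t - x\<bar> \<le> s0 \<Longrightarrow> \<bar>(deriv ^^ j) c t\<bar> \<le> C * fact j * r ^ j"
    by (rule real_analytic_on_bound[OF assms]) (rule that)
  have "deriv_bd x s k c C q" if "s \<le> s0" "q \<ge> 4 * r" for s q k
    unfolding deriv_bd_def
  proof (intro allI impI)
    fix j t assume "j \<le> k" "\<bar>t - x\<bar> \<le> s"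
    \<comment> \<open>The weight is paid for by the ratio: (j + 1)^2 \<le> 4^j, whence the factor 4
      in front of r.\<close>
    have "real j + 1 \<le> 2 ^ j"
      by (induction j) auto
    then have "(real j + 1)\<^sup>2 \<le> (2 ^ j)\<^sup>2" by (intro power_mono) auto
    also have "(2 ^ j)\<^sup>2 = (4::real) ^ j"
      by (simp add: power_even_eq[symmetric] power_mult)
    finally have "r ^ j * (real j + 1)\<^sup>2 \<le> r ^ j * 4 ^ j" using r by (intro mult_left_mono) auto
    also have "\<dots> = (4 * r) ^ j" by (simp add: power_mult_distrib)
    also have "\<dots> \<le> q ^ j" using that r by (intro power_mono) auto
    finally have "r ^ j \<le> q ^ j / (real j + 1)\<^sup>2" by (simp add: pos_le_divide_eq add_pos_nonneg)
    then have "C * fact j * r ^ j \<le> C * fact j * (q ^ j / (real j + 1)\<^sup>2)"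
      using C by (intro mult_left_mono) auto
    with b[of t j] that \<open>\<bar>t - x\<bar> \<le> s\<close> show "\<bar>(deriv ^^ j) c t\<bar> \<le> C * fact j * q ^ j / (real j + 1)\<^sup>2"
      by simp
  qed
  then show ?thesis using s0 C r by (intro that[of s0 C "4 * r"]) auto
qed

text \<open>The order of the quantifiers is the point: D, s0 and r0 are fixed before the radius s,
  the ratio r and the order k, so that r may later be taken large compared with D.\<close>

lemma rgen_deriv_bd:
  assumes "open U" "x \<in> U" "\<And>h. h \<in> rgen ({c. real_analytic_on c U} \<union> Y) \<Longrightarrow> smooth_on h U" "C \<ge> 0"
    and "h \<in> rgen ({c. real_analytic_on c U} \<union> Y)"
  shows "\<exists>s0>0. \<exists>D\<ge>0. \<exists>r0\<ge>1. \<forall>s\<le>s0. \<forall>r\<ge>r0. \<forall>k. (\<forall>y\<in>Y. deriv_bd x s k y C r) \<longrightarrow> deriv_bd x s k h D r"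
  using assms(5)
proof (induction rule: rgen.induct)
  case (base b)
  then show ?case
  proof
    assume "b \<in> {c. real_analytic_on c U}"
    then have "real_analytic_on b U" by simp
    then obtain s0 D r0 where "s0 > 0" "D \<ge> 0" "r0 \<ge> 1" "\<And>s r k. s \<le> s0 \<Longrightarrow> r \<ge> r0 \<Longrightarrow> deriv_bd x s k b D r"
      using real_analytic_on_deriv_bd[OF _ assms(2)] by blast
    then show ?thesis by (intro exI[of _ s0] exI[of _ D] exI[of _ r0] conjI) simp_all
  next
    assume "b \<in> Y"
    with assms(4) show ?thesis by (intro exI[of _ 1] exI[of _ C] conjI) auto
  qed
next
  case (add f g)
  obtain d where d: "d > 0" "cball x d \<subseteq> U" using assms(1,2) open_contains_cball by blast
  obtain s1 D1 r1 where 1: "s1 > 0" "D1 \<ge> 0" "r1 \<ge> 1"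
    "\<And>s r k. s \<le> s1 \<Longrightarrow> r \<ge> r1 \<Longrightarrow> \<forall>y\<in>Y. deriv_bd x s k y C r \<Longrightarrow> deriv_bd x s k f D1 r" using add.IH by metis
  obtain s2 D2 r2 where 2: "s2 > 0" "D2 \<ge> 0" "r2 \<ge> 1"
    "\<And>s r k. s \<le> s2 \<Longrightarrow> r \<ge> r2 \<Longrightarrow> \<forall>y\<in>Y. deriv_bd x s k y C r \<Longrightarrow> deriv_bd x s k g D2 r" using add.IH by metis
  have "deriv_bd x s k (\<lambda>t. f t + g t) (D1 + D2) r" if "s \<le> Min {d, s1, s2}" "r \<ge> max r1 r2"
    "\<forall>y\<in>Y. deriv_bd x s k y C r" for s r k
    using that d(2) add.hyps
    by (intro deriv_bd_add[OF assms(1)] 1(4) 2(4) assms(3)) (auto simp: dist_real_def abs_minus_commute subset_iff)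
  then show ?case using d 1 2
    by (intro exI[of _ "Min {d, s1, s2}"] exI[of _ "D1 + D2"] exI[of _ "max r1 r2"] conjI) auto
next
  case (mult f g)
  obtain d where d: "d > 0" "cball x d \<subseteq> U" using assms(1,2) open_contains_cball by blast
  obtain s1 D1 r1 where 1: "s1 > 0" "D1 \<ge> 0" "r1 \<ge> 1"
    "\<And>s r k. s \<le> s1 \<Longrightarrow> r \<ge> r1 \<Longrightarrow> \<forall>y\<in>Y. deriv_bd x s k y C r \<Longrightarrow> deriv_bd x s k f D1 r" using mult.IH by metis
  obtain s2 D2 r2 where 2: "s2 > 0" "D2 \<ge> 0" "r2 \<ge> 1"
    "\<And>s r k. s \<le> s2 \<Longrightarrow> r \<ge> r2 \<Longrightarrow> \<forall>y\<in>Y. deriv_bd x s k y C r \<Longrightarrow> deriv_bd x s k g D2 r" using mult.IH by metis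
  have "deriv_bd x s k (\<lambda>t. f t * g t) (8 * D1 * D2) r" if "s \<le> Min {d, s1, s2}" "r \<ge> max r1 r2"
    "\<forall>y\<in>Y. deriv_bd x s k y C r" for s r k
    using that d(2) mult.hyps 1(2,3) 2(2,3)
    by (intro deriv_bd_mult[OF assms(1)] 1(4) 2(4) assms(3)) (auto simp: dist_real_def abs_minus_commute subset_iff)
  then show ?case using d 1 2
    by (intro exI[of _ "Min {d, s1, s2}"] exI[of _ "8 * D1 * D2"] exI[of _ "max r1 r2"] conjI) auto
qed

text \<open>Majorants by induction on the order: if all elements of Y satisfy the bound with
  constant C up to order k, then their derivatives, as polynomial expressions, satisfy it with a
  constant D, and one more factor r \<ge> 4 D restores C at order k + 1.\<close>

lemma polynomial_system_analytic:
  assumes U: "open U" and Y: "finite Y"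
    and sys: "\<And>y. y \<in> Y \<Longrightarrow> \<exists>e\<in>rgen ({c. real_analytic_on c U} \<union> Y). \<forall>t\<in>U. (y has_real_derivative e t) (at t)"
    and "y \<in> Y"
  shows "real_analytic_on y U"
proof -
  define R where "R = rgen ({c. real_analytic_on c U} \<union> Y)"
  have smooth: "smooth_on h U" if "h \<in> R" for h
  proof (rule rgen_smooth[OF U])
    fix b assume "b \<in> {c. real_analytic_on c U} \<union> Y"
    then show "\<exists>e\<in>rgen ({c. real_analytic_on c U} \<union> Y). \<forall>t\<in>U. (b has_real_derivative e t) (at t)"
    proof
      assume "b \<in> {c. real_analytic_on c U}"
      then have "real_analytic_on (deriv b) U" "kdiff (Suc 0) b U"
        using real_analytic_on_deriv real_analytic_on_imp_smooth by (auto simp: smooth_on_def)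
      then show ?thesis by (intro bexI[of _ "deriv b"] rgen.base) (auto dest: kdiff_deriv)
    qed (rule sys)
  qed (use that in \<open>simp add: R_def\<close>)
  obtain e where e: "\<And>y. y \<in> Y \<Longrightarrow> e y \<in> R" "\<And>y t. y \<in> Y \<Longrightarrow> t \<in> U \<Longrightarrow> (y has_real_derivative e y t) (at t)"
    using sys unfolding R_def by metis
  have YR: "Y \<subseteq> R" by (auto simp: R_def intro: rgen.base)
  have "\<exists>s>0. \<exists>C\<ge>0. \<exists>r\<ge>1. \<forall>j t. \<bar>t - x\<bar> \<le> s \<longrightarrow> \<bar>(deriv ^^ j) y t\<bar> \<le> C * fact j * r ^ j" if x: "x \<in> U" for x
  proof -
    obtain d where d: "d > 0" "cball x d \<subseteq> U" using U x open_contains_cball by blast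
    have "\<exists>B. \<forall>t\<in>cball x d. \<bar>z t\<bar> \<le> B" if "z \<in> Y" for z
    proof -
      have "continuous_on (cball x d) z"
        using d(2) e(2)[OF that] by (intro continuous_at_imp_continuous_on) (auto intro: DERIV_isCont)
      then have "bounded (z ` cball x d)" by (intro compact_imp_bounded compact_continuous_image) auto
      then show ?thesis by (auto simp: bounded_iff)
    qed
    then obtain B where B: "\<And>z t. z \<in> Y \<Longrightarrow> t \<in> cball x d \<Longrightarrow> \<bar>z t\<bar> \<le> B z" by metis
    \<comment> \<open>At least 1 and above every element of Y on the ball, which settles order
      0.\<close>
    define C where "C = 1 + (\<Sum>z\<in>Y. \<bar>B z\<bar>)"
    have C: "C \<ge> 1" by (simp add: C_def sum_nonneg)
    have BC: "\<bar>z t\<bar> \<le> C" if "z \<in> Y" "t \<in> cball x d" for z t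
    proof -
      have "\<bar>B z\<bar> \<le> (\<Sum>z\<in>Y. \<bar>B z\<bar>)" using Y that(1) by (intro member_le_sum) auto
      with B[OF that] show ?thesis by (simp add: C_def)
    qed
    have "\<exists>s0>0. \<exists>D\<ge>0. \<exists>r0\<ge>1. \<forall>s\<le>s0. \<forall>r\<ge>r0. \<forall>k. (\<forall>y\<in>Y. deriv_bd x s k y C r) \<longrightarrow> deriv_bd x s k (e z) D r"
      if "z \<in> Y" for z
      using rgen_deriv_bd[OF U x, of Y C "e z"] smooth e(1)[OF that] C unfolding R_def by simp
    then obtain S D r0 where S: "\<And>z. z \<in> Y \<Longrightarrow> S z > 0" and D: "\<And>z. z \<in> Y \<Longrightarrow> D z \<ge> 0"
      and bd: "\<And>z s r k. z \<in> Y \<Longrightarrow> s \<le> S z \<Longrightarrow> r \<ge> r0 z \<Longrightarrow> \<forall>y\<in>Y. deriv_bd x s k y C r \<Longrightarrow> deriv_bd x s k (e z) (D z) r"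
      by metis
    define s where "s = Min (insert d (S ` Y))"
    have s: "s > 0" "s \<le> d" "\<And>z. z \<in> Y \<Longrightarrow> s \<le> S z" using Y S d by (auto simp: s_def)
    define r where "r = 1 + (\<Sum>z\<in>Y. \<bar>r0 z\<bar> + 4 * D z)"
    have r: "r \<ge> 1" "r \<ge> r0 z" "4 * D z \<le> r" if "z \<in> Y" for z
    proof -
      have "\<bar>r0 z\<bar> + 4 * D z \<le> (\<Sum>z\<in>Y. \<bar>r0 z\<bar> + 4 * D z)"
        using Y that D by (intro member_le_sum) auto
      then show "r \<ge> 1" "r \<ge> r0 z" "4 * D z \<le> r" using D[OF that] by (auto simp: r_def)
    qed
    have inU: "t \<in> U" if "\<bar>t - x\<bar> \<le> s" for t
      using that s d by (auto simp: subset_iff dist_real_def abs_minus_commute)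
    have main: "\<forall>z\<in>Y. deriv_bd x s k z C r" for k
    proof (induction k)
      case 0
      show ?case using BC s by (auto simp: deriv_bd_def dist_real_def abs_minus_commute)
    next
      case (Suc k)
      show ?case
      proof
        fix z assume z: "z \<in> Y"
        note rz = r[OF z]
        have bz: "deriv_bd x s k (e z) (D z) r" using bd[OF z s(3)[OF z] rz(2) Suc] .
        have "\<bar>(deriv ^^ Suc k) z t\<bar> \<le> C * fact (Suc k) * r ^ Suc k / (real (Suc k) + 1)\<^sup>2" if t: "\<bar>t - x\<bar> \<le> s" for t
        proof -
          have "(deriv ^^ Suc k) z t = (deriv ^^ k) (e z) t"
            unfolding funpow_deriv_Suc
            by (rule deriv_funpow_cong[OF U _ inU[OF t]]) (use e(2)[OF z] in \<open>auto intro: DERIV_imp_deriv\<close>)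
          also have "\<bar>\<dots>\<bar> \<le> D z * fact k * r ^ k / (real k + 1)\<^sup>2"
            using bz t by (auto simp: deriv_bd_def)
          also have "\<dots> \<le> C * fact (Suc k) * r ^ Suc k / (real (Suc k) + 1)\<^sup>2"
          proof -
            \<comment> \<open>The weights at the orders k and k + 1 differ by at most the factor 4,
              which r absorbs together with D.\<close>
            have "D z * (real k + 2)\<^sup>2 \<le> D z * (4 * (real k + 1)\<^sup>2)"
              using D[OF z] by (intro mult_left_mono) (auto simp: power2_eq_square algebra_simps)
            also have "\<dots> = (4 * D z) * (real k + 1)\<^sup>2" by simp
            also have "\<dots> \<le> r * (real k + 1)\<^sup>2" using rz(3) by (intro mult_right_mono) auto
            also have "\<dots> \<le> C * (real k + 1) * (r * (real k + 1)\<^sup>2)"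
            proof -
              have "1 * 1 \<le> C * (real k + 1)" using C by (intro mult_mono) auto
              then have "1 * (r * (real k + 1)\<^sup>2) \<le> C * (real k + 1) * (r * (real k + 1)\<^sup>2)"
                using rz(1) by (intro mult_right_mono) auto
              then show ?thesis by simp
            qed
            finally have "D z * (real k + 2)\<^sup>2 \<le> C * (real k + 1) * (r * (real k + 1)\<^sup>2)" .
            then have "D z / (real k + 1)\<^sup>2 \<le> C * (real k + 1) * r / (real k + 2)\<^sup>2"
              by (simp add: divide_simps mult_ac)
            then have "fact k * r ^ k * (D z / (real k + 1)\<^sup>2) \<le> fact k * r ^ k * (C * (real k + 1) * r / (real k + 2)\<^sup>2)"
              using rz(1) by (intro mult_left_mono) auto
            then show ?thesis by (simp add: mult_ac add_ac)
          qed
          finally show ?thesis .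
        qed
        then show "deriv_bd x s (Suc k) z C r"
          using Suc z by (auto simp: deriv_bd_def le_Suc_eq)
      qed
    qed
    have "\<bar>(deriv ^^ j) y t\<bar> \<le> C * fact j * r ^ j" if t: "\<bar>t - x\<bar> \<le> s" for j t
    proof -
      have "\<bar>(deriv ^^ j) y t\<bar> \<le> C * fact j * r ^ j / (real j + 1)\<^sup>2"
        using main[of j] \<open>y \<in> Y\<close> t by (auto simp: deriv_bd_def)
      also have "\<dots> \<le> C * fact j * r ^ j / 1"
        using C r(1)[OF \<open>y \<in> Y\<close>] by (intro divide_left_mono) auto
      finally show ?thesis by simp
    qed
    with s(1) C r(1)[OF \<open>y \<in> Y\<close>] show ?thesis
      by (intro exI[of _ s] exI[of _ C] exI[of _ r] conjI) auto
  qed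
  with smooth YR \<open>y \<in> Y\<close> show ?thesis by (intro real_analytic_onI_bound[OF U]) auto
qed

section \<open>Hardy fields as sets of functions\<close>

text \<open>Germs are replaced by saturated sets of representatives. The convention inverse 0 = 0
  lets \<open>inv\<close> hold for every element, and \<open>zero_or\<close> carries the content of
  the field axiom. First-order differentiability is enough to ask, as \<open>der\<close> iterates
  it.\<close>

locale hfun =
  fixes S :: "(real \<Rightarrow> real) set"
  assumes cong: "f \<in> S \<Longrightarrow> eventually (\<lambda>t. f t = g t) at_top \<Longrightarrow> g \<in> S"
    and one: "(\<lambda>_. 1) \<in> S"
    and diff: "f \<in> S \<Longrightarrow> g \<in> S \<Longrightarrow> (\<lambda>t. f t - g t) \<in> S"
    and mult: "f \<in> S \<Longrightarrow> g \<in> S \<Longrightarrow> (\<lambda>t. f t * g t) \<in> S"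
    and zero_or: "f \<in> S \<Longrightarrow> eventually (\<lambda>t. f t = 0) at_top \<or> eventually (\<lambda>t. f t \<noteq> 0) at_top"
    and inv: "f \<in> S \<Longrightarrow> (\<lambda>t. inverse (f t)) \<in> S"
    and der: "f \<in> S \<Longrightarrow> deriv f \<in> S"
    and ediff: "f \<in> S \<Longrightarrow> eventually (\<lambda>t. f field_differentiable (at t)) at_top"
begin

lemma zero: "(\<lambda>_. 0) \<in> S"
  using diff[OF one one] by simp

lemma uminus: "f \<in> S \<Longrightarrow> (\<lambda>t. - f t) \<in> S"
  using diff[OF zero] by simp

lemma add: "f \<in> S \<Longrightarrow> g \<in> S \<Longrightarrow> (\<lambda>t. f t + g t) \<in> S"
  using diff[OF _ uminus, of f g] by simp

lemma divide: "f \<in> S \<Longrightarrow> g \<in> S \<Longrightarrow> (\<lambda>t. f t / g t) \<in> S"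
  using mult[OF _ inv, of f g] by (simp add: divide_inverse)

lemma of_nat: "(\<lambda>_. real n) \<in> S"
proof (induction n)
  case (Suc n)
  then show ?case using add[OF one Suc] by simp
qed (simp add: zero)

lemma numeral: "(\<lambda>_. numeral n) \<in> S"
  using of_nat[of "numeral n"] by simp

lemma power: "f \<in> S \<Longrightarrow> (\<lambda>t. f t ^ n) \<in> S"
  by (induction n) (auto intro: one mult)

lemma sum: "(\<And>i. i \<in> A \<Longrightarrow> f i \<in> S) \<Longrightarrow> (\<lambda>t. \<Sum>i\<in>A. f i t) \<in> S"
  by (induction A rule: infinite_finite_induct) (auto intro: zero add)

lemma der_funpow: "f \<in> S \<Longrightarrow> (deriv ^^ k) f \<in> S"
  by (induction k) (auto intro: der)

lemma eDERIV: "f \<in> S \<Longrightarrow> eventually (\<lambda>t. (f has_real_derivative deriv f t) (at t)) at_top"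
  using ediff[of f] by (simp add: DERIV_deriv_iff_field_differentiable)

lemma econt: "f \<in> S \<Longrightarrow> eventually (\<lambda>t. isCont f t) at_top"
  using eDERIV[of f] by (auto elim!: eventually_mono intro: DERIV_isCont)

text \<open>By continuity a function without zeros near infinity keeps its sign there.\<close>

lemma trichotomy:
  assumes "f \<in> S"
  shows "eventually (\<lambda>t. f t = 0) at_top \<or> eventually (\<lambda>t. f t > 0) at_top \<or> eventually (\<lambda>t. f t < 0) at_top"
proof (cases "eventually (\<lambda>t. f t = 0) at_top")
  case False
  then have "eventually (\<lambda>t. f t \<noteq> 0 \<and> isCont f t) at_top"
    using zero_or[OF assms] econt[OF assms] by (auto intro: eventually_conj)
  then obtain a where a: "\<And>t. t \<ge> a \<Longrightarrow> f t \<noteq> 0" "\<And>t. t \<ge> a \<Longrightarrow> isCont f t"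
    unfolding eventually_at_top_linorder by auto
  consider "f a > 0" | "f a < 0" using a(1)[of a] by linarith
  then show ?thesis
  proof cases
    case 1
    have "f t > 0" if "t \<ge> a" for t
    proof (rule ccontr)
      assume "\<not> f t > 0"
      then have "\<exists>x\<ge>a. x \<le> t \<and> f x = 0" using 1 that a(2) by (intro IVT2) auto
      with a(1) show False by blast
    qed
    then show ?thesis unfolding eventually_at_top_linorder by blast
  next
    case 2
    have "f t < 0" if "t \<ge> a" for t
    proof (rule ccontr)
      assume "\<not> f t < 0"
      then have "\<exists>x\<ge>a. x \<le> t \<and> f x = 0" using 2 that a(2) by (intro IVT) auto
      with a(1) show False by blast
    qed
    then show ?thesis unfolding eventually_at_top_linorder by blast
  qed
qed auto

lemma less_or_ge:
  assumes "f \<in> S" "g \<in> S"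
  shows "eventually (\<lambda>t. f t < g t) at_top \<or> eventually (\<lambda>t. g t \<le> f t) at_top"
  using trichotomy[OF diff[OF assms]]
  by (elim disjE) (auto elim!: eventually_mono intro!: disjI2)

lemma abs:
  assumes "f \<in> S"
  shows "(\<lambda>t. \<bar>f t\<bar>) \<in> S"
  using less_or_ge[OF assms zero]
proof
  assume "eventually (\<lambda>t. f t < 0) at_top"
  then show ?thesis by (intro cong[OF uminus[OF assms]]) (auto elim: eventually_mono)
next
  assume "eventually (\<lambda>t. 0 \<le> f t) at_top"
  then show ?thesis by (intro cong[OF assms]) (auto elim: eventually_mono)
qed

text \<open>
  A gauge is comparable with every element of the field: it belongs to the field or lies
  below all its positive elements.
\<close>

definition infra :: "(real \<Rightarrow> real) \<Rightarrow> bool" where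
  "infra \<phi> \<longleftrightarrow> (\<forall>u\<in>S. eventually (\<lambda>t. u t = 0) at_top \<or> eventually (\<lambda>t. \<phi> t < \<bar>u t\<bar>) at_top)"

definition gauge :: "(real \<Rightarrow> real) \<Rightarrow> bool" where
  "gauge \<phi> \<longleftrightarrow> eventually (\<lambda>t. \<phi> t > 0) at_top \<and> eventually (\<lambda>t. isCont \<phi> t) at_top \<and> (\<phi> \<in> S \<or> infra \<phi>)"

lemma gauge_pos: "gauge \<phi> \<Longrightarrow> eventually (\<lambda>t. \<phi> t > 0) at_top"
  by (simp add: gauge_def)

lemma gauge_cont: "gauge \<phi> \<Longrightarrow> eventually (\<lambda>t. isCont \<phi> t) at_top"
  by (simp add: gauge_def)

lemma gauge_mem: "u \<in> S \<Longrightarrow> eventually (\<lambda>t. u t > 0) at_top \<Longrightarrow> gauge u"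
  by (simp add: gauge_def econt)

lemma gauge_less_or_ge:
  assumes "gauge \<phi>" "u \<in> S"
  shows "eventually (\<lambda>t. u t < \<phi> t) at_top \<or> eventually (\<lambda>t. \<phi> t \<le> u t) at_top"
proof (cases "\<phi> \<in> S")
  case False
  then have inf: "infra \<phi>" using assms by (simp add: gauge_def)
  from trichotomy[OF assms(2)] show ?thesis
  proof (elim disjE)
    assume "eventually (\<lambda>t. u t > 0) at_top"
    moreover from this have "\<not> eventually (\<lambda>t. u t = 0) at_top"
      using eventually_happens'[OF _ eventually_conj] by (metis (mono_tags, lifting) less_irrefl trivial_limit_at_top_linorder)
    ultimately have "eventually (\<lambda>t. \<phi> t < \<bar>u t\<bar> \<and> u t > 0) at_top"
      using inf assms(2) by (auto simp: infra_def intro: eventually_conj)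
    then show ?thesis by (intro disjI2) (auto elim: eventually_mono)
  qed (use gauge_pos[OF assms(1)] in \<open>auto elim: eventually_elim2\<close>)
qed (use less_or_ge assms in auto)

text \<open>If one factor is infinitesimal, cutting the product off by that factor makes it
  infinitesimal as well. Otherwise both factors lie in the field, and so does the product.\<close>

lemma gauge_mult:
  assumes "gauge \<phi>" "gauge \<psi>"
  shows "\<exists>\<eta>. gauge \<eta> \<and> eventually (\<lambda>t. \<eta> t \<le> \<phi> t * \<psi> t) at_top"
proof -
  have infra_case: "\<exists>\<eta>. gauge \<eta> \<and> eventually (\<lambda>t. \<eta> t \<le> \<phi> t * \<psi> t) at_top"
    if "gauge \<phi>" "gauge \<psi>" "infra \<phi>" for \<phi> \<psi>
  proof (intro exI conjI)
    show "gauge (\<lambda>t. min (\<phi> t) (\<phi> t * \<psi> t))"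
      unfolding gauge_def
    proof (intro conjI disjI2)
      show "infra (\<lambda>t. min (\<phi> t) (\<phi> t * \<psi> t))"
        unfolding infra_def
      proof
        fix u assume "u \<in> S"
        then have "eventually (\<lambda>t. u t = 0) at_top \<or> eventually (\<lambda>t. \<phi> t < \<bar>u t\<bar>) at_top"
          using \<open>infra \<phi>\<close> by (simp add: infra_def)
        then show "eventually (\<lambda>t. u t = 0) at_top \<or> eventually (\<lambda>t. min (\<phi> t) (\<phi> t * \<psi> t) < \<bar>u t\<bar>) at_top"
          by (elim disjE) (blast, rule disjI2, erule eventually_mono, simp)
      qed
      show "eventually (\<lambda>t. min (\<phi> t) (\<phi> t * \<psi> t) > 0) at_top"
        using gauge_pos[OF that(1)] gauge_pos[OF that(2)] by eventually_elim simp
      show "eventually (\<lambda>t. isCont (\<lambda>t. min (\<phi> t) (\<phi> t * \<psi> t)) t) at_top"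
        using gauge_cont[OF that(1)] gauge_cont[OF that(2)] by eventually_elim (intro continuous_intros)
    qed
  qed simp
  consider "infra \<phi>" | "infra \<psi>" | "\<phi> \<in> S" "\<psi> \<in> S" using assms unfolding gauge_def by blast
  then show ?thesis
  proof cases
    case 1
    then show ?thesis using infra_case assms by blast
  next
    case 2
    then show ?thesis using infra_case[OF assms(2,1)] by (simp add: mult.commute)
  next
    case 3
    then have "gauge (\<lambda>t. \<phi> t * \<psi> t)"
      using gauge_pos[OF assms(1)] gauge_pos[OF assms(2)]
      by (intro gauge_mem mult) (auto elim: eventually_elim2)
    then show ?thesis by (auto intro!: exI)
  qed
qed

end

section \<open>Majorants of countable families\<close>

text \<open>Squaring smooths the corner at a while the derivative still vanishes to its left, so
  locally finite sums of such terms can be differentiated termwise.\<close>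

lemma hinge_square_deriv: "((\<lambda>t. (max 0 (t - a))\<^sup>2) has_real_derivative 2 * max 0 (t - a)) (at t)"
proof -
  consider "t < a" | "t > a" | "t = a" by linarith
  then show ?thesis
  proof cases
    case 1
    have "((\<lambda>t. 0) has_real_derivative 2 * max 0 (t - a)) (at t)" using 1 by simp
    then show ?thesis
      by (rule has_field_derivative_transform_within_open[of _ _ _ "{..<a}"]) (use 1 in auto)
  next
    case 2
    have "((\<lambda>t. (t - a)\<^sup>2) has_real_derivative 2 * max 0 (t - a)) (at t)"
      using 2 by (auto intro!: derivative_eq_intros)
    then show ?thesis
      by (rule has_field_derivative_transform_within_open[of _ _ _ "{a<..}"]) (use 2 in auto)
  next
    case 3
    have "((\<lambda>h. (max 0 h)\<^sup>2 / h) \<longlongrightarrow> 0) (at (0::real))"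
    proof (rule Lim_null_comparison)
      show "eventually (\<lambda>h. norm ((max 0 h)\<^sup>2 / h) \<le> \<bar>h\<bar>) (at (0::real))"
        by (auto simp: eventually_at max_def power2_eq_square intro!: exI[of _ 1])
      show "((\<lambda>h. \<bar>h\<bar>) \<longlongrightarrow> 0) (at (0::real))" by (rule tendsto_rabs_zero) (rule tendsto_ident_at)
    qed
    then show ?thesis using 3 by (simp add: DERIV_def)
  qed
qed

text \<open>A diagonal construction in the manner of du Bois-Reymond: \<open>c j\<close> dominates
  the first j + 1 functions on their intervals up to j + 2, and the j-th squared hinge has value and
  derivative at least 1 from j + 1 on. The derivative has to grow along with L because it becomes
  the logarithmic rate of decay of exp (- L).\<close>

lemma countable_majorant:
  fixes g :: "nat \<Rightarrow> real \<Rightarrow> real"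
  assumes "\<And>i. eventually (\<lambda>t. isCont (g i) t) at_top"
  obtains L L' where "\<And>t. (L has_real_derivative L' t) (at t)"
    "\<And>i. eventually (\<lambda>t. g i t \<le> L t \<and> g i t \<le> L' t) at_top"
proof -
  have "\<forall>i. \<exists>T. \<forall>t\<ge>T. isCont (g i) t"
    using assms by (simp add: eventually_at_top_linorder)
  then obtain T where T: "\<And>i t. t \<ge> T i \<Longrightarrow> isCont (g i) t" by metis
  have "\<exists>B. \<forall>t\<in>{T i..real j + 2}. \<bar>g i t\<bar> \<le> B" for i j
  proof -
    have "bounded (g i ` {T i..real j + 2})"
      by (intro compact_imp_bounded compact_continuous_image continuous_at_imp_continuous_on)
         (auto intro: T)
    then show ?thesis by (auto simp: bounded_iff)
  qed
  then obtain B where B: "\<And>i j t. t \<in> {T i..real j + 2} \<Longrightarrow> \<bar>g i t\<bar> \<le> B i j" by metis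
  define c where "c = (\<lambda>j. \<Sum>i\<le>j. \<bar>B i j\<bar>)"
  have c0: "c j \<ge> 0" for j by (simp add: c_def sum_nonneg)
  have cB: "\<bar>B i j\<bar> \<le> c j" if "i \<le> j" for i j
    unfolding c_def using that by (intro member_le_sum) auto
  define L where "L = (\<lambda>t::real. \<Sum>j<nat \<lceil>t\<rceil>. c j * (max 0 (t - real j))\<^sup>2)"
  define L' where "L' = (\<lambda>t::real. \<Sum>j<nat \<lceil>t\<rceil>. 2 * c j * max 0 (t - real j))"
  \<comment> \<open>Terms with j \<ge> t vanish, so near any point L is a sum over a fixed finite
    range.\<close>
  have trunc: "(\<Sum>j<nat \<lceil>t\<rceil>. h j) = (\<Sum>j<N. h j)"
    if "t < real N" "\<And>j. t \<le> real j \<Longrightarrow> h j = 0" for t N and h :: "nat \<Rightarrow> real"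
  proof (rule sum.mono_neutral_left)
    show "{..<nat \<lceil>t\<rceil>} \<subseteq> {..<N}" using that(1) by (auto simp: nat_less_iff less_ceiling_iff)
    show "\<forall>j\<in>{..<N} - {..<nat \<lceil>t\<rceil>}. h j = 0"
      using that(2) by (auto simp: not_less nat_le_iff ceiling_le_iff)
  qed auto
  have L: "L t = (\<Sum>j<N. c j * (max 0 (t - real j))\<^sup>2)" "L' t = (\<Sum>j<N. 2 * c j * max 0 (t - real j))"
    if "t < real N" for t N
    unfolding L_def L'_def using that by (auto intro!: trunc)
  have "(L has_real_derivative L' t) (at t)" for t
  proof -
    obtain N where N: "t < real N" using reals_Archimedean2 by blast
    have "((\<lambda>t. \<Sum>j<N. c j * (max 0 (t - real j))\<^sup>2) has_real_derivative (\<Sum>j<N. c j * (2 * max 0 (t - real j)))) (at t)"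
      by (intro DERIV_sum DERIV_cmult hinge_square_deriv)
    also have "(\<Sum>j<N. c j * (2 * max 0 (t - real j))) = L' t"
      unfolding L(2)[OF N] by (simp add: mult_ac)
    finally show ?thesis
      by (rule has_field_derivative_transform_within_open[of _ _ _ "{..<real N}"]) (use N L(1) in auto)
  qed
  moreover have "eventually (\<lambda>t. g i t \<le> L t \<and> g i t \<le> L' t) at_top" for i
    using eventually_ge_at_top[of "max (T i) (real i + 1)"]
  proof eventually_elim
    case (elim t)
    \<comment> \<open>This index makes t - j \<ge> 1 and t < j + 2, so the j-th term alone dominates
      \<open>g i t\<close>.\<close>
    define j where "j = nat \<lfloor>t - 1\<rfloor>"
    have j: "real j \<le> t - 1" "t - 1 < real j + 1" "i \<le> j"
      using elim unfolding j_def by (auto simp: le_nat_iff le_floor_iff) linarith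
    obtain N where N: "t < real N" using reals_Archimedean2 by blast
    have jN: "j < N" using j N by linarith
    have "g i t \<le> B i j" using B[of t i j] j elim by auto
    also have "\<dots> \<le> c j" using cB[OF j(3)] by linarith
    finally have g: "g i t \<le> c j" .
    have m: "max 0 (t - real j) \<ge> 1" using j by simp
    have "c j * 1 \<le> c j * (max 0 (t - real j))\<^sup>2"
      using m by (intro mult_left_mono c0) (simp add: one_le_power)
    also have "\<dots> \<le> L t" unfolding L(1)[OF N]
      by (rule member_le_sum[of j "{..<N}" "\<lambda>j. c j * (max 0 (t - real j))\<^sup>2"]) (use jN c0 in auto)
    finally have 1: "c j \<le> L t" by simp
    have "c j * 1 \<le> c j * (2 * max 0 (t - real j))"
      using m by (intro mult_left_mono c0) simp
    also have "\<dots> = 2 * c j * max 0 (t - real j)" by simp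
    also have "\<dots> \<le> L' t" unfolding L(2)[OF N]
      by (rule member_le_sum[of j "{..<N}" "\<lambda>j. 2 * c j * max 0 (t - real j)"]) (use jN c0 in auto)
    finally show ?case using g 1 by simp
  qed
  ultimately show ?thesis by (rule that)
qed

context hfun
begin

text \<open>
  If no continuous germ is infinitesimal relative to the field, an element of the field that is
  frequently below \<open>exp (- L)\<close> has the required properties, since all comparisons between
  elements of the field hold eventually or fail eventually.
\<close>

lemma tiny_gauge:
  fixes \<phi> :: "nat \<Rightarrow> real \<Rightarrow> real"
  assumes "\<And>i. gauge (\<phi> i)"
  obtains \<omega> where "gauge \<omega>" "\<And>i. eventually (\<lambda>t. \<omega> t \<le> \<phi> i t) at_top"
    "eventually (\<lambda>t. (\<omega> has_real_derivative deriv \<omega> t) (at t) \<and> deriv \<omega> t \<le> - \<omega> t / \<phi> 0 t) at_top"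
proof -
  \<comment> \<open>An infinitesimal gauge, if one exists, joins the family, so that exp (- L) falls
    below it and becomes infinitesimal too.\<close>
  define \<phi>s where "\<phi>s = (if \<exists>\<psi>. gauge \<psi> \<and> infra \<psi> then SOME \<psi>. gauge \<psi> \<and> infra \<psi> else \<phi> 0)"
  have \<phi>s: "gauge \<phi>s" "(\<exists>\<psi>. gauge \<psi> \<and> infra \<psi>) \<Longrightarrow> infra \<phi>s"
    using someI_ex[of "\<lambda>\<psi>. gauge \<psi> \<and> infra \<psi>"] assms by (auto simp: \<phi>s_def)
  \<comment> \<open>From L \<ge> 1/\<phi> + 1 follows exp L > 1/\<phi>. The surplus 1 in L' \<ge>
    1/\<phi> + 1 is what later makes ln \<omega> + L - t nondecreasing.\<close>
  define g where "g = (\<lambda>i t. 1 / (case i of 0 \<Rightarrow> \<phi>s | Suc i \<Rightarrow> \<phi> i) t + 1)"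
  have gcont: "eventually (\<lambda>t. isCont (g i) t) at_top" for i
  proof -
    have *: "gauge (case i of 0 \<Rightarrow> \<phi>s | Suc i \<Rightarrow> \<phi> i)" using assms \<phi>s(1) by (simp split: nat.split)
    show ?thesis using gauge_cont[OF *] gauge_pos[OF *]
      by eventually_elim (auto simp: g_def intro!: continuous_intros)
  qed
  obtain L L' where L: "\<And>t. (L has_real_derivative L' t) (at t)"
      and Lg: "\<And>i. eventually (\<lambda>t. g i t \<le> L t \<and> g i t \<le> L' t) at_top"
    by (rule countable_majorant[OF gcont]) (rule that)
  have small: "eventually (\<lambda>t. exp (- L t) < \<psi> t \<and> 1 / \<psi> t + 1 \<le> L' t) at_top"
    if "\<psi> = \<phi>s \<or> \<psi> = \<phi> i" for \<psi> i
  proof -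
    have \<psi>: "gauge \<psi>" "\<exists>j. g j = (\<lambda>t. 1 / \<psi> t + 1)"
      using that assms \<phi>s(1) by (auto simp: g_def intro: exI[of _ 0] exI[of _ "Suc i"])
    then obtain j where j: "g j = (\<lambda>t. 1 / \<psi> t + 1)" by blast
    show ?thesis using gauge_pos[OF \<psi>(1)] Lg[of j]
    proof eventually_elim
      case (elim t)
      have "1 / \<psi> t < exp (L t)" using elim exp_ge_add_one_self[of "L t"] unfolding j by linarith
      then have "exp (- L t) < \<psi> t" using elim by (simp add: exp_minus field_simps)
      then show ?case using elim by (simp add: j)
    qed
  qed
  have Lcont: "isCont (\<lambda>t. exp (- L t)) t" for t
    using DERIV_isCont[OF L] by (intro continuous_intros)
  show ?thesis
  proof (cases "infra \<phi>s")
    case True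
    have "infra (\<lambda>t. exp (- L t))"
      unfolding infra_def
    proof
      fix u assume "u \<in> S"
      with True have "eventually (\<lambda>t. u t = 0) at_top \<or> eventually (\<lambda>t. \<phi>s t < \<bar>u t\<bar>) at_top"
        by (simp add: infra_def)
      moreover have "eventually (\<lambda>t. exp (- L t) < \<bar>u t\<bar>) at_top" if "eventually (\<lambda>t. \<phi>s t < \<bar>u t\<bar>) at_top"
        using that small[OF disjI1[OF refl]] by eventually_elim simp
      ultimately show "eventually (\<lambda>t. u t = 0) at_top \<or> eventually (\<lambda>t. exp (- L t) < \<bar>u t\<bar>) at_top" by blast
    qed
    then have g: "gauge (\<lambda>t. exp (- L t))" using Lcont by (simp add: gauge_def)
    have d: "((\<lambda>t. exp (- L t)) has_real_derivative - L' t * exp (- L t)) (at t)" for t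
      by (auto intro!: derivative_eq_intros L)
    have "eventually (\<lambda>t. ((\<lambda>t. exp (- L t)) has_real_derivative deriv (\<lambda>t. exp (- L t)) t) (at t) \<and>
        deriv (\<lambda>t. exp (- L t)) t \<le> - exp (- L t) / \<phi> 0 t) at_top"
      using small[OF disjI2[OF refl], of 0]
    proof eventually_elim
      case (elim t)
      have "(1 / \<phi> 0 t) * exp (- L t) \<le> L' t * exp (- L t)" using elim by (intro mult_right_mono) auto
      then show ?case using d[of t] DERIV_imp_deriv[OF d, of t] by simp
    qed
    moreover have "eventually (\<lambda>t. exp (- L t) \<le> \<phi> i t) at_top" for i
      using small[OF disjI2[OF refl], of i] by eventually_elim simp
    ultimately show ?thesis using g by (intro that) auto
  next
    case False
    have "gauge (\<lambda>t. exp (- L t))" if "infra (\<lambda>t. exp (- L t))"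
      using that Lcont by (simp add: gauge_def)
    with False have no: "\<not> infra \<psi>" if "gauge \<psi> \<or> \<psi> = (\<lambda>t. exp (- L t))" for \<psi>
      using \<phi>s(2) that by blast
    then obtain u where u: "u \<in> S" "\<not> eventually (\<lambda>t. u t = 0) at_top"
        "\<not> eventually (\<lambda>t. exp (- L t) < \<bar>u t\<bar>) at_top"
      unfolding infra_def by blast
    define \<omega> where "\<omega> = (\<lambda>t. \<bar>u t\<bar>)"
    have \<omega>S: "\<omega> \<in> S" unfolding \<omega>_def using abs u(1) .
    have \<omega>pos: "eventually (\<lambda>t. \<omega> t > 0) at_top"
      using zero_or[OF u(1)] u(2) by (auto simp: \<omega>_def)
    have freq: "\<not> eventually (\<lambda>t. exp (- L t) < \<omega> t) at_top" using u(3) by (simp add: \<omega>_def)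
    have \<phi>S: "\<phi> i \<in> S" for i using assms[of i] no[of "\<phi> i"] by (auto simp: gauge_def)
    have 1: "eventually (\<lambda>t. \<omega> t \<le> \<phi> i t) at_top" for i
      using less_or_ge[OF \<omega>S \<phi>S[of i]]
    proof
      assume "eventually (\<lambda>t. \<phi> i t \<le> \<omega> t) at_top"
      with small[OF disjI2[OF refl], of i] have "eventually (\<lambda>t. exp (- L t) < \<omega> t) at_top"
        by eventually_elim simp
      with freq show ?thesis by blast
    qed (auto elim: eventually_mono)
    define v where "v = (\<lambda>t. deriv \<omega> t + \<omega> t / \<phi> 0 t)"
    have "v \<in> S" unfolding v_def using \<omega>S \<phi>S der divide add by simp
    have "eventually (\<lambda>t. v t \<le> 0) at_top"
      using less_or_ge[OF zero \<open>v \<in> S\<close>]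
    proof
      assume "eventually (\<lambda>t. 0 < v t) at_top"
      then have "eventually (\<lambda>t. 0 < v t \<and> \<omega> t > 0 \<and> (\<omega> has_real_derivative deriv \<omega> t) (at t) \<and>
          1 / \<phi> 0 t + 1 \<le> L' t) at_top"
        using \<omega>pos eDERIV[OF \<omega>S] small[OF disjI2[OF refl], of 0] by eventually_elim simp
      then obtain a where a: "\<And>t. t \<ge> a \<Longrightarrow> 0 < v t" "\<And>t. t \<ge> a \<Longrightarrow> \<omega> t > 0"
          "\<And>t. t \<ge> a \<Longrightarrow> (\<omega> has_real_derivative deriv \<omega> t) (at t)" "\<And>t. t \<ge> a \<Longrightarrow> 1 / \<phi> 0 t + 1 \<le> L' t"
        unfolding eventually_at_top_linorder by blast
      \<comment> \<open>Were v positive, the logarithmic derivative of \<omega> would exceed -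
        1/\<phi>, hence 1 - L'. Then ln \<omega> + L would tend to infinity and \<omega> would end
        up above exp (- L), against the choice of u.\<close>
      have "ln (\<omega> a) + L a - a \<le> ln (\<omega> t) + L t - t" if "a \<le> t" for t
      proof (rule DERIV_nonneg_imp_nondecreasing[OF that])
        fix x assume x: "a \<le> x" "x \<le> t"
        have "((\<lambda>t. ln (\<omega> t) + L t - t) has_real_derivative deriv \<omega> x / \<omega> x + L' x - 1) (at x)"
          using a(2,3)[OF x(1)] by (auto intro!: derivative_eq_intros L)
        moreover have "deriv \<omega> x / \<omega> x + L' x - 1 \<ge> 0"
        proof -
          have "0 < v x / \<omega> x" using a(1,2)[OF x(1)] by simp
          also have "v x / \<omega> x = deriv \<omega> x / \<omega> x + 1 / \<phi> 0 x"
            using a(2)[OF x(1)] by (simp add: v_def add_divide_distrib)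
          finally show ?thesis using a(4)[OF x(1)] by simp
        qed
        ultimately show "\<exists>y. ((\<lambda>t. ln (\<omega> t) + L t - t) has_real_derivative y) (at x) \<and> 0 \<le> y" by blast
      qed
      then have "ln (\<omega> t) + L t > 0" if "t \<ge> a" "t > a - ln (\<omega> a) - L a" for t using that by force
      then have *: "exp (- L t) < \<omega> t" if "t \<ge> a" "t > a - ln (\<omega> a) - L a" for t
        using a(2)[OF that(1)] that by (metis add.inverse_inverse add_less_cancel_right diff_0 diff_add_cancel exp_less_mono exp_ln minus_diff_eq neg_less_iff_less add.commute add_uminus_conv_diff diff_gt_0_iff_gt)
      have "eventually (\<lambda>t. exp (- L t) < \<omega> t) at_top"
        using eventually_ge_at_top[of a] eventually_gt_at_top[of "a - ln (\<omega> a) - L a"]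
        by eventually_elim (rule *)
      with freq show ?thesis by blast
    qed
    then have "eventually (\<lambda>t. (\<omega> has_real_derivative deriv \<omega> t) (at t) \<and> deriv \<omega> t \<le> - \<omega> t / \<phi> 0 t) at_top"
      using eDERIV[OF \<omega>S] by eventually_elim (simp add: v_def)
    with gauge_mem[OF \<omega>S \<omega>pos] 1 show ?thesis by (intro that) auto
  qed
qed

end

section \<open>Contraction from infinity\<close>

text \<open>Since \<omega> tends to 0, the inequality for \<omega>' says that the integral of d from
  t to infinity is at most \<omega> t. Integrating from infinity thus improves a bound by d to one
  by \<omega>. In the application d is \<omega> divided by a small \<rho>.\<close>

locale tail_weight =
  fixes T :: real and \<omega> \<omega>' d :: "real \<Rightarrow> real"
  assumes \<omega>_deriv: "t > T \<Longrightarrow> (\<omega> has_real_derivative \<omega>' t) (at t)"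
    and \<omega>'_le: "t > T \<Longrightarrow> \<omega>' t \<le> - d t"
    and \<omega>_pos: "t > T \<Longrightarrow> \<omega> t > 0"
    and \<omega>_le: "t > T \<Longrightarrow> \<omega> t \<le> d t"
    and d_cont: "continuous_on {T<..} d"
begin

lemma d_pos: "t > T \<Longrightarrow> d t > 0"
  using \<omega>_pos \<omega>_le by force

text \<open>From \<omega>' \<le> - d \<le> - \<omega> the product of \<omega> with exp is
  nonincreasing.\<close>

lemma \<omega>_tendsto_0: "(\<omega> \<longlongrightarrow> 0) at_top"
proof -
  define a where "a = T + 1"
  have "\<omega> t \<le> \<omega> a * exp a * exp (- t)" if "t \<ge> a" for t
  proof -
    have "\<omega> t * exp t \<le> \<omega> a * exp a"
    proof (rule DERIV_nonpos_imp_nonincreasing[OF that])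
      fix x assume x: "a \<le> x" "x \<le> t"
      then have "x > T" by (simp add: a_def)
      have "((\<lambda>t. \<omega> t * exp t) has_real_derivative (\<omega>' x + \<omega> x) * exp x) (at x)"
        by (auto intro!: derivative_eq_intros \<omega>_deriv[OF \<open>x > T\<close>] simp: algebra_simps)
      moreover have "(\<omega>' x + \<omega> x) * exp x \<le> 0"
        using \<omega>'_le[OF \<open>x > T\<close>] \<omega>_le[OF \<open>x > T\<close>] by (intro mult_nonpos_nonneg) auto
      ultimately show "\<exists>y. ((\<lambda>t. \<omega> t * exp t) has_real_derivative y) (at x) \<and> y \<le> 0" by blast
    qed
    then have "\<omega> t * exp t * exp (- t) \<le> \<omega> a * exp a * exp (- t)" by (intro mult_right_mono) auto
    then show ?thesis by (simp add: mult.assoc flip: exp_add)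
  qed
  then have b: "norm (\<omega> t) \<le> \<omega> a * exp a * exp (- t)" if "t \<ge> a" for t
    using \<omega>_pos[of t] that by (simp add: a_def)
  have ev: "eventually (\<lambda>t. norm (\<omega> t) \<le> \<omega> a * exp a * exp (- t)) at_top"
    using eventually_ge_at_top[of a] by eventually_elim (rule b)
  have "((\<lambda>t::real. exp (- t)) \<longlongrightarrow> 0) at_top"
    by (rule filterlim_compose[OF exp_at_bot filterlim_uminus_at_bot_at_top])
  then have "((\<lambda>t. \<omega> a * exp a * exp (- t)) \<longlongrightarrow> 0) at_top"
    by (rule tendsto_mult_right_zero)
  from Lim_null_comparison[OF ev this] show ?thesis .
qed

text \<open>The primitive vanishing at infinity, that is, minus the integral of w from t on. Decay
  like \<omega> singles it out on t > T, and choosing it by this property avoids improper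
  integrals.\<close>

definition prim :: "(real \<Rightarrow> real) \<Rightarrow> real \<Rightarrow> real" where
  "prim w = (SOME W. (\<forall>t>T. (W has_real_derivative w t) (at t)) \<and> (\<exists>C. \<forall>t>T. \<bar>W t\<bar> \<le> C * \<omega> t))"

text \<open>F - C \<omega> increases, F + C \<omega> decreases, and every value of the first lies
  below every value of the second. The supremum of the first therefore serves as the limit of F at
  infinity and is subtracted.\<close>

lemma antiderivative_ex:
  assumes "continuous_on {T<..} w" "\<And>t. t > T \<Longrightarrow> \<bar>w t\<bar> \<le> C * d t" "C \<ge> 0"
  shows "\<exists>W. (\<forall>t>T. (W has_real_derivative w t) (at t)) \<and> (\<forall>t>T. \<bar>W t\<bar> \<le> C * \<omega> t)"
proof -
  have "isCont w t" if "t > T" for t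
    using assms(1) that by (simp add: continuous_on_eq_continuous_at)
  then have "\<exists>F. \<forall>t. ereal T < ereal t \<longrightarrow> ereal t < \<infinity> \<longrightarrow> (F has_vector_derivative w t) (at t)"
    by (intro einterval_antiderivative) auto
  then obtain F where F: "\<And>t. t > T \<Longrightarrow> (F has_real_derivative w t) (at t)"
    by (auto simp: has_real_derivative_iff_has_vector_derivative)
  have up: "F s - C * \<omega> s \<le> F t - C * \<omega> t" if "T < s" "s \<le> t" for s t
  proof (rule DERIV_nonneg_imp_nondecreasing[OF that(2)])
    fix x assume "s \<le> x" "x \<le> t"
    then have x: "x > T" using that by simp
    have "((\<lambda>t. F t - C * \<omega> t) has_real_derivative w x - C * \<omega>' x) (at x)"
      by (auto intro!: derivative_eq_intros F[OF x] \<omega>_deriv[OF x])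
    moreover have "C * d x \<le> C * (- \<omega>' x)" using \<omega>'_le[OF x] assms(3) by (intro mult_left_mono) auto
    then have "w x - C * \<omega>' x \<ge> 0" using assms(2)[OF x] by auto
    ultimately show "\<exists>y. ((\<lambda>t. F t - C * \<omega> t) has_real_derivative y) (at x) \<and> 0 \<le> y" by blast
  qed
  have down: "F t + C * \<omega> t \<le> F s + C * \<omega> s" if "T < s" "s \<le> t" for s t
  proof (rule DERIV_nonpos_imp_nonincreasing[OF that(2)])
    fix x assume "s \<le> x" "x \<le> t"
    then have x: "x > T" using that by simp
    have "((\<lambda>t. F t + C * \<omega> t) has_real_derivative w x + C * \<omega>' x) (at x)"
      by (auto intro!: derivative_eq_intros F[OF x] \<omega>_deriv[OF x])
    moreover have "C * d x \<le> C * (- \<omega>' x)" using \<omega>'_le[OF x] assms(3) by (intro mult_left_mono) auto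
    then have "w x + C * \<omega>' x \<le> 0" using assms(2)[OF x] by auto
    ultimately show "\<exists>y. ((\<lambda>t. F t + C * \<omega> t) has_real_derivative y) (at x) \<and> y \<le> 0" by blast
  qed
  have le: "F s - C * \<omega> s \<le> F t + C * \<omega> t" if "T < s" "T < t" for s t
  proof -
    have "F s - C * \<omega> s \<le> F (max s t) - C * \<omega> (max s t)" using that by (intro up) auto
    also have "\<dots> \<le> F (max s t) + C * \<omega> (max s t)"
    proof -
      have "0 \<le> C * \<omega> (max s t)" using assms(3) \<omega>_pos[of "max s t"] that by (intro mult_nonneg_nonneg less_imp_le[OF \<omega>_pos]) auto
      then show ?thesis by simp
    qed
    also have "\<dots> \<le> F t + C * \<omega> t" using that by (intro down) auto
    finally show ?thesis .
  qed
  define l where "l = (SUP s\<in>{T<..}. F s - C * \<omega> s)"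
  have l: "F t - C * \<omega> t \<le> l" "l \<le> F t + C * \<omega> t" if "t > T" for t
    unfolding l_def using that le
    by (auto intro!: cSUP_upper cSUP_least bdd_aboveI2[where M = "F t + C * \<omega> t"])
  show ?thesis
  proof (intro exI conjI allI impI)
    fix t assume t: "t > T"
    show "((\<lambda>t. F t - l) has_real_derivative w t) (at t)"
      by (auto intro!: derivative_eq_intros F[OF t])
    show "\<bar>F t - l\<bar> \<le> C * \<omega> t" using l[OF t] by linarith
  qed
qed

text \<open>Two candidates differ by a constant, which tends to 0 with \<omega>.\<close>

lemma antiderivative_unique:
  assumes "\<And>t. t > T \<Longrightarrow> (V has_real_derivative w t) (at t)" "\<And>t. t > T \<Longrightarrow> \<bar>V t\<bar> \<le> C * \<omega> t"
    and "\<And>t. t > T \<Longrightarrow> (W has_real_derivative w t) (at t)" "\<And>t. t > T \<Longrightarrow> \<bar>W t\<bar> \<le> D * \<omega> t"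
    and "t > T"
  shows "V t = W t"
proof -
  have "((\<lambda>t. V t - W t) has_real_derivative 0) (at s)" if "s > T" for s
    using DERIV_diff[OF assms(1,3), OF that that] by simp
  then have eq: "V s - W s = V t - W t" if "s > T" for s
    using that assms(5) by (intro DERIV_isconst3[of T "max s t + 1" s t "\<lambda>t. V t - W t"]) auto
  have ev: "eventually (\<lambda>s. norm (V t - W t) \<le> (C + D) * \<omega> s) at_top"
    using eventually_gt_at_top[of T]
  proof eventually_elim
    case (elim s)
    show ?case using eq[OF elim] assms(2,4)[OF elim] by (simp add: algebra_simps)
  qed
  have "((\<lambda>s. (C + D) * \<omega> s) \<longlongrightarrow> 0) at_top"
    by (rule tendsto_mult_right_zero[OF \<omega>_tendsto_0])
  from Lim_null_comparison[OF ev this] have "V t - W t = 0"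
    by (simp add: tendsto_const_iff)
  then show ?thesis by simp
qed

lemma prim:
  assumes "continuous_on {T<..} w" "\<And>t. t > T \<Longrightarrow> \<bar>w t\<bar> \<le> C * d t" "C \<ge> 0"
  shows "\<And>t. t > T \<Longrightarrow> (prim w has_real_derivative w t) (at t)"
    and "\<And>t. t > T \<Longrightarrow> \<bar>prim w t\<bar> \<le> C * \<omega> t"
proof -
  obtain W where W: "\<forall>t>T. (W has_real_derivative w t) (at t)" "\<forall>t>T. \<bar>W t\<bar> \<le> C * \<omega> t"
    using antiderivative_ex[OF assms] by blast
  then have "\<exists>W. (\<forall>t>T. (W has_real_derivative w t) (at t)) \<and> (\<exists>C. \<forall>t>T. \<bar>W t\<bar> \<le> C * \<omega> t)"
    by blast
  from someI_ex[OF this] have "(\<forall>t>T. (prim w has_real_derivative w t) (at t)) \<and> (\<exists>C. \<forall>t>T. \<bar>prim w t\<bar> \<le> C * \<omega> t)"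
    unfolding prim_def .
  then obtain D where D: "\<forall>t>T. (prim w has_real_derivative w t) (at t)" "\<forall>t>T. \<bar>prim w t\<bar> \<le> D * \<omega> t"
    by blast
  show "(prim w has_real_derivative w t) (at t)" if "t > T" for t using D that by blast
  show "\<bar>prim w t\<bar> \<le> C * \<omega> t" if "t > T" for t
    using antiderivative_unique[of "prim w" w D W C t] W D that by auto
qed

lemma prim_continuous:
  assumes "continuous_on {T<..} w" "\<And>t. t > T \<Longrightarrow> \<bar>w t\<bar> \<le> C * d t" "C \<ge> 0"
  shows "continuous_on {T<..} (prim w)"
  using prim(1)[OF assms] by (intro continuous_at_imp_continuous_on) (auto intro: DERIV_isCont)

lemma prim_diff:
  assumes "continuous_on {T<..} v" "\<And>t. t > T \<Longrightarrow> \<bar>v t\<bar> \<le> C * d t" "C \<ge> 0"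
    and "continuous_on {T<..} w" "\<And>t. t > T \<Longrightarrow> \<bar>w t\<bar> \<le> C * d t"
    and "\<And>t. t > T \<Longrightarrow> \<bar>v t - w t\<bar> \<le> D * d t" "D \<ge> 0" "t > T"
  shows "\<bar>prim v t - prim w t\<bar> \<le> D * \<omega> t"
proof -
  have c: "continuous_on {T<..} (\<lambda>t. v t - w t)" using assms by (intro continuous_intros)
  have "prim v t - prim w t = prim (\<lambda>t. v t - w t) t"
  proof (rule antiderivative_unique[of "\<lambda>t. prim v t - prim w t" "\<lambda>t. v t - w t" "C + C" _ D])
    fix s assume s: "s > T"
    show "((\<lambda>t. prim v t - prim w t) has_real_derivative v s - w s) (at s)"
      using s by (intro DERIV_diff prim(1)[where C = C] assms)
    have "\<bar>prim v s\<bar> \<le> C * \<omega> s" "\<bar>prim w s\<bar> \<le> C * \<omega> s"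
      using s by (auto intro!: prim(2) assms)
    then show "\<bar>prim v s - prim w s\<bar> \<le> (C + C) * \<omega> s" by (simp add: algebra_simps)
    show "(prim (\<lambda>t. v t - w t) has_real_derivative v s - w s) (at s)"
      using s by (intro prim(1)[OF c assms(6,7)])
    show "\<bar>prim (\<lambda>t. v t - w t) s\<bar> \<le> D * \<omega> s"
      using s by (intro prim(2)[OF c assms(6,7)])
  qed (rule assms)
  also have "\<bar>\<dots>\<bar> \<le> D * \<omega> t" by (rule prim(2)[OF c assms(6,7,8)])
  finally show ?thesis .
qed

text \<open>Because \<omega> \<le> d, each integration reproduces the bound C * d, so the number of
  iterations does not enter the constant; a single integration already gains \<omega>.\<close>

lemma prim_funpow:
  assumes "continuous_on {T<..} w" "\<And>t. t > T \<Longrightarrow> \<bar>w t\<bar> \<le> C * d t" "C \<ge> 0"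
  shows "continuous_on {T<..} ((prim ^^ j) w) \<and> (\<forall>t>T. \<bar>(prim ^^ j) w t\<bar> \<le> C * d t) \<and>
    (j > 0 \<longrightarrow> (\<forall>t>T. \<bar>(prim ^^ j) w t\<bar> \<le> C * \<omega> t))"
proof (induction j)
  case (Suc j)
  have "\<bar>(prim ^^ Suc j) w t\<bar> \<le> C * \<omega> t" if "t > T" for t
    using prim(2)[of "(prim ^^ j) w" C t] Suc assms(3) that by auto
  moreover have "C * \<omega> t \<le> C * d t" if "t > T" for t
    using \<omega>_le[OF that] assms(3) by (intro mult_left_mono)
  moreover have "continuous_on {T<..} ((prim ^^ Suc j) w)"
    using prim_continuous[of "(prim ^^ j) w" C] Suc assms(3) by auto
  ultimately show ?case by (meson order_trans)
qed (use assms in auto)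

lemma prim_funpow_diff:
  assumes "continuous_on {T<..} v" "\<And>t. t > T \<Longrightarrow> \<bar>v t\<bar> \<le> C * d t" "C \<ge> 0"
    and "continuous_on {T<..} w" "\<And>t. t > T \<Longrightarrow> \<bar>w t\<bar> \<le> C * d t"
    and "\<And>t. t > T \<Longrightarrow> \<bar>v t - w t\<bar> \<le> D * d t" "D \<ge> 0"
  shows "(\<forall>t>T. \<bar>(prim ^^ j) v t - (prim ^^ j) w t\<bar> \<le> D * d t) \<and>
    (j > 0 \<longrightarrow> (\<forall>t>T. \<bar>(prim ^^ j) v t - (prim ^^ j) w t\<bar> \<le> D * \<omega> t))"
proof (induction j)
  case (Suc j)
  have "\<bar>(prim ^^ Suc j) v t - (prim ^^ Suc j) w t\<bar> \<le> D * \<omega> t" if "t > T" for t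
    using prim_diff[of "(prim ^^ j) v" C "(prim ^^ j) w" D t] prim_funpow[OF assms(1-3), of j]
      prim_funpow[OF assms(4,5,3), of j] Suc assms(3,7) that by auto
  moreover have "D * \<omega> t \<le> D * d t" if "t > T" for t
    using \<omega>_le[OF that] assms(7) by (intro mult_left_mono)
  ultimately show ?case by (meson order_trans)
qed (use assms in auto)

text \<open>The unknown is the top function, written as d * u with u in the unit ball of the bounded
  continuous functions; the lower ones are iterated primitives of it. Accordingly differences of
  lower functions carry the smaller weight \<omega> in \<open>lip\<close>, and the factor 1/2 there
  makes the map contract.\<close>

theorem contraction_from_infinity:
  fixes E :: "real \<Rightarrow> (nat \<Rightarrow> real) \<Rightarrow> real"
  assumes E0: "\<And>t. t > T \<Longrightarrow> \<bar>E t (\<lambda>_. 0)\<bar> \<le> d t / 2"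
    and lip: "\<And>t x x' c. t > T \<Longrightarrow> c \<ge> 0 \<Longrightarrow> (\<And>k. k \<le> r \<Longrightarrow> \<bar>x k\<bar> \<le> d t \<and> \<bar>x' k\<bar> \<le> d t) \<Longrightarrow>
      (\<And>k. k < r \<Longrightarrow> \<bar>x k - x' k\<bar> \<le> c * \<omega> t) \<Longrightarrow> \<bar>x r - x' r\<bar> \<le> c * d t \<Longrightarrow>
      \<bar>E t x - E t x'\<bar> \<le> c / 2 * d t"
    and cont: "\<And>x. (\<And>k. k \<le> r \<Longrightarrow> continuous_on {T<..} (x k)) \<Longrightarrow> continuous_on {T<..} (\<lambda>t. E t (\<lambda>k. x k t))"
    and T1: "T1 > T"
  obtains z where "\<And>k t. k \<le> r \<Longrightarrow> t > T \<Longrightarrow> \<bar>z k t\<bar> \<le> d t"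
    "\<And>k t. k < r \<Longrightarrow> t > T \<Longrightarrow> (z k has_real_derivative z (Suc k) t) (at t)"
    "continuous_on {T<..} (z r)"
    "\<And>t. t \<ge> T1 \<Longrightarrow> z r t = E t (\<lambda>k. z k t)"
proof -
  define w where "w = (\<lambda>(u::real \<Rightarrow>\<^sub>C real) t. d t * u t)"
  define zz where "zz = (\<lambda>(u::real \<Rightarrow>\<^sub>C real) k. (prim ^^ (r - k)) (w u))"
  \<comment> \<open>Freezing the argument at T1 keeps it in t > T, where d is positive and
    continuous, and yields a function on the whole line. The equation therefore holds from T1 on
    only.\<close>
  define F where "F = (\<lambda>u t. E (max t T1) (\<lambda>k. zz u k (max t T1)) / d (max t T1))"
  define B where "B = cball (0::real \<Rightarrow>\<^sub>C real) 1"
  have B: "\<bar>u t\<bar> \<le> 1" if "u \<in> B" for u t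
    using norm_bounded[of u t] that by (auto simp: B_def)
  have w: "continuous_on {T<..} (w u)" "\<And>t. t > T \<Longrightarrow> \<bar>w u t\<bar> \<le> 1 * d t" if "u \<in> B" for u
  proof -
    show "continuous_on {T<..} (w u)" unfolding w_def by (intro continuous_intros d_cont) simp
    show "\<bar>w u t\<bar> \<le> 1 * d t" if "t > T" for t
      using B[OF \<open>u \<in> B\<close>, of t] d_pos[OF that] by (simp add: w_def abs_mult mult_left_le)
  qed
  have zz: "continuous_on {T<..} (zz u k)" "\<And>t. t > T \<Longrightarrow> \<bar>zz u k t\<bar> \<le> d t"
    "\<And>t. k < r \<Longrightarrow> t > T \<Longrightarrow> \<bar>zz u k t\<bar> \<le> \<omega> t" if "u \<in> B" for u k
    using prim_funpow[OF w[OF that], of "r - k"] by (auto simp: zz_def)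
  have zzd: "t > T \<Longrightarrow> \<bar>zz u k t - zz v k t\<bar> \<le> dist u v * d t"
    "k < r \<Longrightarrow> t > T \<Longrightarrow> \<bar>zz u k t - zz v k t\<bar> \<le> dist u v * \<omega> t" if "u \<in> B" "v \<in> B" for u v k t
  proof -
    have "\<bar>w u t - w v t\<bar> \<le> dist u v * d t" if "t > T" for t
    proof -
      have "\<bar>w u t - w v t\<bar> = d t * \<bar>u t - v t\<bar>"
        using d_pos[OF that] by (simp add: w_def abs_mult flip: right_diff_distrib)
      also have "\<dots> \<le> d t * dist u v"
        using d_pos[OF that] dist_bounded[of u t v] by (intro mult_left_mono) (auto simp: dist_real_def)
      finally show ?thesis by (simp add: mult.commute)
    qed
    from prim_funpow_diff[OF w[OF that(1)] _ w[OF that(2)] this, of "r - k"]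
    show "t > T \<Longrightarrow> \<bar>zz u k t - zz v k t\<bar> \<le> dist u v * d t"
      "k < r \<Longrightarrow> t > T \<Longrightarrow> \<bar>zz u k t - zz v k t\<bar> \<le> dist u v * \<omega> t"
      by (auto simp: zz_def)
  qed
  have mT: "max t T1 > T" for t using T1 by simp
  have EB: "\<bar>E t (\<lambda>k. zz u k t)\<bar> \<le> d t" if "u \<in> B" "t > T" for u t
  proof -
    have "\<bar>E t (\<lambda>k. zz u k t) - E t (\<lambda>_. 0)\<bar> \<le> 1 / 2 * d t"
      using zz[OF that(1)] that(2) d_pos[OF that(2)] by (intro lip) auto
    with E0[OF that(2)] show ?thesis by linarith
  qed
  have Fb: "\<bar>F u t\<bar> \<le> 1" if "u \<in> B" for u t
    using EB[OF that mT, of t] d_pos[OF mT, of t] by (simp add: F_def abs_divide)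
  have Fc: "F u \<in> bcontfun" if "u \<in> B" for u
  proof -
    have "continuous_on {T<..} (\<lambda>t. E t (\<lambda>k. zz u k t) / d t)"
      using zz(1)[OF that] d_pos by (intro continuous_intros cont d_cont) force+
    then have "continuous_on UNIV (\<lambda>s. E (max s T1) (\<lambda>k. zz u k (max s T1)) / d (max s T1))"
      by (rule continuous_on_compose2) (auto intro!: continuous_intros simp: mT)
    then have "continuous_on UNIV (F u)" by (simp add: F_def)
    moreover have "bounded (range (F u))" using Fb[OF that] by (auto simp: bounded_iff)
    ultimately show ?thesis by (simp add: bcontfun_def)
  qed
  have "closed B" by (simp add: B_def)
  have "\<exists>!u\<in>B. Bcontfun (F u) = u"
  proof (rule Banach_fix[where c = "1/2", OF complete_eq_closed[THEN iffD2, OF \<open>closed B\<close>]])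
    show "B \<noteq> {}" by (simp add: B_def)
    show "(\<lambda>u. Bcontfun (F u)) ` B \<subseteq> B"
    proof safe
      fix u assume "u \<in> B"
      then have "norm (Bcontfun (F u)) \<le> 1"
        by (intro norm_bound) (simp add: Bcontfun_inverse Fc Fb)
      then show "Bcontfun (F u) \<in> B" by (simp add: B_def)
    qed
    show "dist (Bcontfun (F u)) (Bcontfun (F v)) \<le> 1 / 2 * dist u v" if "u \<in> B" "v \<in> B" for u v
    proof (rule dist_bound)
      fix t
      let ?s = "max t T1"
      have "\<bar>E ?s (\<lambda>k. zz u k ?s) - E ?s (\<lambda>k. zz v k ?s)\<bar> \<le> dist u v / 2 * d ?s"
        using zz[OF that(1)] zz[OF that(2)] zzd[OF that] mT[of t] by (intro lip) auto
      then have "\<bar>F u t - F v t\<bar> \<le> dist u v / 2"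
        using d_pos[OF mT, of t] by (simp add: F_def pos_divide_le_eq flip: diff_divide_distrib)
      then show "dist (apply_bcontfun (Bcontfun (F u)) t) (apply_bcontfun (Bcontfun (F v)) t) \<le> 1 / 2 * dist u v"
        by (simp add: Bcontfun_inverse Fc that dist_real_def)
    qed
  qed auto
  then obtain u where u: "u \<in> B" "Bcontfun (F u) = u" by blast
  have fp: "u t = F u t" for t
    using u Bcontfun_inverse[OF Fc[OF u(1)]] by metis
  show ?thesis
  proof (rule that[of "zz u"])
    show "\<bar>zz u k t\<bar> \<le> d t" if "t > T" for k t using zz(2)[OF u(1) that] .
    show "(zz u k has_real_derivative zz u (Suc k) t) (at t)" if "k < r" "t > T" for k t
    proof -
      have eq: "zz u k = prim (zz u (Suc k))"
        using that(1) by (simp add: zz_def Suc_diff_Suc[symmetric])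
      show ?thesis unfolding eq
        by (rule prim(1)[where C = 1]) (use zz[OF u(1)] that in auto)
    qed
    show "continuous_on {T<..} (zz u r)" using zz(1)[OF u(1)] .
    show "zz u r t = E t (\<lambda>k. zz u k t)" if "t \<ge> T1" for t
    proof -
      have "zz u r t = d t * u t" by (simp add: zz_def w_def)
      also have "u t = E t (\<lambda>k. zz u k t) / d t" using fp[of t] that by (simp add: F_def)
      finally show ?thesis using d_pos[of t] that T1 by simp
    qed
  qed
qed

end

section \<open>Differential polynomials with their coefficient norms\<close>

text \<open>
  A pair \<open>(n, p)\<close> in \<open>polys S N r\<close> is a polynomial function \<open>p t x\<close> in \<open>x 0, \<dots>, x (r - 1)\<close>, of
  degree at most \<open>N\<close> in each variable, together with the sum \<open>n t\<close> of the absolute values of its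
  coefficients; the coefficients are functions in \<open>S\<close>.
\<close>

type_synonym npoly = "(real \<Rightarrow> real) \<times> (real \<Rightarrow> (nat \<Rightarrow> real) \<Rightarrow> real)"

text \<open>The degree in the new variable is a parameter of its own, since the lower bounds are
  proved by induction on it, separately from N.\<close>

definition layer :: "nat \<Rightarrow> nat \<Rightarrow> npoly set \<Rightarrow> npoly set" where
  "layer d r A = {((\<lambda>t. \<Sum>i\<le>d. n i t), (\<lambda>t x. \<Sum>i\<le>d. p i t x * x r ^ i)) |n p. \<forall>i\<le>d. (n i, p i) \<in> A}"

primrec polys :: "(real \<Rightarrow> real) set \<Rightarrow> nat \<Rightarrow> nat \<Rightarrow> npoly set" where
  "polys S N 0 = {((\<lambda>t. \<bar>c t\<bar>), (\<lambda>t x. c t)) |c. c \<in> S}"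
| "polys S N (Suc r) = layer N r (polys S N r)"

text \<open>The exponent e bounds the total degree. Coefficients enter through the factor n t alone,
  so one size and one Lipschitz estimate serve all polynomials of a given shape.\<close>

definition estimate :: "nat \<Rightarrow> nat \<Rightarrow> npoly \<Rightarrow> bool" where
  "estimate e r = (\<lambda>(n, p). (\<forall>t. n t \<ge> 0) \<and>
    (\<forall>t M x. M \<ge> 1 \<longrightarrow> (\<forall>k<r. \<bar>x k\<bar> \<le> M) \<longrightarrow> \<bar>p t x\<bar> \<le> n t * M ^ e) \<and>
    (\<forall>t M D x x'. M \<ge> 1 \<longrightarrow> (\<forall>k<r. \<bar>x k\<bar> \<le> M \<and> \<bar>x' k\<bar> \<le> M \<and> \<bar>x k - x' k\<bar> \<le> D) \<longrightarrow> D \<ge> 0 \<longrightarrow>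
       \<bar>p t x - p t x'\<bar> \<le> n t * (real e * M ^ e) * D))"

lemma power_diff_bound:
  assumes "\<bar>a\<bar> \<le> M" "\<bar>b\<bar> \<le> M" "\<bar>a - b\<bar> \<le> D" "M \<ge> (1::real)"
  shows "\<bar>a ^ i - b ^ i\<bar> \<le> real i * M ^ i * D"
proof (induction i)
  case (Suc i)
  have D: "D \<ge> 0" using assms(3) by linarith
  have "a ^ Suc i - b ^ Suc i = a * (a ^ i - b ^ i) + (a - b) * b ^ i"
    by (simp add: algebra_simps)
  also have "\<bar>\<dots>\<bar> \<le> \<bar>a\<bar> * \<bar>a ^ i - b ^ i\<bar> + \<bar>a - b\<bar> * \<bar>b\<bar> ^ i"
    by (metis abs_mult abs_triangle_ineq power_abs)
  also have "\<dots> \<le> M * (real i * M ^ i * D) + D * M ^ i"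
    using assms Suc D by (intro add_mono mult_mono power_mono) auto
  also have "\<dots> \<le> M * (real i * M ^ i * D) + D * (M * M ^ i)"
    using assms(4) D by (intro add_left_mono mult_left_mono) (auto intro: mult_right_mono[of 1 M, simplified])
  also have "\<dots> = real (Suc i) * M ^ Suc i * D" by (simp add: algebra_simps)
  finally show ?case .
qed simp

lemma estimate_layer:
  assumes "\<And>q. q \<in> A \<Longrightarrow> estimate e r q" "q \<in> layer d r A"
  shows "estimate (e + d) (Suc r) q"
proof -
  obtain n p where q: "q = ((\<lambda>t. \<Sum>i\<le>d. n i t), (\<lambda>t x. \<Sum>i\<le>d. p i t x * x r ^ i))"
    and np: "\<And>i. i \<le> d \<Longrightarrow> (n i, p i) \<in> A"
    using assms(2) unfolding layer_def by blast
  have est: "n i t \<ge> 0" "M \<ge> 1 \<Longrightarrow> (\<And>k. k < r \<Longrightarrow> \<bar>x k\<bar> \<le> M) \<Longrightarrow> \<bar>p i t x\<bar> \<le> n i t * M ^ e"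
    "M \<ge> 1 \<Longrightarrow> (\<And>k. k < r \<Longrightarrow> \<bar>x k\<bar> \<le> M \<and> \<bar>x' k\<bar> \<le> M \<and> \<bar>x k - x' k\<bar> \<le> D) \<Longrightarrow> D \<ge> 0 \<Longrightarrow>
       \<bar>p i t x - p i t x'\<bar> \<le> n i t * (real e * M ^ e) * D" if "i \<le> d" for i t M x x' D
    using assms(1)[OF np[OF that]] unfolding estimate_def by auto
  have 1: "\<bar>\<Sum>i\<le>d. p i t x * x r ^ i\<bar> \<le> (\<Sum>i\<le>d. n i t) * M ^ (e + d)"
    if M: "M \<ge> 1" and x: "\<forall>k<Suc r. \<bar>x k\<bar> \<le> M" for t M x
    unfolding sum_distrib_right
  proof (rule order_trans[OF sum_abs sum_mono])
    fix i assume "i \<in> {..d}"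
    then have i: "i \<le> d" by simp
    have "\<bar>p i t x * x r ^ i\<bar> \<le> (n i t * M ^ e) * M ^ i"
      unfolding abs_mult power_abs using x M est(1)[OF i]
      by (intro mult_mono est(2)[OF i] power_mono) auto
    also have "\<dots> \<le> (n i t * M ^ e) * M ^ d"
      using est(1)[OF i] M i by (intro mult_left_mono power_increasing) auto
    finally show "\<bar>p i t x * x r ^ i\<bar> \<le> n i t * M ^ (e + d)" by (simp add: power_add mult_ac)
  qed
  have 2: "\<bar>(\<Sum>i\<le>d. p i t x * x r ^ i) - (\<Sum>i\<le>d. p i t x' * x' r ^ i)\<bar> \<le>
      (\<Sum>i\<le>d. n i t) * (real (e + d) * M ^ (e + d)) * D"
    if M: "M \<ge> 1" and x: "\<forall>k<Suc r. \<bar>x k\<bar> \<le> M \<and> \<bar>x' k\<bar> \<le> M \<and> \<bar>x k - x' k\<bar> \<le> D" and D: "D \<ge> 0" for t M D x x'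
    unfolding sum_distrib_right sum_subtractf[symmetric]
  proof (rule order_trans[OF sum_abs sum_mono])
    fix i assume "i \<in> {..d}"
    then have i: "i \<le> d" by simp
    note n0 = est(1)[OF i, of t]
    have "p i t x * x r ^ i - p i t x' * x' r ^ i = (p i t x - p i t x') * x r ^ i + p i t x' * (x r ^ i - x' r ^ i)"
      by (simp add: algebra_simps)
    also have "\<bar>\<dots>\<bar> \<le> \<bar>p i t x - p i t x'\<bar> * \<bar>x r\<bar> ^ i + \<bar>p i t x'\<bar> * \<bar>x r ^ i - x' r ^ i\<bar>"
      by (metis abs_mult abs_triangle_ineq power_abs)
    also have "\<dots> \<le> (n i t * (real e * M ^ e) * D) * M ^ i + (n i t * M ^ e) * (real i * M ^ i * D)"
      using x M n0 D by (intro add_mono mult_mono est(2,3)[OF i] power_mono power_diff_bound) auto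
    also have "\<dots> = n i t * D * real (e + i) * M ^ (e + i)" by (simp add: power_add algebra_simps)
    also have "\<dots> \<le> n i t * D * real (e + d) * M ^ (e + d)"
      using n0 D M i by (intro mult_mono power_increasing) auto
    finally show "\<bar>p i t x * x r ^ i - p i t x' * x' r ^ i\<bar> \<le> n i t * (real (e + d) * M ^ (e + d)) * D"
      by (simp add: mult_ac)
  qed
  show ?thesis
    unfolding q estimate_def prod.case
    using est(1) 1 2 by (auto intro!: sum_nonneg)
qed

lemma estimate_polys: "q \<in> polys S N r \<Longrightarrow> estimate (N * r) r q"
proof (induction r arbitrary: q)
  case (Suc r)
  then have "estimate (N * r + N) (Suc r) q"
    by (intro estimate_layer[of "polys S N r"]) auto
  then show ?case by (simp add: add.commute)
qed (auto simp: estimate_def)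

lemma estimate_layer_polys: "q \<in> layer d r (polys S N r) \<Longrightarrow> estimate (N * r + d) (Suc r) q"
  by (rule estimate_layer[OF estimate_polys])

lemma estimateD:
  assumes "estimate e r (n, p)"
  shows "n t \<ge> 0"
    and "M \<ge> 1 \<Longrightarrow> (\<And>k. k < r \<Longrightarrow> \<bar>x k\<bar> \<le> M) \<Longrightarrow> \<bar>p t x\<bar> \<le> n t * M ^ e"
    and "M \<ge> 1 \<Longrightarrow> (\<And>k. k < r \<Longrightarrow> \<bar>x k\<bar> \<le> M) \<Longrightarrow> (\<And>k. k < r \<Longrightarrow> \<bar>x' k\<bar> \<le> M) \<Longrightarrow>
      (\<And>k. k < r \<Longrightarrow> \<bar>x k - x' k\<bar> \<le> D) \<Longrightarrow> D \<ge> 0 \<Longrightarrow> \<bar>p t x - p t x'\<bar> \<le> n t * (real e * M ^ e) * D"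
  using assms unfolding estimate_def by auto

text \<open>The Lipschitz estimate with D = 0, on a box large enough for x.\<close>

lemma estimate_cong:
  assumes "estimate e r (n, p)" "\<And>k. k < r \<Longrightarrow> x k = x' k"
  shows "p t x = p t x'"
proof -
  define M where "M = 1 + (\<Sum>k<r. \<bar>x k\<bar>)"
  have "\<bar>x k\<bar> \<le> M" if "k < r" for k
  proof -
    have "\<bar>x k\<bar> \<le> (\<Sum>k<r. \<bar>x k\<bar>)" using that by (intro member_le_sum) auto
    then show ?thesis by (simp add: M_def)
  qed
  moreover have "M \<ge> 1" by (simp add: M_def sum_nonneg)
  ultimately have "\<bar>p t x - p t x'\<bar> \<le> n t * (real e * M ^ e) * 0"
    using assms(2) by (intro estimateD(3)[OF assms(1)]) auto
  then show ?thesis by simp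
qed

lemma layer_continuous:
  assumes "\<And>n p. (n, p) \<in> A \<Longrightarrow> eventually (\<lambda>T. \<forall>x. (\<forall>k<r. continuous_on {T<..} (x k)) \<longrightarrow>
      continuous_on {T<..} (\<lambda>t. p t (\<lambda>k. x k t))) at_top"
    and "(n, p) \<in> layer d r A"
  shows "eventually (\<lambda>T. \<forall>x. (\<forall>k<Suc r. continuous_on {T<..} (x k)) \<longrightarrow>
      continuous_on {T<..} (\<lambda>t. p t (\<lambda>k. x k t))) at_top"
proof -
  obtain m q where p: "p = (\<lambda>t x. \<Sum>i\<le>d. q i t x * x r ^ i)" and mq: "\<And>i. i \<le> d \<Longrightarrow> (m i, q i) \<in> A"
    using assms(2) unfolding layer_def by blast
  have "eventually (\<lambda>T. \<forall>i\<in>{..d}. \<forall>x. (\<forall>k<r. continuous_on {T<..} (x k)) \<longrightarrow>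
      continuous_on {T<..} (\<lambda>t. q i t (\<lambda>k. x k t))) at_top"
    by (rule eventually_ball_finite) (use assms(1)[OF mq] in auto)
  then show ?thesis
    unfolding p by eventually_elim (auto intro!: continuous_intros)
qed

lemma (in hfun) polys_continuous:
  "(n, p) \<in> polys S N r \<Longrightarrow> eventually (\<lambda>T. \<forall>x. (\<forall>k<r. continuous_on {T<..} (x k)) \<longrightarrow>
      continuous_on {T<..} (\<lambda>t. p t (\<lambda>k. x k t))) at_top"
proof (induction r arbitrary: n p)
  case 0
  then obtain c where c: "p = (\<lambda>t x. c t)" "c \<in> S" by auto
  obtain a where "\<And>t. t \<ge> a \<Longrightarrow> isCont c t" using econt[OF c(2)] unfolding eventually_at_top_linorder by blast
  then have "continuous_on {T<..} c" if "T \<ge> a" for T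
    using that by (intro continuous_at_imp_continuous_on) auto
  then show ?case unfolding c eventually_at_top_linorder by blast
next
  case (Suc r)
  then show ?case using layer_continuous[of "polys S N r" r n p N] by simp
qed

lemma (in hfun) layer_polys_continuous:
  "(n, p) \<in> layer d r (polys S N r) \<Longrightarrow> eventually (\<lambda>T. \<forall>x. (\<forall>k<Suc r. continuous_on {T<..} (x k)) \<longrightarrow>
      continuous_on {T<..} (\<lambda>t. p t (\<lambda>k. x k t))) at_top"
  by (rule layer_continuous[OF polys_continuous])

lemma (in hfun) polys_norm_mem: "(n, p) \<in> polys S N r \<Longrightarrow> n \<in> S"
  by (induction r arbitrary: n p) (auto simp: layer_def intro: abs sum)

lemma (in hfun) layer_norm_mem: "(n, p) \<in> layer d r (polys S N r) \<Longrightarrow> n \<in> S"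
  by (auto simp: layer_def intro!: sum intro: polys_norm_mem)

lemma (in hfun) polys_eval_mem:
  "(n, p) \<in> polys A N r \<Longrightarrow> A \<subseteq> S \<Longrightarrow> (\<And>k. k < r \<Longrightarrow> z k \<in> S) \<Longrightarrow> (\<lambda>t. p t (\<lambda>k. z k t)) \<in> S"
  by (induction r arbitrary: n p) (auto simp: layer_def intro!: sum mult power)

lemma (in hfun) layer_eval_mem:
  "(n, p) \<in> layer d r (polys A N r) \<Longrightarrow> A \<subseteq> S \<Longrightarrow> (\<And>k. k \<le> r \<Longrightarrow> z k \<in> S) \<Longrightarrow> (\<lambda>t. p t (\<lambda>k. z k t)) \<in> S"
proof -
  assume A: "A \<subseteq> S" and z: "\<And>k. k \<le> r \<Longrightarrow> z k \<in> S" and "(n, p) \<in> layer d r (polys A N r)"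
  then obtain m q where p: "p = (\<lambda>t x. \<Sum>i\<le>d. q i t x * x r ^ i)" and mq: "\<And>i. i \<le> d \<Longrightarrow> (m i, q i) \<in> polys A N r"
    unfolding layer_def by blast
  have "(\<lambda>t. q i t (\<lambda>k. z k t)) \<in> S" if "i \<le> d" for i
    by (rule polys_eval_mem[OF mq[OF that] A]) (simp add: z)
  then show ?thesis
    unfolding p using z[of r] by (intro sum mult power) auto
qed

lemma (in hfun) polys_scale:
  assumes "c \<ge> 0" "(\<lambda>_. c) \<in> S"
  shows "(n, p) \<in> polys S N r \<Longrightarrow> ((\<lambda>t. c * n t), (\<lambda>t x. c * p t x)) \<in> polys S N r"
proof (induction r arbitrary: n p)
  case 0
  then obtain h where h: "n = (\<lambda>t. \<bar>h t\<bar>)" "p = (\<lambda>t x. h t)" "h \<in> S" by auto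
  then show ?case using assms mult[OF assms(2) h(3)] by (auto intro!: exI[of _ "\<lambda>t. c * h t"] simp: abs_mult)
next
  case (Suc r)
  then obtain m q where n: "n = (\<lambda>t. \<Sum>i\<le>N. m i t)" "p = (\<lambda>t x. \<Sum>i\<le>N. q i t x * x r ^ i)"
    and mq: "\<And>i. i \<le> N \<Longrightarrow> (m i, q i) \<in> polys S N r"
    by (auto simp: layer_def)
  show ?case
    unfolding polys.simps layer_def n using Suc.IH[OF mq]
    by (intro CollectI exI[of _ "\<lambda>i t. c * m i t"] exI[of _ "\<lambda>i t x. c * q i t x"])
       (auto simp: sum_distrib_left mult.assoc)
qed

lemma layer_mono:
  assumes "A \<subseteq> B" "d \<le> e" "((\<lambda>_. 0), (\<lambda>_ _. 0)) \<in> B"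
  shows "layer d r A \<subseteq> layer e r B"
proof
  fix q assume "q \<in> layer d r A"
  then obtain n p where q: "q = ((\<lambda>t. \<Sum>i\<le>d. n i t), (\<lambda>t x. \<Sum>i\<le>d. p i t x * x r ^ i))"
    and np: "\<And>i. i \<le> d \<Longrightarrow> (n i, p i) \<in> A"
    unfolding layer_def by blast
  define n' where "n' = (\<lambda>i. if i \<le> d then n i else (\<lambda>t. 0))"
  define p' where "p' = (\<lambda>i. if i \<le> d then p i else (\<lambda>t x. 0))"
  have "(\<Sum>i\<le>d. n i t) = (\<Sum>i\<le>e. n' i t)" for t
    by (rule sum.mono_neutral_cong_left) (use assms(2) in \<open>auto simp: n'_def\<close>)
  moreover have "(\<Sum>i\<le>d. p i t x * x r ^ i) = (\<Sum>i\<le>e. p' i t x * x r ^ i)" for t x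
    by (rule sum.mono_neutral_cong_left) (use assms(2) in \<open>auto simp: p'_def\<close>)
  moreover have "(n' i, p' i) \<in> B" for i
    using np assms by (auto simp: n'_def p'_def)
  ultimately show "q \<in> layer e r B" unfolding q layer_def
    by (intro CollectI exI[of _ n'] exI[of _ p']) simp
qed

lemma (in hfun) zero_polys: "((\<lambda>_. 0), (\<lambda>_ _. 0)) \<in> polys S N r"
proof (induction r)
  case (Suc r)
  then show ?case
    by (auto simp: layer_def intro!: exI[of _ "\<lambda>_ _. 0"] exI[of _ "\<lambda>_ _ _. 0"])
qed (auto intro!: exI[of _ "\<lambda>_. 0"] zero)

lemma (in hfun) polys_mono: "N \<le> N' \<Longrightarrow> polys S N r \<subseteq> polys S N' r"
proof (induction r)
  case (Suc r)
  assume "N \<le> N'"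
  with Suc show ?case unfolding polys.simps by (intro layer_mono zero_polys) auto
qed simp

text \<open>Degree bound and coefficient norm are forgotten here, since products and pseudo-division
  change both. Each element still lies in some \<open>polys S N r\<close>, and the lower bounds are
  proved for every N.\<close>

definition pfun :: "(real \<Rightarrow> real) set \<Rightarrow> nat \<Rightarrow> (real \<Rightarrow> (nat \<Rightarrow> real) \<Rightarrow> real) set" where
  "pfun S r = {p. \<exists>N n. (n, p) \<in> polys S N r}"

section \<open>The ring of polynomial functions and pseudo-division\<close>

context hfun
begin

lemma pfun_family:
  assumes "\<And>i. i \<le> (d::nat) \<Longrightarrow> p i \<in> pfun S r"
  shows "\<exists>N n. \<forall>i\<le>d. (n i, p i) \<in> polys S N r"
proof -
  have "\<exists>N n. (n, p i) \<in> polys S N r" if "i \<le> d" for i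
    using assms[OF that] by (simp add: pfun_def)
  then obtain N n where Nn: "\<And>i. i \<le> d \<Longrightarrow> (n i, p i) \<in> polys S (N i) r"
    by metis
  have "(n i, p i) \<in> polys S (\<Sum>i\<le>d. N i) r" if "i \<le> d" for i
  proof -
    have "N i \<le> (\<Sum>i\<le>d. N i)" using that by (intro member_le_sum) auto
    then show ?thesis using polys_mono Nn[OF that] by blast
  qed
  then show ?thesis by blast
qed

lemma layer_pfun:
  assumes "\<And>i. i \<le> (d::nat) \<Longrightarrow> p i \<in> pfun S r"
  shows "\<exists>N n. (n, (\<lambda>t x. \<Sum>i\<le>d. p i t x * x r ^ i)) \<in> layer d r (polys S N r)"
  using pfun_family[of d p r] assms unfolding layer_def by blast

lemma pfun_SucI:
  assumes "\<And>i. i \<le> (d::nat) \<Longrightarrow> p i \<in> pfun S r"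
  shows "(\<lambda>t x. \<Sum>i\<le>d. p i t x * x r ^ i) \<in> pfun S (Suc r)"
proof -
  obtain N n where "(n, (\<lambda>t x. \<Sum>i\<le>d. p i t x * x r ^ i)) \<in> layer d r (polys S N r)"
    using layer_pfun[of d p r] assms by blast
  then have "(n, (\<lambda>t x. \<Sum>i\<le>d. p i t x * x r ^ i)) \<in> layer (max d N) r (polys S (max d N) r)"
    using layer_mono[OF polys_mono[of N "max d N" r] _ zero_polys, of d "max d N" r] by auto
  then show ?thesis unfolding pfun_def by (metis (mono_tags, lifting) mem_Collect_eq polys.simps(2))
qed

lemma pfun_SucE:
  assumes "q \<in> pfun S (Suc r)"
  obtains d p where "q = (\<lambda>t x. \<Sum>i\<le>d. p i t x * x r ^ i)" "\<And>i. i \<le> d \<Longrightarrow> p i \<in> pfun S r"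
proof -
  obtain N n where "(n, q) \<in> layer N r (polys S N r)" using assms by (auto simp: pfun_def)
  then obtain m p where "q = (\<lambda>t x. \<Sum>i\<le>N. p i t x * x r ^ i)" "\<forall>i\<le>N. (m i, p i) \<in> polys S N r"
    unfolding layer_def by blast
  then show ?thesis by (intro that[where d = N and p = p]) (auto simp: pfun_def)
qed

lemma pfun_0: "pfun S 0 = {\<lambda>t x. c t |c. c \<in> S}"
  by (auto simp: pfun_def)

lemma pfun_const: "c \<in> S \<Longrightarrow> (\<lambda>t x. c t) \<in> pfun S r"
proof (induction r)
  case (Suc r)
  then show ?case using pfun_SucI[of 0 "\<lambda>_ t x. c t" r] by simp
qed (auto simp: pfun_0)

lemma pfun_lift: "p \<in> pfun S r \<Longrightarrow> p \<in> pfun S (Suc r)"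
  using pfun_SucI[of 0 "\<lambda>_. p" r] by simp

text \<open>Sum and product share one induction, because a product in one more variable both
  multiplies and adds coefficients of the level below.\<close>

lemma pfun_add_mult:
  "(\<forall>p\<in>pfun S r. \<forall>q\<in>pfun S r. (\<lambda>t x. p t x + q t x) \<in> pfun S r) \<and>
   (\<forall>p\<in>pfun S r. \<forall>q\<in>pfun S r. (\<lambda>t x. p t x * q t x) \<in> pfun S r)"
proof (induction r)
  case 0
  then show ?case by (auto simp: pfun_0 intro: add mult)
next
  case (Suc r)
  have zero: "(\<lambda>t x. 0) \<in> pfun S r" using pfun_const[OF zero] .
  have A: "(\<lambda>t x. p t x + q t x) \<in> pfun S (Suc r)" if pq: "p \<in> pfun S (Suc r)" "q \<in> pfun S (Suc r)" for p q
  proof -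
    obtain d a where p: "p = (\<lambda>t x. \<Sum>i\<le>d. a i t x * x r ^ i)" "\<And>i. i \<le> d \<Longrightarrow> a i \<in> pfun S r"
      using pfun_SucE[OF pq(1)] by blast
    obtain e b where q: "q = (\<lambda>t x. \<Sum>i\<le>e. b i t x * x r ^ i)" "\<And>i. i \<le> e \<Longrightarrow> b i \<in> pfun S r"
      using pfun_SucE[OF pq(2)] by blast
    define c where "c = (\<lambda>i t x. (if i \<le> d then a i else (\<lambda>t x. 0)) t x + (if i \<le> e then b i else (\<lambda>t x. 0)) t x)"
    have "c i \<in> pfun S r" for i
      using Suc p(2) q(2) zero unfolding c_def by simp
    then have "(\<lambda>t x. \<Sum>i\<le>max d e. c i t x * x r ^ i) \<in> pfun S (Suc r)" by (intro pfun_SucI)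
    also have "(\<lambda>t x. \<Sum>i\<le>max d e. c i t x * x r ^ i) = (\<lambda>t x. p t x + q t x)"
    proof (intro ext)
      fix t x
      have "(\<Sum>i\<le>max d e. c i t x * x r ^ i) =
        (\<Sum>i\<le>max d e. if i \<le> d then a i t x * x r ^ i else 0) + (\<Sum>i\<le>max d e. if i \<le> e then b i t x * x r ^ i else 0)"
        unfolding sum.distrib[symmetric] by (intro sum.cong) (auto simp: c_def distrib_right)
      moreover have "(\<Sum>i\<le>max d e. if i \<le> d then a i t x * x r ^ i else 0) = p t x"
        unfolding p(1) by (rule sum.mono_neutral_cong_right) auto
      moreover have "(\<Sum>i\<le>max d e. if i \<le> e then b i t x * x r ^ i else 0) = q t x"
        unfolding q(1) by (rule sum.mono_neutral_cong_right) auto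
      ultimately show "(\<Sum>i\<le>max d e. c i t x * x r ^ i) = p t x + q t x" by simp
    qed
    finally show ?thesis .
  qed
  \<comment> \<open>Multiplication by a monomial in the last variable shifts the coefficient
    sequence; general products are sums of such shifts.\<close>
  have shift: "(\<lambda>t x. c t x * q t x * x r ^ k) \<in> pfun S (Suc r)" if c: "c \<in> pfun S r" and q: "q \<in> pfun S (Suc r)" for c q k
  proof -
    obtain e b where q: "q = (\<lambda>t x. \<Sum>i\<le>e. b i t x * x r ^ i)" "\<And>i. i \<le> e \<Longrightarrow> b i \<in> pfun S r"
      using pfun_SucE[OF q] by blast
    define h where "h = (\<lambda>i t x. if k \<le> i then c t x * b (i - k) t x else 0)"
    have "h i \<in> pfun S r" if "i \<le> e + k" for i
      using Suc c q(2)[of "i - k"] that zero unfolding h_def by (cases "k \<le> i") auto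
    then have "(\<lambda>t x. \<Sum>i\<le>e + k. h i t x * x r ^ i) \<in> pfun S (Suc r)" by (intro pfun_SucI)
    also have "(\<lambda>t x. \<Sum>i\<le>e + k. h i t x * x r ^ i) = (\<lambda>t x. c t x * q t x * x r ^ k)"
    proof (intro ext)
      fix t x
      have "(\<Sum>i\<le>e + k. h i t x * x r ^ i) = (\<Sum>i\<in>{k..e + k}. h i t x * x r ^ i)"
        by (rule sum.mono_neutral_right) (auto simp: h_def)
      also have "\<dots> = (\<Sum>i\<le>e. h (i + k) t x * x r ^ (i + k))"
        using sum.shift_bounds_cl_nat_ivl[of "\<lambda>i. h i t x * x r ^ i" 0 k e] by (simp add: atLeast0AtMost)
      also have "\<dots> = c t x * q t x * x r ^ k"
        unfolding q(1) h_def by (simp add: sum_distrib_left sum_distrib_right power_add mult_ac)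
      finally show "(\<Sum>i\<le>e + k. h i t x * x r ^ i) = c t x * q t x * x r ^ k" .
    qed
    finally show ?thesis .
  qed
  have M: "(\<lambda>t x. p t x * q t x) \<in> pfun S (Suc r)" if pq: "p \<in> pfun S (Suc r)" "q \<in> pfun S (Suc r)" for p q
  proof -
    obtain d a where p: "p = (\<lambda>t x. \<Sum>i\<le>d. a i t x * x r ^ i)" "\<And>i. i \<le> d \<Longrightarrow> a i \<in> pfun S r"
      using pfun_SucE[OF pq(1)] by blast
    have "(\<lambda>t x. \<Sum>i\<le>m. a i t x * q t x * x r ^ i) \<in> pfun S (Suc r)" if "m \<le> d" for m
      using that
    proof (induction m)
      case 0
      then show ?case using shift[OF p(2) pq(2), of 0 0] by simp
    next
      case (Suc m)
      then show ?case using A[OF _ shift[OF p(2) pq(2), of "Suc m" "Suc m"]] by simp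
    qed
    then have "(\<lambda>t x. \<Sum>i\<le>d. a i t x * q t x * x r ^ i) \<in> pfun S (Suc r)" by simp
    also have "(\<lambda>t x. \<Sum>i\<le>d. a i t x * q t x * x r ^ i) = (\<lambda>t x. p t x * q t x)"
      unfolding p(1) sum_distrib_right by (intro ext sum.cong) auto
    finally show ?thesis .
  qed
  show ?case using A M by blast
qed

lemma pfun_add: "p \<in> pfun S r \<Longrightarrow> q \<in> pfun S r \<Longrightarrow> (\<lambda>t x. p t x + q t x) \<in> pfun S r"
  and pfun_mult: "p \<in> pfun S r \<Longrightarrow> q \<in> pfun S r \<Longrightarrow> (\<lambda>t x. p t x * q t x) \<in> pfun S r"
  using pfun_add_mult by blast+

lemma pfun_diff: "p \<in> pfun S r \<Longrightarrow> q \<in> pfun S r \<Longrightarrow> (\<lambda>t x. p t x - q t x) \<in> pfun S r"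
  using pfun_add[OF _ pfun_mult[OF pfun_const[OF uminus[OF one]]], of p r q] by simp

lemma pfun_power: "p \<in> pfun S r \<Longrightarrow> (\<lambda>t x. p t x ^ m) \<in> pfun S r"
  by (induction m) (auto intro: pfun_mult pfun_const[OF one, simplified])

lemma pfun_var: "k < r \<Longrightarrow> (\<lambda>t x. x k) \<in> pfun S r"
proof (induction r)
  case (Suc r)
  show ?case
  proof (cases "k = r")
    case True
    have "(\<lambda>t x. \<Sum>i\<le>1. (if i = 0 then (\<lambda>t x. 0) else (\<lambda>t x. 1)) t x * x r ^ i) \<in> pfun S (Suc r)"
      using pfun_const[OF zero] pfun_const[OF one] by (intro pfun_SucI) auto
    then show ?thesis by (simp add: True)
  next
    case False
    with Suc show ?thesis by (intro pfun_lift) auto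
  qed
qed simp

lemma pfun_mono: "r \<le> r' \<Longrightarrow> pfun S r \<subseteq> pfun S r'"
  by (induction r' rule: dec_induct) (auto intro: pfun_lift)

text \<open>Horner's scheme, one coefficient of q at a time. The identity is pointwise on the zero
  set of the divisor, and the power of the leading coefficient stays on the side of q, so nothing is
  ever divided.\<close>

lemma pfun_pseudo_division:
  assumes p: "\<And>i. i \<le> Suc d \<Longrightarrow> p i \<in> pfun S r" and q: "q \<in> pfun S (Suc r)"
  obtains m c where "\<And>i. i \<le> d \<Longrightarrow> c i \<in> pfun S r"
    "\<And>t x. (\<Sum>i\<le>Suc d. p i t x * x r ^ i) = 0 \<Longrightarrow> p (Suc d) t x ^ m * q t x = (\<Sum>i\<le>d. c i t x * x r ^ i)"
proof -
  define l where "l = p (Suc d)"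
  have l: "l \<in> pfun S r" using p by (simp add: l_def)
  have main: "\<exists>m c. (\<forall>i\<le>d. c i \<in> pfun S r) \<and> (\<forall>t x. (\<Sum>i\<le>Suc d. p i t x * x r ^ i) = 0 \<longrightarrow>
      l t x ^ m * (\<Sum>i\<le>e. a i t x * x r ^ i) = (\<Sum>i\<le>d. c i t x * x r ^ i))"
    if "\<And>i. i \<le> e \<Longrightarrow> a i \<in> pfun S r" for e a
    using that
  proof (induction e arbitrary: a)
    case 0
    have "(\<Sum>i\<le>d. (if i = 0 then a 0 else (\<lambda>t x. 0)) t x * x r ^ i) = a 0 t x" for t x
      by (subst sum.mono_neutral_cong_right[of _ "{0}" _ "\<lambda>i. a 0 t x"]) auto
    with 0 show ?case
      using pfun_const[OF zero]
      by (intro exI[of _ 0] exI[of _ "\<lambda>i. if i = 0 then a 0 else (\<lambda>t x. 0)"]) simp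
  next
    case (Suc e)
    obtain m c where c: "\<And>i. i \<le> d \<Longrightarrow> c i \<in> pfun S r"
      and eq: "\<And>t x. (\<Sum>i\<le>Suc d. p i t x * x r ^ i) = 0 \<Longrightarrow>
        l t x ^ m * (\<Sum>i\<le>e. a (Suc i) t x * x r ^ i) = (\<Sum>i\<le>d. c i t x * x r ^ i)"
      using Suc.IH[of "\<lambda>i. a (Suc i)"] Suc.prems by auto
    \<comment> \<open>Multiplying the previous remainder by x r creates a term of degree Suc d.
      After a factor l this term equals - c d times the lower part of the divisor, wherever the
      divisor vanishes.\<close>
    define c' where "c' = (\<lambda>i t x. (if i = 0 then (\<lambda>t x. l t x ^ Suc m * a 0 t x) else (\<lambda>t x. l t x * c (i - 1) t x)) t x
        - c d t x * p i t x)"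
    have c': "c' i \<in> pfun S r" if "i \<le> d" for i
      unfolding c'_def using that l c Suc.prems p
      by (cases "i = 0") (auto intro!: pfun_diff pfun_mult pfun_power)
    have "l t x ^ Suc m * (\<Sum>i\<le>Suc e. a i t x * x r ^ i) = (\<Sum>i\<le>d. c' i t x * x r ^ i)"
      if 0: "(\<Sum>i\<le>Suc d. p i t x * x r ^ i) = 0" for t x
    proof -
      have "(\<Sum>i\<le>d. c' i t x * x r ^ i) + c d t x * (\<Sum>i\<le>d. p i t x * x r ^ i) =
          (\<Sum>i\<le>d. (if i = 0 then l t x ^ Suc m * a 0 t x else l t x * c (i - 1) t x) * x r ^ i)"
        unfolding sum_distrib_left sum.distrib[symmetric]
        by (intro sum.cong) (auto simp: c'_def algebra_simps)
      also have "(\<Sum>i\<le>d. p i t x * x r ^ i) = - l t x * x r ^ Suc d"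
        using 0 by (simp add: l_def)
      also have "(\<Sum>i\<le>d. (if i = 0 then l t x ^ Suc m * a 0 t x else l t x * c (i - 1) t x) * x r ^ i) =
          (\<Sum>i\<le>Suc d. (if i = 0 then l t x ^ Suc m * a 0 t x else l t x * c (i - 1) t x) * x r ^ i) - l t x * c d t x * x r ^ Suc d"
        by simp
      also have "(\<Sum>i\<le>Suc d. (if i = 0 then l t x ^ Suc m * a 0 t x else l t x * c (i - 1) t x) * x r ^ i) =
          l t x ^ Suc m * a 0 t x + l t x * x r * (\<Sum>i\<le>d. c i t x * x r ^ i)"
        by (subst sum.atMost_Suc_shift) (simp add: sum_distrib_left mult_ac)
      also have "(\<Sum>i\<le>d. c i t x * x r ^ i) = l t x ^ m * (\<Sum>i\<le>e. a (Suc i) t x * x r ^ i)"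
        using eq[OF 0] by simp
      also have "l t x ^ Suc m * a 0 t x + l t x * x r * (l t x ^ m * (\<Sum>i\<le>e. a (Suc i) t x * x r ^ i)) =
          l t x ^ Suc m * (a 0 t x + x r * (\<Sum>i\<le>e. a (Suc i) t x * x r ^ i))"
        by (simp add: algebra_simps)
      also have "a 0 t x + x r * (\<Sum>i\<le>e. a (Suc i) t x * x r ^ i) = (\<Sum>i\<le>Suc e. a i t x * x r ^ i)"
        unfolding sum.atMost_Suc_shift[of _ e] by (simp add: sum_distrib_left mult_ac)
      finally show ?thesis by simp
    qed
    with c' show ?case by blast
  qed
  obtain e a where a: "q = (\<lambda>t x. \<Sum>i\<le>e. a i t x * x r ^ i)" "\<And>i. i \<le> e \<Longrightarrow> a i \<in> pfun S r"
    by (rule pfun_SucE[OF q]) (rule that)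
  from main[of e a] a(2) have "\<exists>m c. (\<forall>i\<le>d. c i \<in> pfun S r) \<and> (\<forall>t x. (\<Sum>i\<le>Suc d. p i t x * x r ^ i) = 0 \<longrightarrow>
      l t x ^ m * (\<Sum>i\<le>e. a i t x * x r ^ i) = (\<Sum>i\<le>d. c i t x * x r ^ i))" by simp
  then obtain m c where c: "\<forall>i\<le>d. c i \<in> pfun S r"
    "\<forall>t x. (\<Sum>i\<le>Suc d. p i t x * x r ^ i) = 0 \<longrightarrow>
      l t x ^ m * (\<Sum>i\<le>e. a i t x * x r ^ i) = (\<Sum>i\<le>d. c i t x * x r ^ i)"
    by (elim exE conjE)
  show ?thesis
    by (rule that[of c m]) (use c in \<open>auto simp: a(1) l_def\<close>)
qed

text \<open>Q is left open because the lemma serves several purposes: membership in a fraction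
  field, membership in a ring generated on a tail, regularity on a tail. Closure under sums and
  products is all that these have in common.\<close>

lemma pfun_deriv:
  assumes Q: "\<And>f g. Q f \<Longrightarrow> Q g \<Longrightarrow> Q (\<lambda>t. f t + g t)" "\<And>f g. Q f \<Longrightarrow> Q g \<Longrightarrow> Q (\<lambda>t. f t * g t)"
    and S: "\<And>c. c \<in> S \<Longrightarrow> Q c"
  shows "(\<And>k. k < r \<Longrightarrow> Q (y k) \<and> Q (y' k) \<and> eventually (\<lambda>t. (y k has_real_derivative y' k t) (at t)) at_top) \<Longrightarrow>
    p \<in> pfun S r \<Longrightarrow> Q (\<lambda>t. p t (\<lambda>k. y k t)) \<and>
    (\<exists>e. Q e \<and> eventually (\<lambda>t. ((\<lambda>t. p t (\<lambda>k. y k t)) has_real_derivative e t) (at t)) at_top)"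
proof (induction r arbitrary: p)
  case 0
  then obtain c where "p = (\<lambda>t x. c t)" "c \<in> S" by (auto simp: pfun_0)
  then show ?case using S der eDERIV by (auto intro!: exI[of _ "deriv c"])
next
  case (Suc r)
  let ?D = "\<lambda>f. Q f \<and> (\<exists>e. Q e \<and> eventually (\<lambda>t. (f has_real_derivative e t) (at t)) at_top)"
  have Dadd: "?D (\<lambda>t. f t + g t)" if "?D f" "?D g" for f g
  proof -
    obtain a b where "Q a" "eventually (\<lambda>t. (f has_real_derivative a t) (at t)) at_top"
       "Q b" "eventually (\<lambda>t. (g has_real_derivative b t) (at t)) at_top" using \<open>?D f\<close> \<open>?D g\<close> by blast
    then have "Q (\<lambda>t. a t + b t)" "eventually (\<lambda>t. ((\<lambda>t. f t + g t) has_real_derivative a t + b t) (at t)) at_top"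
      using Q by (auto elim: eventually_elim2 intro: DERIV_add)
    then show ?thesis using that Q by blast
  qed
  have Dmult: "?D (\<lambda>t. f t * g t)" if "?D f" "?D g" for f g
  proof -
    obtain a b where "Q a" "eventually (\<lambda>t. (f has_real_derivative a t) (at t)) at_top"
       "Q b" "eventually (\<lambda>t. (g has_real_derivative b t) (at t)) at_top" using \<open>?D f\<close> \<open>?D g\<close> by blast
    then have "Q (\<lambda>t. a t * g t + b t * f t)" "eventually (\<lambda>t. ((\<lambda>t. f t * g t) has_real_derivative a t * g t + b t * f t) (at t)) at_top"
      using Q that by (auto elim: eventually_elim2 intro: DERIV_mult)
    then show ?thesis using that Q by blast
  qed
  obtain d a where p: "p = (\<lambda>t x. \<Sum>i\<le>d. a i t x * x r ^ i)" "\<And>i. i \<le> d \<Longrightarrow> a i \<in> pfun S r"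
    using pfun_SucE[OF Suc.prems(2)] by blast
  have Dc: "?D (\<lambda>_. 1)" using S one der[OF one] eDERIV[OF one] by blast
  have Dy: "?D (y r)" using Suc.prems(1)[of r] by blast
  have Dpow: "?D (\<lambda>t. y r t ^ i)" for i
    by (induction i) (use Dc Dmult[OF Dy] in simp_all)
  have Da: "?D (\<lambda>t. a i t (\<lambda>k. y k t))" if "i \<le> d" for i
    by (rule Suc.IH[OF _ p(2)[OF that]]) (use Suc.prems(1) in auto)
  have "?D (\<lambda>t. \<Sum>i\<le>m. a i t (\<lambda>k. y k t) * y r t ^ i)" if "m \<le> d" for m
    using that
  proof (induction m)
    case 0
    then show ?case using Dmult[OF Da[of 0] Dpow[of 0]] by simp
  next
    case (Suc m)
    then show ?case using Dadd[OF _ Dmult[OF Da[of "Suc m"] Dpow[of "Suc m"]]] by simp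
  qed
  from this[of d] show ?case unfolding p(1) by simp
qed

end

thm_deps hfun.pfun_deriv

section \<open>Extensions of maximal Hardy fields\<close>

text \<open>The flag lets one argument serve both kinds of maximal Hardy field.\<close>

definition regular_on :: "bool \<Rightarrow> (real \<Rightarrow> real) \<Rightarrow> real set \<Rightarrow> bool" where
  "regular_on an f U = (if an then real_analytic_on f U else smooth_on f U)"

lemma regular_on_imp_smooth: "regular_on an f U \<Longrightarrow> smooth_on f U"
  by (auto simp: regular_on_def real_analytic_on_imp_smooth split: if_splits)

lemma real_analytic_on_imp_regular: "real_analytic_on f U \<Longrightarrow> regular_on an f U"
  by (auto simp: regular_on_def real_analytic_on_imp_smooth)

lemma regular_on_subset: "regular_on an f U \<Longrightarrow> V \<subseteq> U \<Longrightarrow> regular_on an f V"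
  by (auto simp: regular_on_def smooth_on_def intro: real_analytic_on_subset kdiff_mono split: if_splits)

lemma regular_on_cong: "open U \<Longrightarrow> (\<And>x. x \<in> U \<Longrightarrow> f x = g x) \<Longrightarrow> regular_on an f U \<Longrightarrow> regular_on an g U"
  using real_analytic_on_cong[of U f g] kdiff_cong[of U f g]
  by (auto simp: regular_on_def smooth_on_def split: if_splits)

lemma regular_on_add: "open U \<Longrightarrow> regular_on an f U \<Longrightarrow> regular_on an g U \<Longrightarrow> regular_on an (\<lambda>x. f x + g x) U"
  by (auto simp: regular_on_def smooth_on_def intro: real_analytic_on_add kdiff_add split: if_splits)

lemma regular_on_mult: "open U \<Longrightarrow> regular_on an f U \<Longrightarrow> regular_on an g U \<Longrightarrow> regular_on an (\<lambda>x. f x * g x) U"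
  by (auto simp: regular_on_def smooth_on_def intro: real_analytic_on_mult kdiff_mult split: if_splits)

lemma regular_on_system:
  assumes "open U" "finite Y"
    and "\<And>y. y \<in> Y \<Longrightarrow> \<exists>e\<in>rgen ({c. regular_on an c U} \<union> Y). \<forall>t\<in>U. (y has_real_derivative e t) (at t)"
    and "y \<in> Y"
  shows "regular_on an y U"
  using assms polynomial_system_analytic[of U Y y] polynomial_system_smooth[of U Y y]
  by (cases an) (simp_all add: regular_on_def)

lemma rgen_regular:
  assumes "open U" "\<And>b. b \<in> B \<Longrightarrow> regular_on an b U"
  shows "h \<in> rgen B \<Longrightarrow> regular_on an h U"
  by (induction rule: rgen.induct) (auto intro: assms regular_on_add regular_on_mult)

text \<open>The reciprocal y solves y' = - f' y^2, a polynomial equation with smooth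
  coefficients.\<close>

lemma smooth_on_inverse:
  assumes "open U" "smooth_on f U" "\<And>x. x \<in> U \<Longrightarrow> f x \<noteq> 0"
  shows "smooth_on (\<lambda>x. inverse (f x)) U"
proof (rule polynomial_system_smooth[OF assms(1), of "{\<lambda>x. inverse (f x)}"])
  fix y assume "y \<in> {\<lambda>x. inverse (f x)}"
  then have y: "y = (\<lambda>x. inverse (f x))" by simp
  have f: "kdiff (Suc n) f U" for n using assms(2) by (simp add: smooth_on_def)
  then have "smooth_on (deriv f) U" by (simp add: smooth_on_def kdiff_Suc)
  \<comment> \<open>The constant -1 is supplied as a base function, since \<open>rgen\<close> offers
    only sums and products.\<close>
  then have "(\<lambda>x. deriv f x * ((\<lambda>x. -1) x * (y x * y x))) \<in> rgen ({c. smooth_on c U} \<union> {\<lambda>x. inverse (f x)})"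
    unfolding y by (intro rgen.mult rgen.base[of "deriv f"] rgen.base[of "\<lambda>x. -1"] rgen.base[of "\<lambda>x. inverse (f x)"])
      (auto simp: smooth_on_def)
  moreover have "(y has_real_derivative deriv f x * (-1 * (y x * y x))) (at x)" if "x \<in> U" for x
    unfolding y using kdiff_deriv[OF f[of 0] that] assms(3)[OF that]
    by (auto intro!: derivative_eq_intros simp: field_simps power2_eq_square)
  ultimately show "\<exists>e\<in>rgen ({c. smooth_on c U} \<union> {\<lambda>x. inverse (f x)}). \<forall>t\<in>U. (y has_real_derivative e t) (at t)"
    by (intro bexI) auto
qed simp

lemma regular_on_inverse:
  "open U \<Longrightarrow> regular_on an f U \<Longrightarrow> (\<And>x. x \<in> U \<Longrightarrow> f x \<noteq> 0) \<Longrightarrow> regular_on an (\<lambda>x. inverse (f x)) U"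
  using real_analytic_on_inverse[of f U] smooth_on_inverse[of U f]
  by (auto simp: regular_on_def split: if_splits)

definition regular :: "bool \<Rightarrow> (real \<Rightarrow> real) \<Rightarrow> bool" where
  "regular an f \<longleftrightarrow> (\<exists>a. regular_on an f {a<..})"

lemma regular_cong:
  assumes "regular an f" "eventually (\<lambda>t. f t = g t) at_top"
  shows "regular an g"
proof -
  obtain a b where a: "regular_on an f {a<..}" "\<And>t. t \<ge> b \<Longrightarrow> f t = g t"
    using assms by (auto simp: regular_def eventually_at_top_linorder)
  have "regular_on an f {max a b<..}" using a(1) by (rule regular_on_subset) auto
  then have "regular_on an g {max a b<..}" using a(2) by (intro regular_on_cong[of _ f g]) auto
  then show ?thesis unfolding regular_def by blast
qed

lemma regular_mult:
  assumes "regular an f" "regular an g"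
  shows "regular an (\<lambda>t. f t * g t)"
proof -
  obtain a b where "regular_on an f {a<..}" "regular_on an g {b<..}" using assms by (auto simp: regular_def)
  then have "regular_on an f {max a b<..}" "regular_on an g {max a b<..}"
    by (auto elim!: regular_on_subset)
  then show ?thesis unfolding regular_def by (intro exI[of _ "max a b"] regular_on_mult) auto
qed

lemma regular_inverse:
  assumes "regular an f" "eventually (\<lambda>t. f t \<noteq> 0) at_top"
  shows "regular an (\<lambda>t. inverse (f t))"
proof -
  obtain a b where a: "regular_on an f {a<..}" "\<And>t. t \<ge> b \<Longrightarrow> f t \<noteq> 0"
    using assms by (auto simp: regular_def eventually_at_top_linorder)
  have "regular_on an f {max a b<..}" using a(1) by (rule regular_on_subset) auto
  then show ?thesis unfolding regular_def using a(2)
    by (intro exI[of _ "max a b"] regular_on_inverse) auto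
qed

lemma eventually_nhds_at_top:
  fixes P :: "real \<Rightarrow> bool"
  assumes "eventually P at_top"
  shows "eventually (\<lambda>t. eventually P (nhds t)) at_top"
proof -
  obtain a where a: "\<And>t. t \<ge> a \<Longrightarrow> P t" using assms by (auto simp: eventually_at_top_linorder)
  show ?thesis using eventually_gt_at_top[of a]
  proof eventually_elim
    case (elim t)
    show ?case using eventually_nhds_in_open[of "{a<..}" t] elim by (auto elim!: eventually_mono intro: a)
  qed
qed

lemma has_real_derivative_cong_ev:
  assumes "eventually (\<lambda>s. f s = g s) (nhds t)"
  shows "(f has_real_derivative D) (at t) \<longleftrightarrow> (g has_real_derivative D) (at t)"
  using DERIV_cong_ev[OF refl assms refl] .

section \<open>Fraction fields of rings of functions\<close>

definition fracs :: "(real \<Rightarrow> real) set \<Rightarrow> (real \<Rightarrow> real) set" where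
  "fracs A = {f. \<exists>a\<in>A. \<exists>b\<in>A. eventually (\<lambda>t. b t \<noteq> 0 \<and> f t = a t / b t) at_top}"

locale fun_ring =
  fixes A :: "(real \<Rightarrow> real) set"
  assumes r_one: "(\<lambda>_. 1) \<in> A"
    and r_diff: "f \<in> A \<Longrightarrow> g \<in> A \<Longrightarrow> (\<lambda>t. f t - g t) \<in> A"
    and r_mult: "f \<in> A \<Longrightarrow> g \<in> A \<Longrightarrow> (\<lambda>t. f t * g t) \<in> A"
    and r_zero_or: "f \<in> A \<Longrightarrow> eventually (\<lambda>t. f t = 0) at_top \<or> eventually (\<lambda>t. f t \<noteq> 0) at_top"
begin

lemma r_zero: "(\<lambda>_. 0) \<in> A"
  using r_diff[OF r_one r_one] by simp

lemma fracs_base: "a \<in> A \<Longrightarrow> a \<in> fracs A"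
  unfolding fracs_def using r_one by (intro CollectI bexI[of _ a] bexI[of _ "\<lambda>_. 1"]) auto

lemma fracs_diff: assumes "f \<in> fracs A" "g \<in> fracs A" shows "(\<lambda>t. f t - g t) \<in> fracs A"
proof -
  obtain a b c d where "a \<in> A" "b \<in> A" "c \<in> A" "d \<in> A" and
    ev: "eventually (\<lambda>t. b t \<noteq> 0 \<and> f t = a t / b t) at_top" "eventually (\<lambda>t. d t \<noteq> 0 \<and> g t = c t / d t) at_top"
    using assms unfolding fracs_def by blast
  moreover have "eventually (\<lambda>t. b t * d t \<noteq> 0 \<and> f t - g t = (a t * d t - c t * b t) / (b t * d t)) at_top"
    using ev by eventually_elim (simp add: field_simps)
  ultimately show ?thesis unfolding fracs_def
    by (intro CollectI bexI[of _ "\<lambda>t. a t * d t - c t * b t"] bexI[of _ "\<lambda>t. b t * d t"] r_diff r_mult)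
qed

lemma fracs_mult: assumes "f \<in> fracs A" "g \<in> fracs A" shows "(\<lambda>t. f t * g t) \<in> fracs A"
proof -
  obtain a b c d where "a \<in> A" "b \<in> A" "c \<in> A" "d \<in> A" and
    ev: "eventually (\<lambda>t. b t \<noteq> 0 \<and> f t = a t / b t) at_top" "eventually (\<lambda>t. d t \<noteq> 0 \<and> g t = c t / d t) at_top"
    using assms unfolding fracs_def by blast
  moreover have "eventually (\<lambda>t. b t * d t \<noteq> 0 \<and> f t * g t = (a t * c t) / (b t * d t)) at_top"
    using ev by eventually_elim simp
  ultimately show ?thesis unfolding fracs_def
    by (intro CollectI bexI[of _ "\<lambda>t. a t * c t"] bexI[of _ "\<lambda>t. b t * d t"] r_mult)
qed

lemma fracs_add: assumes "f \<in> fracs A" "g \<in> fracs A" shows "(\<lambda>t. f t + g t) \<in> fracs A"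
  using fracs_diff[OF assms(1) fracs_diff[OF fracs_base[OF r_zero] assms(2)]] by simp

lemma fracs_cong: "f \<in> fracs A \<Longrightarrow> eventually (\<lambda>t. f t = g t) at_top \<Longrightarrow> g \<in> fracs A"
proof -
  assume "f \<in> fracs A" and fg: "eventually (\<lambda>t. f t = g t) at_top"
  then obtain a b where ab: "a \<in> A" "b \<in> A" and ev: "eventually (\<lambda>t. b t \<noteq> 0 \<and> f t = a t / b t) at_top"
    unfolding fracs_def by blast
  have "eventually (\<lambda>t. b t \<noteq> 0 \<and> g t = a t / b t) at_top"
    using ev fg by eventually_elim simp
  with ab show ?thesis unfolding fracs_def by blast
qed

lemma fracs_zero_or: "f \<in> fracs A \<Longrightarrow> eventually (\<lambda>t. f t = 0) at_top \<or> eventually (\<lambda>t. f t \<noteq> 0) at_top"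
proof -
  assume "f \<in> fracs A"
  then obtain a b where "a \<in> A" and ev: "eventually (\<lambda>t. b t \<noteq> 0 \<and> f t = a t / b t) at_top"
    unfolding fracs_def by blast
  from r_zero_or[OF \<open>a \<in> A\<close>] show ?thesis
  proof
    assume "eventually (\<lambda>t. a t = 0) at_top"
    with ev have "eventually (\<lambda>t. f t = 0) at_top" by eventually_elim simp
    then show ?thesis ..
  next
    assume "eventually (\<lambda>t. a t \<noteq> 0) at_top"
    with ev have "eventually (\<lambda>t. f t \<noteq> 0) at_top" by eventually_elim simp
    then show ?thesis ..
  qed
qed

lemma fracs_inverse: assumes "f \<in> fracs A" shows "(\<lambda>t. inverse (f t)) \<in> fracs A"
proof -
  obtain a b where ab: "a \<in> A" "b \<in> A" and ev: "eventually (\<lambda>t. b t \<noteq> 0 \<and> f t = a t / b t) at_top"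
    using assms unfolding fracs_def by blast
  from r_zero_or[OF \<open>a \<in> A\<close>] show ?thesis
  proof
    assume "eventually (\<lambda>t. a t = 0) at_top"
    with ev have "eventually (\<lambda>t. 0 = inverse (f t)) at_top" by eventually_elim simp
    then show ?thesis by (rule fracs_cong[OF fracs_base[OF r_zero]])
  next
    assume "eventually (\<lambda>t. a t \<noteq> 0) at_top"
    with ev have "eventually (\<lambda>t. a t \<noteq> 0 \<and> inverse (f t) = b t / a t) at_top" by eventually_elim simp
    with ab show ?thesis unfolding fracs_def by blast
  qed
qed

text \<open>Derivatives of elements of A are only asked to be fractions, because adjoining an
  algebraic y produces a derivative with the separant in the denominator. The quotient rule does the
  rest.\<close>

lemma hfun_fracs:
  assumes "\<And>a. a \<in> A \<Longrightarrow> \<exists>e\<in>fracs A. eventually (\<lambda>t. (a has_real_derivative e t) (at t)) at_top"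
  shows "hfun (fracs A)"
proof -
  have D: "\<exists>e\<in>fracs A. eventually (\<lambda>t. (f has_real_derivative e t) (at t)) at_top" if f: "f \<in> fracs A" for f
  proof -
    obtain a b where ab: "a \<in> A" "b \<in> A" and ev: "eventually (\<lambda>t. b t \<noteq> 0 \<and> f t = a t / b t) at_top"
      using f unfolding fracs_def by blast
    obtain a' b' where a': "a' \<in> fracs A" "b' \<in> fracs A"
      and d: "eventually (\<lambda>t. (a has_real_derivative a' t) (at t)) at_top"
        "eventually (\<lambda>t. (b has_real_derivative b' t) (at t)) at_top"
      using assms ab by meson
    have "eventually (\<lambda>t. (f has_real_derivative (a' t * b t - a t * b' t) * inverse (b t * b t)) (at t)) at_top"
      using d ev eventually_nhds_at_top[OF ev]
    proof eventually_elim
      case (elim t)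
      have "((\<lambda>t. a t / b t) has_real_derivative (a' t * b t - a t * b' t) * inverse (b t * b t)) (at t)"
        using DERIV_divide[OF elim(1,2)] elim(3) by (simp add: divide_inverse)
      moreover have "eventually (\<lambda>s. f s = a s / b s) (nhds t)" using elim(4) by eventually_elim simp
      then have "(f has_real_derivative D) (at t) \<longleftrightarrow> ((\<lambda>t. a t / b t) has_real_derivative D) (at t)" for D
        by (rule has_real_derivative_cong_ev)
      ultimately show ?case by simp
    qed
    moreover have "(\<lambda>t. (a' t * b t - a t * b' t) * inverse (b t * b t)) \<in> fracs A"
      by (intro fracs_mult fracs_diff fracs_inverse fracs_base ab a')
    ultimately show ?thesis by (intro bexI[of _ "\<lambda>t. (a' t * b t - a t * b' t) * inverse (b t * b t)"])
  qed
  show ?thesis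
  proof
    fix f assume f: "f \<in> fracs A"
    then obtain e where e: "e \<in> fracs A" and ev: "eventually (\<lambda>t. (f has_real_derivative e t) (at t)) at_top"
      using D by blast
    show "deriv f \<in> fracs A"
      by (rule fracs_cong[OF e]) (use ev in \<open>auto elim!: eventually_mono simp: DERIV_imp_deriv\<close>)
    show "eventually (\<lambda>t. f field_differentiable (at t)) at_top"
      using ev by (auto elim!: eventually_mono simp: field_differentiable_def)
  qed (auto intro: fracs_cong fracs_base[OF r_one] fracs_diff fracs_mult fracs_inverse dest: fracs_zero_or)
qed

end

locale max_hfun = hfun +
  fixes an :: bool
  assumes regular: "f \<in> S \<Longrightarrow> regular an f"
    and maximal: "hfun S' \<Longrightarrow> (\<And>f. f \<in> S' \<Longrightarrow> regular an f) \<Longrightarrow> S \<subseteq> S' \<Longrightarrow> S' \<subseteq> S"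
begin

text \<open>The fraction field of A is a Hardy field of the same regularity above S, so maximality
  absorbs it.\<close>

lemma extension_trivial:
  assumes "fun_ring A" "S \<subseteq> A" "\<And>a. a \<in> A \<Longrightarrow> regular an a"
    "\<And>a. a \<in> A \<Longrightarrow> \<exists>e\<in>fracs A. eventually (\<lambda>t. (a has_real_derivative e t) (at t)) at_top"
  shows "A \<subseteq> S"
proof -
  interpret A: fun_ring A by fact
  have "fracs A \<subseteq> S"
  proof (rule maximal[OF A.hfun_fracs[OF assms(4)]])
    show "S \<subseteq> fracs A" using assms(2) A.fracs_base by blast
    fix f assume "f \<in> fracs A"
    then obtain a b where ab: "a \<in> A" "b \<in> A" and ev: "eventually (\<lambda>t. b t \<noteq> 0 \<and> f t = a t / b t) at_top"
      unfolding fracs_def by blast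
    have "regular an (\<lambda>t. a t * inverse (b t))"
      by (intro regular_mult regular_inverse assms ab) (use ev in \<open>auto elim: eventually_mono\<close>)
    then show "regular an f"
      by (rule regular_cong) (use ev in \<open>auto elim!: eventually_mono simp: divide_inverse\<close>)
  qed auto
  then show ?thesis using A.fracs_base by blast
qed

end

section \<open>Adjoining algebraic and transcendental elements\<close>

definition evals :: "(real \<Rightarrow> real) set \<Rightarrow> (nat \<Rightarrow> real \<Rightarrow> real) \<Rightarrow> nat \<Rightarrow> (real \<Rightarrow> real) set" where
  "evals S y r = (\<lambda>p t. p t (\<lambda>k. y k t)) ` pfun S r"

context hfun
begin

lemma evals_memI: "p \<in> pfun S r \<Longrightarrow> (\<lambda>t. p t (\<lambda>k. y k t)) \<in> evals S y r"
  unfolding evals_def by (rule imageI)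

lemma evals_memE:
  assumes "f \<in> evals S y r"
  obtains p where "f = (\<lambda>t. p t (\<lambda>k. y k t))" "p \<in> pfun S r"
  using assms unfolding evals_def by blast

lemma evals_diff: "f \<in> evals S y r \<Longrightarrow> g \<in> evals S y r \<Longrightarrow> (\<lambda>t. f t - g t) \<in> evals S y r"
  by (elim evals_memE) (auto dest: evals_memI[OF pfun_diff])

lemma evals_mult: "f \<in> evals S y r \<Longrightarrow> g \<in> evals S y r \<Longrightarrow> (\<lambda>t. f t * g t) \<in> evals S y r"
  by (elim evals_memE) (auto dest: evals_memI[OF pfun_mult])

lemma evals_const: "c \<in> S \<Longrightarrow> c \<in> evals S y r"
  using evals_memI[OF pfun_const] .

lemma evals_var: "k < r \<Longrightarrow> y k \<in> evals S y r"
  using evals_memI[OF pfun_var] .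

lemma evals_mono: "r \<le> r' \<Longrightarrow> evals S y r \<subseteq> evals S y r'"
  unfolding evals_def by (intro image_mono pfun_mono)

lemmas evals_ring = evals_const[OF one] evals_diff evals_mult evals_const evals_var

end

text \<open>Implicit differentiation of a merely continuous y. Caratheodory's form of the derivative
  for the a i and the factorisation of y(s)^i - y(t)^i give 0 = (s - t) G(s) + (y(s) - y(t)) K(s)
  with G and K continuous at t, and K(t) is the separant, so the difference quotient converges to -
  G(t)/K(t).\<close>

lemma implicit_derivative:
  fixes y :: "real \<Rightarrow> real"
  assumes a: "\<And>i. i \<le> d \<Longrightarrow> (a i has_real_derivative e i) (at t)" and y: "isCont y t"
    and zero: "eventually (\<lambda>s. (\<Sum>i\<le>d. a i s * y s ^ i) = 0) (nhds t)"
    and V: "(\<Sum>i\<le>d. real i * a i t * y t ^ (i - 1)) \<noteq> 0"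
  shows "(y has_real_derivative - (\<Sum>i\<le>d. e i * y t ^ i) * inverse (\<Sum>i\<le>d. real i * a i t * y t ^ (i - 1))) (at t)"
proof -
  have "\<exists>g. (\<forall>s. a i s - a i t = g s * (s - t)) \<and> isCont g t \<and> g t = e i" if "i \<le> d" for i
    using a[OF that] unfolding CARAT_DERIV by blast
  then obtain g where g: "\<And>i s. i \<le> d \<Longrightarrow> a i s - a i t = g i s * (s - t)" "\<And>i. i \<le> d \<Longrightarrow> isCont (g i) t"
    "\<And>i. i \<le> d \<Longrightarrow> g i t = e i" by metis
  define G where "G = (\<lambda>s. \<Sum>i\<le>d. g i s * y s ^ i)"
  \<comment> \<open>The difference quotient of the polynomial in the variable y, with coefficients
    frozen at t.\<close>
  define K where "K = (\<lambda>s. \<Sum>i\<le>d. a i t * (\<Sum>j<i. y s ^ j * y t ^ (i - 1 - j)))"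
  have Gc: "isCont G t" unfolding G_def using g(2) y by (intro continuous_intros) auto
  have Kc: "isCont K t" unfolding K_def using y by (intro continuous_intros) auto
  have Kt: "K t = (\<Sum>i\<le>d. real i * a i t * y t ^ (i - 1))"
    unfolding K_def
  proof (intro sum.cong refl)
    fix i
    have "(\<Sum>j<i. y t ^ j * y t ^ (i - 1 - j)) = (\<Sum>j<i. y t ^ (i - 1))"
      by (intro sum.cong) (auto simp flip: power_add)
    then show "a i t * (\<Sum>j<i. y t ^ j * y t ^ (i - 1 - j)) = real i * a i t * y t ^ (i - 1)" by simp
  qed
  have Gt: "G t = (\<Sum>i\<le>d. e i * y t ^ i)" using g(3) by (auto simp: G_def intro: sum.cong)
  have zt: "(\<Sum>i\<le>d. a i t * y t ^ i) = 0" using zero by (rule eventually_nhds_x_imp_x)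
  have key: "(\<Sum>i\<le>d. a i s * y s ^ i) - (\<Sum>i\<le>d. a i t * y t ^ i) = (s - t) * G s + (y s - y t) * K s" for s
  proof -
    have "(\<Sum>i\<le>d. a i s * y s ^ i) - (\<Sum>i\<le>d. a i t * y t ^ i) = (\<Sum>i\<le>d. (s - t) * (g i s * y s ^ i) +
      (y s - y t) * (a i t * (\<Sum>j<i. y s ^ j * y t ^ (i - 1 - j))))"
    unfolding sum_subtractf[symmetric]
  proof (intro sum.cong refl)
    fix i assume "i \<in> {..d}"
    then have 1: "a i s - a i t = g i s * (s - t)" using g(1)[of i s] by simp
    have 2: "y s ^ i - y t ^ i = (y s - y t) * (\<Sum>j<i. y s ^ j * y t ^ (i - 1 - j))"
      by (subst power_diff_sumr2) (simp add: mult.commute)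
    have "a i s * y s ^ i - a i t * y t ^ i = (a i s - a i t) * y s ^ i + a i t * (y s ^ i - y t ^ i)"
      by (simp add: algebra_simps)
    then show "a i s * y s ^ i - a i t * y t ^ i =
        (s - t) * (g i s * y s ^ i) + (y s - y t) * (a i t * (\<Sum>j<i. y s ^ j * y t ^ (i - 1 - j)))"
      unfolding 1 2 by (simp only: mult_ac)
  qed
    also have "\<dots> = (s - t) * G s + (y s - y t) * K s"
      unfolding G_def K_def by (simp only: sum.distrib sum_distrib_left)
    finally show ?thesis .
  qed
  have Kne: "eventually (\<lambda>s. K s \<noteq> 0) (at t)"
    using tendsto_imp_eventually_ne[OF Kc[unfolded isCont_def], of 0] V by (simp add: Kt)
  have zero_at: "eventually (\<lambda>s. (\<Sum>i\<le>d. a i s * y s ^ i) = 0) (at t)"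
    using zero by (simp add: eventually_nhds_conv_at)
  have ev: "eventually (\<lambda>s. (y s - y t) / (s - t) = - G s / K s) (at t)"
    using Kne zero_at eventually_neq_at_within[of t t UNIV]
  proof eventually_elim
    case (elim s)
    have "(s - t) * G s + (y s - y t) * K s = 0" using key[of s] elim zt by simp
    then show ?case using elim by (simp add: field_simps)
  qed
  have "((\<lambda>s. - G s / K s) \<longlongrightarrow> - G t / K t) (at t)"
    using Gc Kc V unfolding Kt[symmetric] isCont_def by (intro tendsto_intros)
  then have "((\<lambda>s. (y s - y t) / (s - t)) \<longlongrightarrow> - G t / K t) (at t)"
    using tendsto_cong[OF ev] by simp
  then show ?thesis by (simp add: has_field_derivative_iff Gt Kt divide_inverse)
qed

lemma eventually_all_le:
  "(\<And>i. i \<le> (d::nat) \<Longrightarrow> eventually (P i) F) \<Longrightarrow> eventually (\<lambda>t. \<forall>i\<le>d. P i t) F"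
  using eventually_ball_finite[of "{..d}" "\<lambda>t i. P i t" F] by (simp add: Ball_def)

context max_hfun
begin

text \<open>The ring is S[y 0, ..., y r]. Its elements are tested for zero by pseudo-division, which
  leads back to degree at most d, where \<open>nz\<close> applies. The derivative of y r, so far
  only continuous, comes from implicit differentiation; regularity comes from a polynomial system
  satisfied by the y k together with the reciprocal of the separant.\<close>

lemma algebraic_extension:
  assumes yd: "\<And>k. k < r \<Longrightarrow> eventually (\<lambda>t. (y k has_real_derivative y (Suc k) t) (at t)) at_top"
    and yc: "eventually (\<lambda>t. isCont (y r) t) at_top"
    and p: "\<And>i. i \<le> Suc d \<Longrightarrow> p i \<in> pfun S r"
    and zero: "eventually (\<lambda>t. (\<Sum>i\<le>Suc d. p i t (\<lambda>k. y k t) * y r t ^ i) = 0) at_top"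
    and sep: "eventually (\<lambda>t. (\<Sum>i\<le>Suc d. real i * p i t (\<lambda>k. y k t) * y r t ^ (i - 1)) \<noteq> 0) at_top"
    and lead: "eventually (\<lambda>t. p (Suc d) t (\<lambda>k. y k t) \<noteq> 0) at_top"
    and nz: "\<And>c. (\<And>i. i \<le> d \<Longrightarrow> c i \<in> pfun S r) \<Longrightarrow>
      eventually (\<lambda>t. (\<Sum>i\<le>d. c i t (\<lambda>k. y k t) * y r t ^ i) = 0) at_top \<or>
      eventually (\<lambda>t. (\<Sum>i\<le>d. c i t (\<lambda>k. y k t) * y r t ^ i) \<noteq> 0) at_top"
  shows "k \<le> r \<Longrightarrow> y k \<in> S"
proof -
  define A where "A = evals S y (Suc r)"
  define V where "V = (\<lambda>t. \<Sum>i\<le>Suc d. real i * p i t (\<lambda>k. y k t) * y r t ^ (i - 1))"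
  define v where "v = (\<lambda>t. inverse (V t))"
  have VA: "V \<in> A"
  proof -
    have "(\<lambda>t x. \<Sum>i\<le>d. real (Suc i) * p (Suc i) t x * x r ^ i) \<in> pfun S (Suc r)"
      by (intro pfun_SucI pfun_mult pfun_const of_nat p) auto
    moreover have "V = (\<lambda>t. \<Sum>i\<le>d. real (Suc i) * p (Suc i) t (\<lambda>k. y k t) * y r t ^ i)"
      unfolding V_def by (subst sum.atMost_Suc_shift) simp
    ultimately show ?thesis unfolding A_def evals_def by (auto intro!: rev_image_eqI)
  qed
  interpret A: fun_ring A
  proof
    fix f assume "f \<in> A"
    then obtain q where f: "f = (\<lambda>t. q t (\<lambda>k. y k t))" and q: "q \<in> pfun S (Suc r)"
      by (auto simp: A_def evals_def)
    obtain m c where c: "\<And>i. i \<le> d \<Longrightarrow> c i \<in> pfun S r"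
      and red: "\<And>t x. (\<Sum>i\<le>Suc d. p i t x * x r ^ i) = 0 \<Longrightarrow> p (Suc d) t x ^ m * q t x = (\<Sum>i\<le>d. c i t x * x r ^ i)"
      by (rule pfun_pseudo_division[OF p q]) (assumption, rule that)
    \<comment> \<open>Near infinity the divisor vanishes and its leading coefficient does not, so f
      and the remainder have the same zeros.\<close>
    have ev: "eventually (\<lambda>t. (f t = 0) = ((\<Sum>i\<le>d. c i t (\<lambda>k. y k t) * y r t ^ i) = 0)) at_top"
      using zero lead
    proof eventually_elim
      case (elim t)
      show ?case using red[of t "\<lambda>k. y k t"] elim by (auto simp: f)
    qed
    from nz[OF c] show "eventually (\<lambda>t. f t = 0) at_top \<or> eventually (\<lambda>t. f t \<noteq> 0) at_top"
    proof
      assume "eventually (\<lambda>t. (\<Sum>i\<le>d. c i t (\<lambda>k. y k t) * y r t ^ i) = 0) at_top"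
      with ev have "eventually (\<lambda>t. f t = 0) at_top" by eventually_elim simp
      then show ?thesis ..
    next
      assume "eventually (\<lambda>t. (\<Sum>i\<le>d. c i t (\<lambda>k. y k t) * y r t ^ i) \<noteq> 0) at_top"
      with ev have "eventually (\<lambda>t. f t \<noteq> 0) at_top" by eventually_elim simp
      then show ?thesis ..
    qed
  qed (auto simp: A_def intro: evals_ring)
  have SA: "S \<subseteq> A" by (auto simp: A_def intro: evals_ring)
  have yA: "y k \<in> A" if "k \<le> r" for k using that by (auto simp: A_def intro: evals_ring)

  \<comment> \<open>Q will stand once for being a fraction of A and once for being generated by Y
    over the regular functions on a tail.\<close>
  have step1: "\<exists>e. (\<forall>i\<le>Suc d. Q (e i) \<and> eventually (\<lambda>t. ((\<lambda>t. p i t (\<lambda>k. y k t)) has_real_derivative e i t) (at t)) at_top)"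
    if Q: "\<And>f g. Q f \<Longrightarrow> Q g \<Longrightarrow> Q (\<lambda>t. f t + g t)" "\<And>f g. Q f \<Longrightarrow> Q g \<Longrightarrow> Q (\<lambda>t. f t * g t)"
      "\<And>c. c \<in> S \<Longrightarrow> Q c" "\<And>k. k \<le> r \<Longrightarrow> Q (y k)" for Q
  proof -
    have "\<exists>e. Q e \<and> eventually (\<lambda>t. ((\<lambda>t. p i t (\<lambda>k. y k t)) has_real_derivative e t) (at t)) at_top" if "i \<le> Suc d" for i
      using pfun_deriv[where Q = Q and r = r and y = y and y' = "\<lambda>k. y (Suc k)" and p = "p i"] Q yd p[OF that] by auto
    then show ?thesis by metis
  qed
  have step2: "eventually (\<lambda>t. (y r has_real_derivative - (\<Sum>i\<le>Suc d. e i t * y r t ^ i) * v t) (at t)) at_top"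
    if e: "\<forall>i\<le>Suc d. eventually (\<lambda>t. ((\<lambda>t. p i t (\<lambda>k. y k t)) has_real_derivative e i t) (at t)) at_top" for e
  proof -
    have "eventually (\<lambda>t. \<forall>i\<le>Suc d. ((\<lambda>t. p i t (\<lambda>k. y k t)) has_real_derivative e i t) (at t)) at_top"
      by (rule eventually_all_le) (use e in auto)
    then show ?thesis using yc eventually_nhds_at_top[OF zero] sep
  proof eventually_elim
    case (elim t)
    then show ?case unfolding v_def V_def by (intro implicit_derivative) auto
  qed
  qed
  have step3: "\<exists>yr. Q yr \<and> eventually (\<lambda>t. (y r has_real_derivative yr t) (at t)) at_top"
    if Q: "\<And>f g. Q f \<Longrightarrow> Q g \<Longrightarrow> Q (\<lambda>t. f t + g t)" "\<And>f g. Q f \<Longrightarrow> Q g \<Longrightarrow> Q (\<lambda>t. f t * g t)"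
      "\<And>c. c \<in> S \<Longrightarrow> Q c" "\<And>k. k \<le> r \<Longrightarrow> Q (y k)" "Q v" for Q
  proof -
    have "\<exists>e. \<forall>i\<le>Suc d. Q (e i) \<and> eventually (\<lambda>t. ((\<lambda>t. p i t (\<lambda>k. y k t)) has_real_derivative e i t) (at t)) at_top"
      by (rule step1[of Q]) (use Q in blast)+
    then obtain e where e: "\<forall>i\<le>Suc d. Q (e i) \<and> eventually (\<lambda>t. ((\<lambda>t. p i t (\<lambda>k. y k t)) has_real_derivative e i t) (at t)) at_top"
      by (elim exE)
    have pw: "Q (\<lambda>t. y r t ^ i)" for i
    proof (induction i)
      case 0
      show ?case using Q(3)[OF one] by simp
    next
      case (Suc i)
      show ?case using Q(2)[OF Q(4)[OF order_refl] Suc] by simp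
    qed
    have sm: "Q (\<lambda>t. \<Sum>i\<le>m. e i t * y r t ^ i)" if "m \<le> Suc d" for m
      using that
    proof (induction m)
      case 0
      then show ?case using Q(2)[of "e 0" "\<lambda>t. y r t ^ 0"] e pw[of 0] by simp
    next
      case (Suc m)
      then show ?case using Q(1)[OF _ Q(2)[of "e (Suc m)" "\<lambda>t. y r t ^ Suc m"]] e pw[of "Suc m"] by simp
    qed
    have "Q (\<lambda>t. (-1) * (\<Sum>i\<le>Suc d. e i t * y r t ^ i) * v t)"
      by (intro Q(2) Q(3)[OF uminus[OF one]] sm Q(5)) simp
    then show ?thesis using step2[of e] e by auto
  qed
  have step4: "\<exists>e. Q e \<and> eventually (\<lambda>t. (a has_real_derivative e t) (at t)) at_top" and step5: "Q a"
    if Q: "\<And>f g. Q f \<Longrightarrow> Q g \<Longrightarrow> Q (\<lambda>t. f t + g t)" "\<And>f g. Q f \<Longrightarrow> Q g \<Longrightarrow> Q (\<lambda>t. f t * g t)"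
      "\<And>c. c \<in> S \<Longrightarrow> Q c" "\<And>k. k \<le> r \<Longrightarrow> Q (y k)" "Q v" and a: "a \<in> A" for Q a
  proof -
    obtain q where f: "a = (\<lambda>t. q t (\<lambda>k. y k t))" and q: "q \<in> pfun S (Suc r)"
      using a by (auto simp: A_def evals_def)
    obtain yr where yr: "Q yr" "eventually (\<lambda>t. (y r has_real_derivative yr t) (at t)) at_top"
      using step3[of Q] Q by blast
    have "Q a \<and> (\<exists>e. Q e \<and> eventually (\<lambda>t. (a has_real_derivative e t) (at t)) at_top)"
      unfolding f
      by (rule pfun_deriv[where Q = Q and r = "Suc r" and y' = "\<lambda>k. if k < r then y (Suc k) else yr"])
         (use Q yd yr q in \<open>auto simp: less_Suc_eq\<close>)
    then show "\<exists>e. Q e \<and> eventually (\<lambda>t. (a has_real_derivative e t) (at t)) at_top" "Q a" by auto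
  qed
  have vF: "v \<in> fracs A" unfolding v_def using VA by (intro A.fracs_inverse A.fracs_base)
  have FD: "\<exists>e\<in>fracs A. eventually (\<lambda>t. (a has_real_derivative e t) (at t)) at_top" if "a \<in> A" for a
    using step4[of "\<lambda>f. f \<in> fracs A" a] that vF SA yA by (auto intro: A.fracs_add A.fracs_mult A.fracs_base)
  \<comment> \<open>Adjoining v makes the system polynomial: v' = - V' v^2, and V' lies in the
    generated ring.\<close>
  define Y where "Y = insert v (y ` {..r})"
  \<comment> \<open>Elements of S are regular only from some point on, so membership is asked for
    all late tails; finitely many elements of Y then share one tail.\<close>
  define R where "R = (\<lambda>f. eventually (\<lambda>T. f \<in> rgen ({c. regular_on an c {T<..}} \<union> Y)) at_top)"
  have R: "\<And>f g. R f \<Longrightarrow> R g \<Longrightarrow> R (\<lambda>t. f t + g t)" "\<And>f g. R f \<Longrightarrow> R g \<Longrightarrow> R (\<lambda>t. f t * g t)"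
    unfolding R_def by (auto elim: eventually_elim2 intro: rgen.add rgen.mult)
  have RS: "R c" if c: "c \<in> S" for c
  proof -
    obtain a where a: "regular_on an c {a<..}" using regular[OF c] by (auto simp: regular_def)
    have "c \<in> rgen ({c. regular_on an c {T<..}} \<union> Y)" if "T \<ge> a" for T
      using regular_on_subset[OF a, of "{T<..}"] that by (auto intro: rgen.base)
    then show ?thesis unfolding R_def eventually_at_top_linorder by blast
  qed
  have RY: "R z" if "z \<in> Y" for z
    using that unfolding R_def by (intro always_eventually allI rgen.base) simp
  then have Ry: "\<And>k. k \<le> r \<Longrightarrow> R (y k)" and Rv: "R v" by (auto simp: Y_def)
  have Yd: "\<exists>e. R e \<and> eventually (\<lambda>t. (z has_real_derivative e t) (at t)) at_top" if "z \<in> Y" for z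
    using that unfolding Y_def
  proof
    assume z: "z = v"
    obtain V' where V': "R V'" "eventually (\<lambda>t. (V has_real_derivative V' t) (at t)) at_top"
      using step4[OF R RS Ry Rv VA] by blast
    have "eventually (\<lambda>t. (v has_real_derivative -1 * V' t * (v t * v t)) (at t)) at_top"
      using V'(2) sep
    proof eventually_elim
      case (elim t)
      then have "V t \<noteq> 0" by (simp add: V_def)
      then show ?case unfolding v_def using elim(1)
        by (auto intro!: derivative_eq_intros simp: field_simps power2_eq_square)
    qed
    moreover have "R (\<lambda>t. -1 * V' t * (v t * v t))"
      by (intro R RS[OF uminus[OF one]] V' Rv)
    ultimately show ?thesis unfolding z by blast
  next
    assume "z \<in> y ` {..r}"
    then show ?thesis using step4[OF R RS Ry Rv] yA by blast
  qed
  then obtain E where E: "\<And>z. z \<in> Y \<Longrightarrow> R (E z)" "\<And>z. z \<in> Y \<Longrightarrow> eventually (\<lambda>t. (z has_real_derivative E z t) (at t)) at_top"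
    by metis
  have finY: "finite Y" by (simp add: Y_def)
  have ev1: "eventually (\<lambda>T. \<forall>z\<in>Y. E z \<in> rgen ({c. regular_on an c {T<..}} \<union> Y)) at_top"
    by (rule eventually_ball_finite[OF finY]) (use E(1) in \<open>auto simp: R_def\<close>)
  have ev2: "eventually (\<lambda>t. \<forall>z\<in>Y. (z has_real_derivative E z t) (at t)) at_top"
    by (rule eventually_ball_finite[OF finY]) (use E(2) in auto)
  obtain T1 where T1: "\<And>T. T \<ge> T1 \<Longrightarrow> \<forall>z\<in>Y. E z \<in> rgen ({c. regular_on an c {T<..}} \<union> Y)"
    using ev1 unfolding eventually_at_top_linorder by blast
  obtain T2 where T2: "\<And>t. t \<ge> T2 \<Longrightarrow> \<forall>z\<in>Y. (z has_real_derivative E z t) (at t)"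
    using ev2 unfolding eventually_at_top_linorder by blast
  have Yreg: "regular_on an z {T<..}" if "T \<ge> max T1 T2" "z \<in> Y" for z T
    by (rule regular_on_system[OF _ finY _ that(2)]) (use T1[of T] T2 that(1) in \<open>auto intro!: bexI[of _ "E _"]\<close>)
  have reg: "regular an a" if "a \<in> A" for a
  proof -
    have "R a" using step5[OF R RS Ry Rv that] .
    then obtain T0 where T0: "\<And>T. T \<ge> T0 \<Longrightarrow> a \<in> rgen ({c. regular_on an c {T<..}} \<union> Y)"
      unfolding R_def eventually_at_top_linorder by blast
    define T where "T = Max {T0, T1, T2}"
    have "regular_on an a {T<..}"
      by (rule rgen_regular[OF _ _ T0]) (use Yreg[of T] in \<open>auto simp: T_def\<close>)
    then show ?thesis unfolding regular_def by blast
  qed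
  have "A \<subseteq> S" by (rule extension_trivial[OF A.fun_ring_axioms SA reg FD])
  then show "k \<le> r \<Longrightarrow> y k \<in> S" using yA by blast
qed

text \<open>All derivatives of g are adjoined at once, so differentiating a polynomial in them gives
  another one. The hypothesis on zeros is the whole price for a field.\<close>

lemma transcendental_extension:
  assumes g: "regular an g"
    and nz: "\<And>r p. p \<in> pfun S r \<Longrightarrow> eventually (\<lambda>t. p t (\<lambda>k. (deriv ^^ k) g t) = 0) at_top \<or>
      eventually (\<lambda>t. p t (\<lambda>k. (deriv ^^ k) g t) \<noteq> 0) at_top"
  shows "g \<in> S"
proof -
  define y where "y = (\<lambda>k. (deriv ^^ k) g)"
  define A where "A = (\<Union>r. evals S y r)"
  obtain a where a: "regular_on an g {a<..}" using g by (auto simp: regular_def)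
  have yd: "(y k has_real_derivative y (Suc k) t) (at t)" if "t > a" for k t
    using regular_on_imp_smooth[OF a] that kdiff_deriv_funpow[of "Suc k" g "{a<..}" k t]
    by (auto simp: y_def smooth_on_def)
  have yreg: "regular_on an (y k) {a<..}" for k
  proof (cases an)
    case True
    have "real_analytic_on (y k) {a<..}"
      by (induction k) (use a True real_analytic_on_deriv in \<open>auto simp: y_def regular_on_def\<close>)
    then show ?thesis using True by (simp add: regular_on_def)
  next
    case False
    have "smooth_on (y k) {a<..}"
      by (induction k) (use a False in \<open>auto simp: y_def regular_on_def smooth_on_def kdiff_Suc\<close>, metis kdiff_Suc)
    then show ?thesis using False by (simp add: regular_on_def)
  qed
  have two: "\<exists>r. f \<in> evals S y r \<and> h \<in> evals S y r" if "f \<in> A" "h \<in> A" for f h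
  proof -
    from that obtain r s where "f \<in> evals S y r" "h \<in> evals S y s" by (auto simp: A_def)
    then show ?thesis using evals_mono[of r "max r s" y] evals_mono[of s "max r s" y] by force
  qed
  interpret A: fun_ring A
  proof
    show "(\<lambda>_. 1) \<in> A" by (auto simp: A_def intro: evals_ring)
    show "(\<lambda>t. f t - h t) \<in> A" "(\<lambda>t. f t * h t) \<in> A" if "f \<in> A" "h \<in> A" for f h
      using two[OF that] by (auto simp: A_def intro: evals_ring)
    show "eventually (\<lambda>t. f t = 0) at_top \<or> eventually (\<lambda>t. f t \<noteq> 0) at_top" if "f \<in> A" for f
      using that nz by (auto simp: A_def evals_def y_def)
  qed
  have SA: "S \<subseteq> A" by (auto simp: A_def intro: evals_ring)
  have yA: "y k \<in> A" for k using evals_var[of k "Suc k" y] by (auto simp: A_def)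
  have Qgen: "Q f \<and> (\<exists>e. Q e \<and> eventually (\<lambda>t. (f has_real_derivative e t) (at t)) at_top)"
    if Q: "\<And>f g. Q f \<Longrightarrow> Q g \<Longrightarrow> Q (\<lambda>t. f t + g t)" "\<And>f g. Q f \<Longrightarrow> Q g \<Longrightarrow> Q (\<lambda>t. f t * g t)"
      "\<And>c. c \<in> S \<Longrightarrow> Q c" "\<And>k. Q (y k)" and f: "f \<in> A" for Q f
  proof -
    obtain r p where p: "p \<in> pfun S r" "f = (\<lambda>t. p t (\<lambda>k. y k t))" using f by (auto simp: A_def evals_def)
    have "eventually (\<lambda>t. (y k has_real_derivative y (Suc k) t) (at t)) at_top" for k
      using eventually_gt_at_top[of a] by eventually_elim (rule yd)
    then show ?thesis unfolding p(2)
      by (intro pfun_deriv[where Q = Q and r = r and y' = "\<lambda>k. y (Suc k)"]) (use Q p in auto)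
  qed
  have reg: "regular an f" if "f \<in> A" for f
  proof -
    define R where "R = (\<lambda>f. eventually (\<lambda>T. regular_on an f {T<..}) at_top)"
    have "R f"
    proof (rule Qgen[of R f, THEN conjunct1])
      show "R (\<lambda>t. f t + h t)" if "R f" "R h" for f h
        using that unfolding R_def by eventually_elim (rule regular_on_add[OF open_greaterThan])
      show "R (\<lambda>t. f t * h t)" if "R f" "R h" for f h
        using that unfolding R_def by eventually_elim (rule regular_on_mult[OF open_greaterThan])
      show "R c" if "c \<in> S" for c
        using regular[OF that] unfolding R_def regular_def eventually_at_top_linorder
        by (auto elim!: regular_on_subset)
      show "R (y k)" for k
        unfolding R_def eventually_at_top_linorder using yreg[of k] by (auto elim!: regular_on_subset)
    qed fact
    then show ?thesis unfolding R_def regular_def eventually_at_top_linorder by blast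
  qed
  have "A \<subseteq> S"
  proof (rule extension_trivial[OF A.fun_ring_axioms SA reg])
    fix f assume "f \<in> A"
    then show "\<exists>e\<in>fracs A. eventually (\<lambda>t. (f has_real_derivative e t) (at t)) at_top"
      using Qgen[of "\<lambda>f. f \<in> fracs A" f] SA yA by (auto intro: A.fracs_add A.fracs_mult A.fracs_base)
  qed
  then show ?thesis using yA[of 0] by (auto simp: y_def)
qed

end

thm_deps max_hfun.transcendental_extension

section \<open>Lower bounds at a gap\<close>

locale hardy_gap = max_hfun S an + K: hfun K for S an K +
  fixes f \<epsilon> :: "real \<Rightarrow> real"
  assumes SK: "S \<subseteq> K" and fK: "f \<in> K" and \<epsilon>K: "\<epsilon> \<in> K"
    and \<epsilon>_pos: "eventually (\<lambda>t. \<epsilon> t > 0) at_top"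
    and gap: "h \<in> S \<Longrightarrow> \<not> eventually (\<lambda>t. \<bar>f t - h t\<bar> < \<epsilon> t) at_top"
begin

abbreviation fd :: "nat \<Rightarrow> real \<Rightarrow> real" where
  "fd k \<equiv> (deriv ^^ k) f"

text \<open>One gauge serves every pair in A. Comparing with the coefficient norm, instead of
  normalising by it, also covers coefficients that all vanish.\<close>

definition lower :: "(real \<Rightarrow> real) \<Rightarrow> npoly set \<Rightarrow> bool" where
  "lower \<phi> A \<longleftrightarrow> K.gauge \<phi> \<and> (\<forall>(n, p)\<in>A. eventually (\<lambda>t. n t * \<phi> t \<le> \<bar>p t (\<lambda>k. fd k t)\<bar>) at_top)"

lemma lowerD: "lower \<phi> A \<Longrightarrow> (n, p) \<in> A \<Longrightarrow> eventually (\<lambda>t. n t * \<phi> t \<le> \<bar>p t (\<lambda>k. fd k t)\<bar>) at_top"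
  by (auto simp: lower_def)

lemma fd_mem: "fd k \<in> K"
  using K.der_funpow[OF fK] .

text \<open>The constant leaves room: any point within distance 1 of the derivatives of f up to
  order r still has coordinates bounded by M.\<close>

definition M :: "nat \<Rightarrow> real \<Rightarrow> real" where
  "M r t = 2 + (\<Sum>k\<le>r. \<bar>fd k t\<bar>)"

lemma M_mem: "M r \<in> K"
  unfolding M_def by (intro K.add K.numeral K.sum K.abs fd_mem)

lemma M_ge: "M r t \<ge> 2" "k \<le> r \<Longrightarrow> \<bar>fd k t\<bar> + 1 \<le> M r t"
proof -
  show "M r t \<ge> 2" by (simp add: M_def sum_nonneg)
  assume "k \<le> r"
  then have "\<bar>fd k t\<bar> \<le> (\<Sum>k\<le>r. \<bar>fd k t\<bar>)" by (intro member_le_sum) auto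
  then show "\<bar>fd k t\<bar> + 1 \<le> M r t" by (simp add: M_def)
qed

lemma M_power_ge: "M r t ^ e \<ge> 1"
  using M_ge(1)[of r t] by (intro one_le_power) simp

text \<open>A gauge multiplied by this weight absorbs a Lipschitz constant c * M^e.
  \<open>Suc c\<close> keeps the denominator positive for c = 0.\<close>

definition cw :: "nat \<Rightarrow> nat \<Rightarrow> nat \<Rightarrow> real \<Rightarrow> real" where
  "cw r c e t = 1 / (real (Suc c) * M r t ^ e)"

lemma M_power_pos: "M r t ^ e > 0"
  using M_power_ge[of r t e] by linarith

lemma cw_pos: "cw r c e t > 0"
  using M_power_pos[of r t e] by (simp add: cw_def)

lemma cw_cancel: "x * cw r c e t * (real (Suc c) * M r t ^ e) = x"
proof -
  define D where "D = real (Suc c) * M r t ^ e"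
  have "D > 0" unfolding D_def using M_power_pos[of r t e] by (intro mult_pos_pos) auto
  then show ?thesis unfolding cw_def D_def[symmetric] by simp
qed

lemma gauge_cw: "K.gauge (cw r c e)"
proof (rule K.gauge_mem)
  show "cw r c e \<in> K" unfolding cw_def by (intro K.divide K.one K.mult K.of_nat K.power M_mem)
qed (simp add: cw_pos)

lemma gauge_below:
  fixes \<phi> :: "nat \<Rightarrow> real \<Rightarrow> real"
  assumes "\<And>i. K.gauge (\<phi> i)"
  shows "\<exists>\<psi>. K.gauge \<psi> \<and> (\<forall>i. eventually (\<lambda>t. \<psi> t \<le> \<phi> i t) at_top)"
  using K.tiny_gauge[of \<phi>, OF assms] by metis

lemma gauge_below_mult:
  assumes "K.gauge \<phi>" "K.gauge \<psi>" "K.gauge \<phi>'"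
  shows "\<exists>\<eta>. K.gauge \<eta> \<and> eventually (\<lambda>t. \<eta> t \<le> \<phi> t * \<psi> t) at_top \<and> eventually (\<lambda>t. \<eta> t \<le> \<phi>' t) at_top"
proof -
  obtain \<eta>1 where 1: "K.gauge \<eta>1" "eventually (\<lambda>t. \<eta>1 t \<le> \<phi> t * \<psi> t) at_top"
    using K.gauge_mult[OF assms(1,2)] by blast
  have "K.gauge (if i = (0::nat) then \<eta>1 else \<phi>')" for i using 1(1) assms(3) by simp
  then obtain \<eta> where \<eta>: "K.gauge \<eta>" "\<And>i. eventually (\<lambda>t. \<eta> t \<le> (if i = (0::nat) then \<eta>1 else \<phi>') t) at_top"
    using gauge_below[of "\<lambda>i. if i = 0 then \<eta>1 else \<phi>'"] by blast
  have "eventually (\<lambda>t. \<eta> t \<le> \<phi> t * \<psi> t) at_top"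
    using \<eta>(2)[of 0] 1(2) by eventually_elim simp
  with \<eta>(1) \<eta>(2)[of 1] show ?thesis by auto
qed

lemma gauge_one: "K.gauge (\<lambda>_. 1)"
  by (rule K.gauge_mem[OF K.one]) simp

lemma near_lower_bound:
  assumes est: "estimate e (Suc r) (n, q)"
    and lo: "n t * \<Phi> \<le> \<bar>q t (\<lambda>k. fd k t)\<bar>"
    and x: "\<And>k. k \<le> r \<Longrightarrow> \<bar>x k - fd k t\<bar> \<le> D" and D: "D \<le> 1" "2 * (real e * M r t ^ e) * D \<le> \<Phi>" "D \<ge> 0"
  shows "n t * \<Phi> / 2 \<le> \<bar>q t x\<bar>"
proof -
  have xM: "\<bar>x k\<bar> \<le> M r t" "\<bar>fd k t\<bar> \<le> M r t" if "k \<le> r" for k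
    using x[OF that] D(1) M_ge(2)[OF that, of t] by auto
  have "\<bar>q t x - q t (\<lambda>k. fd k t)\<bar> \<le> n t * (real e * M r t ^ e) * D"
    using xM x D(3) M_ge(1)[of r t] by (intro estimateD(3)[OF est]) auto
  also have "\<dots> = n t * ((2 * (real e * M r t ^ e) * D) / 2)" by simp
  also have "\<dots> \<le> n t * (\<Phi> / 2)"
    using D(2) estimateD(1)[OF est, of t] by (intro mult_left_mono divide_right_mono) auto
  finally show ?thesis using lo by linarith
qed

text \<open>The coefficient norm lies in the field and decides the case: if it vanishes, so do the
  values of q; otherwise the lower bound at f, at most halved by passing to the nearby x, still
  excludes zeros.\<close>

lemma near_zero_or:
  assumes est: "estimate e (Suc r) (n, q)" and n: "n \<in> S"
    and lo: "eventually (\<lambda>t. n t * \<Phi> t \<le> \<bar>q t (\<lambda>k. fd k t)\<bar>) at_top" and \<Phi>: "eventually (\<lambda>t. \<Phi> t > 0) at_top"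
    and D: "eventually (\<lambda>t. D t \<le> 1 \<and> 2 * (real e * M r t ^ e) * D t \<le> \<Phi> t \<and> D t \<ge> 0) at_top"
    and x: "eventually (\<lambda>t. \<forall>k\<le>r. \<bar>x k t - fd k t\<bar> \<le> D t) at_top"
  shows "eventually (\<lambda>t. n t = 0 \<and> q t (\<lambda>k. x k t) = 0) at_top \<or> eventually (\<lambda>t. q t (\<lambda>k. x k t) \<noteq> 0) at_top"
  using zero_or[OF n]
proof
  assume "eventually (\<lambda>t. n t = 0) at_top"
  then have "eventually (\<lambda>t. n t = 0 \<and> q t (\<lambda>k. x k t) = 0) at_top"
    using D x
  proof eventually_elim
    case (elim t)
    have "\<bar>x k t\<bar> \<le> M r t" if "k \<le> r" for k
    proof -
      have "\<bar>x k t - fd k t\<bar> \<le> D t" using elim that by blast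
      then show ?thesis using elim M_ge(2)[OF that, of t] by auto
    qed
    then have "\<bar>q t (\<lambda>k. x k t)\<bar> \<le> n t * M r t ^ e"
      using M_ge(1)[of r t] by (intro estimateD(2)[OF est]) auto
    with elim show ?case by simp
  qed
  then show ?thesis ..
next
  assume "eventually (\<lambda>t. n t \<noteq> 0) at_top"
  then have "eventually (\<lambda>t. q t (\<lambda>k. x k t) \<noteq> 0) at_top"
    using D x lo \<Phi>
  proof eventually_elim
    case (elim t)
    have "n t * \<Phi> t / 2 \<le> \<bar>q t (\<lambda>k. x k t)\<bar>"
      using elim by (intro near_lower_bound[OF est]) auto
    moreover have "n t > 0" using estimateD(1)[OF est, of t] elim by simp
    then have "n t * \<Phi> t > 0" using elim by simp
    ultimately show ?case by auto
  qed
  then show ?thesis ..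
qed

lemma layer_0_embed: "(n, p) \<in> polys S N r \<Longrightarrow> (n, p) \<in> layer d r (polys S N r)"
proof -
  assume "(n, p) \<in> polys S N r"
  then have "(n, p) \<in> layer 0 r (polys S N r)"
    unfolding layer_def by (intro CollectI exI[of _ "\<lambda>_. n"] exI[of _ "\<lambda>_. p"]) simp
  then show ?thesis using layer_mono[OF subset_refl _ zero_polys, of 0 d r N r] by blast
qed

text \<open>
  Either the part of \<open>P\<close> involving \<open>x r\<close> is negligible, or the separant of \<open>P\<close> is bounded below at
  \<open>f\<close>. In the latter case a value of \<open>P\<close> at \<open>f\<close> that is too small would yield a zero of \<open>P\<close> close
  to \<open>f\<close>; this zero generates a regular Hardy field over \<open>S\<close>, so it lies in \<open>S\<close> and contradicts
  the gap.
\<close>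

lemma lower_step:
  assumes IH: "\<And>N. \<exists>\<phi>. lower \<phi> (layer d r (polys S N r))"
  shows "\<exists>\<phi>. lower \<phi> (layer (Suc d) r (polys S N r))"
proof -
  \<comment> \<open>Bounds for all N are collected: reduction modulo P yields polynomials of degree
    at most d in x r but of uncontrolled degree in the lower variables.\<close>
  obtain \<Phi> where \<Phi>: "\<And>N. lower (\<Phi> N) (layer d r (polys S N r))" using IH by metis
  have \<Phi>g: "K.gauge (\<Phi> N)" for N using \<Phi> by (simp add: lower_def)
  define e where "e = N * r + Suc d"
  define E where "E = (\<lambda>N'. N' * r + d)"
  define m where "m = M r"
  have m1: "m t \<ge> 1" for t using M_ge(1)[of r t] by (simp add: m_def)
  \<comment> \<open>The threshold between the two cases. If the coefficients involving x r weigh at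
    most \<psi> times the constant one, their contribution at f is at most a quarter of the lower
    bound for the constant one.\<close>
  obtain \<psi> where \<psi>: "K.gauge \<psi>" "eventually (\<lambda>t. \<psi> t \<le> \<Phi> N t * cw r (4 * Suc e) e t) at_top" "eventually (\<lambda>t. \<psi> t \<le> 1) at_top"
    using gauge_below_mult[OF \<Phi>g gauge_cw gauge_one] by blast
  \<comment> \<open>In the other case the separant is at least n * \<psi>2: one factor \<psi>
    compares n with the part involving x r, the other comes from the induction hypothesis for the
    separant.\<close>
  obtain \<psi>2 where \<psi>2: "K.gauge \<psi>2" "eventually (\<lambda>t. \<psi>2 t \<le> \<psi> t * \<psi> t) at_top"
    using K.gauge_mult[OF \<psi>(1,1)] by blast
  have half\<epsilon>: "K.gauge (\<lambda>t. \<epsilon> t / 2)"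
    by (rule K.gauge_mem) (use \<epsilon>K K.numeral K.divide \<epsilon>_pos in auto)
  \<comment> \<open>The source of the radius \<rho> within which the separant varies by at most a
    quarter; the constant accounts for the Lipschitz bounds of both P and its separant.\<close>
  obtain \<rho>1 where \<rho>1: "K.gauge \<rho>1" "eventually (\<lambda>t. \<rho>1 t \<le> \<psi>2 t * cw r (4 * Suc d * Suc e) e t) at_top" "eventually (\<lambda>t. \<rho>1 t \<le> 1) at_top"
    using gauge_below_mult[OF \<psi>2(1) gauge_cw gauge_one] by blast
  obtain \<rho> where \<rho>: "K.gauge \<rho>" "eventually (\<lambda>t. \<rho> t \<le> \<rho>1 t * 1) at_top" "eventually (\<lambda>t. \<rho> t \<le> \<epsilon> t / 2) at_top"
    using gauge_below_mult[OF \<rho>1(1) gauge_one half\<epsilon>] by blast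
  \<comment> \<open>With \<omega> below these bounds the zero found later is so close to f that the
    induction hypothesis survives the perturbation for every N'.\<close>
  have "\<exists>\<tau>. K.gauge \<tau> \<and> eventually (\<lambda>t. \<tau> t \<le> \<rho> t * (\<Phi> N' t * cw r (2 * E N') (E N') t)) at_top" for N'
  proof -
    obtain \<tau>1 where 1: "K.gauge \<tau>1" "eventually (\<lambda>t. \<tau>1 t \<le> \<Phi> N' t * cw r (2 * E N') (E N') t) at_top"
      using K.gauge_mult[OF \<Phi>g gauge_cw] by blast
    obtain \<tau> where 2: "K.gauge \<tau>" "eventually (\<lambda>t. \<tau> t \<le> \<rho> t * \<tau>1 t) at_top"
      using K.gauge_mult[OF \<rho>(1) 1(1)] by blast
    have "eventually (\<lambda>t. \<tau> t \<le> \<rho> t * (\<Phi> N' t * cw r (2 * E N') (E N') t)) at_top"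
      using 2(2) 1(2) K.gauge_pos[OF \<rho>(1)]
    proof eventually_elim
      case (elim t)
      then have "\<rho> t * \<tau>1 t \<le> \<rho> t * (\<Phi> N' t * cw r (2 * E N') (E N') t)" by (intro mult_left_mono) auto
      with elim show ?case by linarith
    qed
    with 2(1) show ?thesis by blast
  qed
  then obtain \<tau> where \<tau>: "\<And>N'. K.gauge (\<tau> N')"
    "\<And>N'. eventually (\<lambda>t. \<tau> N' t \<le> \<rho> t * (\<Phi> N' t * cw r (2 * E N') (E N') t)) at_top" by metis
  obtain \<rho>2 where \<rho>2: "K.gauge \<rho>2" "eventually (\<lambda>t. \<rho>2 t \<le> \<rho> t * \<rho> t) at_top"
    using K.gauge_mult[OF \<rho>(1,1)] by blast
  \<comment> \<open>\<open>tiny_gauge\<close> controls the derivative through the entry of index 0,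
    so \<rho> comes first; the remaining entries only bound \<omega> from above.\<close>
  define G where "G = (\<lambda>i. case i of 0 \<Rightarrow> \<rho> | Suc 0 \<Rightarrow> \<rho>2 | Suc (Suc N') \<Rightarrow> \<tau> N')"
  have Gg: "K.gauge (G i)" for i using \<rho>(1) \<rho>2(1) \<tau>(1) by (auto simp: G_def split: nat.split)
  obtain \<omega> where \<omega>: "K.gauge \<omega>" and \<omega>G: "\<And>i. eventually (\<lambda>t. \<omega> t \<le> G i t) at_top"
    and \<omega>d: "eventually (\<lambda>t. (\<omega> has_real_derivative deriv \<omega> t) (at t) \<and> deriv \<omega> t \<le> - \<omega> t / G 0 t) at_top"
    by (rule K.tiny_gauge[of G, OF Gg]) (rule that)
  have \<omega>\<rho>: "eventually (\<lambda>t. \<omega> t \<le> \<rho> t * \<rho> t) at_top"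
    using \<omega>G[of 1] \<rho>2(2) by eventually_elim (simp add: G_def)
  have \<omega>\<tau>: "eventually (\<lambda>t. \<omega> t \<le> \<rho> t * (\<Phi> N' t * cw r (2 * E N') (E N') t)) at_top" for N'
    using \<omega>G[of "Suc (Suc N')"] \<tau>(2)[of N'] by eventually_elim (simp add: G_def)
  have halfg: "K.gauge (\<lambda>t. 1 / 2)"
    by (rule K.gauge_mem[OF K.divide[OF K.one K.numeral]]) simp
  obtain \<phi>1 where \<phi>1: "K.gauge \<phi>1" "eventually (\<lambda>t. \<phi>1 t \<le> \<omega> t * (1 / 2)) at_top"
    using K.gauge_mult[OF \<omega> halfg] by blast
  obtain \<phi> where \<phi>: "K.gauge \<phi>" "eventually (\<lambda>t. \<phi> t \<le> \<psi>2 t * \<phi>1 t) at_top" "eventually (\<lambda>t. \<phi> t \<le> \<psi> t) at_top"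
    using gauge_below_mult[OF \<psi>2(1) \<phi>1(1) \<psi>(1)] by blast
  \<comment> \<open>The pair \<omega>, dw instantiates the weights of the contraction:
    \<open>deriv \<omega>\<close> is at most - dw, and \<omega> \<le> \<rho>^2 with \<rho> \<le> 1
    gives \<omega> \<le> dw \<le> \<rho>.\<close>
  define dw where "dw = (\<lambda>t. \<omega> t / \<rho> t)"
  note pos = K.gauge_pos[OF \<psi>(1)] K.gauge_pos[OF \<psi>2(1)] K.gauge_pos[OF \<rho>(1)] K.gauge_pos[OF \<omega>] K.gauge_pos[OF \<phi>(1)] K.gauge_pos[OF \<Phi>g[of N]]
  have basic: "eventually (\<lambda>t. \<psi> t > 0 \<and> \<psi>2 t > 0 \<and> \<rho> t > 0 \<and> \<omega> t > 0 \<and> \<phi> t > 0 \<and> \<Phi> N t > 0 \<and>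
      4 * \<psi> t * (real (Suc e) * m t ^ e) \<le> \<Phi> N t \<and> \<psi> t \<le> 1 \<and> \<psi>2 t \<le> \<psi> t * \<psi> t \<and>
      4 * \<rho> t * (real (Suc d) * real (Suc e) * m t ^ e) \<le> \<psi>2 t \<and> \<rho> t \<le> 1 \<and> \<rho> t < \<epsilon> t \<and>
      \<omega> t \<le> \<rho> t * \<rho> t \<and> dw t > 0 \<and> dw t \<le> \<rho> t \<and> \<omega> t \<le> dw t \<and> \<omega> t = \<rho> t * dw t \<and>
      \<phi> t \<le> \<psi> t \<and> \<phi> t \<le> \<psi>2 t * \<omega> t / 2) at_top"
    using pos \<psi>(2,3) \<psi>2(2) \<rho>(2,3) \<rho>1(2,3) \<omega>\<rho> \<phi>(2,3) \<phi>1(2) \<epsilon>_pos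
  proof eventually_elim
    case (elim t)
    have mp: "m t ^ e \<ge> 1" unfolding m_def by (rule M_power_ge)
    have 1: "4 * \<psi> t * (real (Suc e) * m t ^ e) \<le> \<Phi> N t"
    proof -
      have "\<psi> t * (4 * (real (Suc e) * m t ^ e)) \<le> \<psi> t * (real (Suc (4 * Suc e)) * m t ^ e)"
        using elim mp by (intro mult_left_mono) (auto simp: algebra_simps)
      also have "\<dots> \<le> (\<Phi> N t * cw r (4 * Suc e) e t) * (real (Suc (4 * Suc e)) * m t ^ e)"
        using elim mp by (intro mult_right_mono) auto
      also have "\<dots> = \<Phi> N t"
        unfolding m_def by (rule cw_cancel)
      finally show ?thesis by (simp add: mult_ac)
    qed
    have \<rho>le: "\<rho> t \<le> \<rho>1 t" using elim by simp
    have 2: "4 * \<rho> t * (real (Suc d) * real (Suc e) * m t ^ e) \<le> \<psi>2 t"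
    proof -
      have "\<rho> t * (4 * (real (Suc d) * real (Suc e) * m t ^ e)) \<le> \<rho> t * (real (Suc (4 * Suc d * Suc e)) * m t ^ e)"
        using elim mp by (intro mult_left_mono) (auto simp: algebra_simps)
      also have "\<dots> \<le> (\<psi>2 t * cw r (4 * Suc d * Suc e) e t) * (real (Suc (4 * Suc d * Suc e)) * m t ^ e)"
        using elim \<rho>le mp by (intro mult_right_mono) auto
      also have "\<dots> = \<psi>2 t"
        unfolding m_def by (rule cw_cancel)
      finally show ?thesis by (simp add: mult_ac)
    qed
    have \<rho>1': "\<rho> t \<le> 1" using elim \<rho>le by linarith
    have d: "dw t > 0" "\<omega> t = \<rho> t * dw t" using elim by (auto simp: dw_def)
    have d2: "dw t \<le> \<rho> t" using elim by (simp add: dw_def pos_divide_le_eq)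
    have d3: "\<omega> t \<le> dw t" unfolding d(2) using d(1) \<rho>1' elim by (intro mult_left_le_one_le) auto
    have "\<psi>2 t * \<phi>1 t \<le> \<psi>2 t * (\<omega> t * (1/2))" using elim by (intro mult_left_mono) auto
    also have "\<psi>2 t * (\<omega> t * (1/2)) = \<psi>2 t * \<omega> t / 2" by simp
    finally have 5: "\<phi> t \<le> \<psi>2 t * \<omega> t / 2" using elim by linarith
    show ?case using elim 1 2 \<rho>1' d d2 d3 5 by (intro conjI) (assumption | linarith)+
  qed
  have "eventually (\<lambda>t. n t * \<phi> t \<le> \<bar>P t (\<lambda>k. fd k t)\<bar>) at_top" if nP: "(n, P) \<in> layer (Suc d) r (polys S N r)" for n P
  proof -
    obtain ni p where n: "n = (\<lambda>t. \<Sum>i\<le>Suc d. ni i t)" and P: "P = (\<lambda>t x. \<Sum>i\<le>Suc d. p i t x * x r ^ i)"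
      and np: "\<And>i. i \<le> Suc d \<Longrightarrow> (ni i, p i) \<in> polys S N r"
      using nP unfolding layer_def by blast
    define \<eta> where "\<eta> = (\<lambda>t. \<Sum>i\<le>d. ni (Suc i) t)"
    \<comment> \<open>P without its part constant in x r, padded by a zero coefficient to stay in
      the same layer. \<open>Sn\<close> and \<open>Sp\<close> below are the coefficient norm and the
      values of the separant, of degree d in x r.\<close>
    define R where "R = (\<lambda>t x. \<Sum>i\<le>Suc d. (if i = 0 then (\<lambda>_ _. 0) else p i) t x * x r ^ i)"
    define Sn where "Sn = (\<lambda>t. \<Sum>i\<le>d. real (Suc i) * ni (Suc i) t)"
    define Sp where "Sp = (\<lambda>t x. \<Sum>i\<le>d. (real (Suc i) * p (Suc i) t x) * x r ^ i)"
    have nS: "n \<in> S" using layer_norm_mem[OF nP] .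
    have n0S: "ni i \<in> S" if "i \<le> Suc d" for i using polys_norm_mem[OF np[OF that]] .
    have \<eta>S: "\<eta> \<in> S" unfolding \<eta>_def by (intro sum n0S) auto
    have ni0: "ni i t \<ge> 0" if "i \<le> Suc d" for i t
      using estimateD(1)[OF estimate_polys[OF np[OF that]]] .
    have n_eq: "n t = ni 0 t + \<eta> t" for t unfolding n \<eta>_def by (subst sum.atMost_Suc_shift) simp
    have \<eta>0: "\<eta> t \<ge> 0" for t unfolding \<eta>_def by (intro sum_nonneg ni0) auto
    have PK: "(\<lambda>t. P t (\<lambda>k. fd k t)) \<in> K" by (rule K.layer_eval_mem[OF nP SK fd_mem])
    have Pest: "estimate e (Suc r) (n, P)" using estimate_layer_polys[OF nP] by (simp add: e_def)
    have Rlay: "(\<eta>, R) \<in> layer (Suc d) r (polys S N r)"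
      unfolding layer_def
    proof (intro CollectI exI[of _ "\<lambda>i. if i = 0 then (\<lambda>_. 0) else ni i"] exI[of _ "\<lambda>i. if i = 0 then (\<lambda>_ _. 0) else p i"] conjI allI impI)
      have "\<eta> t = (\<Sum>i\<le>Suc d. (if i = 0 then (\<lambda>_. 0) else ni i) t)" for t
        unfolding \<eta>_def by (subst sum.atMost_Suc_shift) simp
      then show "(\<eta>, R) = ((\<lambda>t. \<Sum>i\<le>Suc d. (if i = 0 then (\<lambda>_. 0) else ni i) t),
          (\<lambda>t x. \<Sum>i\<le>Suc d. (if i = 0 then (\<lambda>_ _. 0) else p i) t x * x r ^ i))"
        unfolding R_def by (simp only: prod.inject fun_eq_iff) simp
      show "(if i = 0 then (\<lambda>_. 0) else ni i, if i = 0 then (\<lambda>_ _. 0) else p i) \<in> polys S N r" if "i \<le> Suc d" for i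
        using np[OF that] zero_polys by simp
    qed
    have Rest: "estimate e (Suc r) (\<eta>, R)" using estimate_layer_polys[OF Rlay] by (simp add: e_def)
    have PR: "P t x = p 0 t x + R t x" for t x
      unfolding P R_def sum.atMost_Suc_shift[of _ d] by simp
    have Slay: "(Sn, Sp) \<in> layer d r (polys S N r)"
      unfolding layer_def Sn_def Sp_def
      by (intro CollectI exI[of _ "\<lambda>i t. real (Suc i) * ni (Suc i) t"] exI[of _ "\<lambda>i t x. real (Suc i) * p (Suc i) t x"] conjI refl allI impI
          polys_scale of_nat np) auto
    have Sest: "estimate (E N) (Suc r) (Sn, Sp)" using estimate_layer_polys[OF Slay] by (simp add: E_def)
    have Sn_ge: "Sn t \<ge> \<eta> t" for t
      unfolding Sn_def \<eta>_def
    proof (rule sum_mono)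
      fix i assume "i \<in> {..d}"
      then have "1 * ni (Suc i) t \<le> real (Suc i) * ni (Suc i) t" using ni0[of "Suc i" t] by (intro mult_right_mono) auto
      then show "ni (Suc i) t \<le> real (Suc i) * ni (Suc i) t" by simp
    qed
    have Sn_le: "Sn t \<le> real (Suc d) * n t" for t
    proof -
      have "Sn t \<le> (\<Sum>i\<le>d. real (Suc d) * ni (Suc i) t)"
        unfolding Sn_def by (intro sum_mono mult_right_mono ni0) auto
      also have "\<dots> = real (Suc d) * \<eta> t" by (simp add: \<eta>_def sum_distrib_left)
      also have "\<dots> \<le> real (Suc d) * n t" using ni0[of 0 t] by (intro mult_left_mono) (auto simp: n_eq)
      finally show ?thesis .
    qed
    have Sf: "eventually (\<lambda>t. Sn t * \<Phi> N t \<le> \<bar>Sp t (\<lambda>k. fd k t)\<bar>) at_top"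
      by (rule lowerD[OF \<Phi> Slay])
    have fM: "\<bar>fd k t\<bar> \<le> m t" if "k < Suc r" for k t using M_ge(2)[of k r t] that by (simp add: m_def)

    \<comment> \<open>P(f) is governed by \<open>p 0\<close>, for which a bound is known, and n is
      at most twice \<open>ni 0\<close>.\<close>
    have caseA: ?thesis if A: "eventually (\<lambda>t. \<eta> t \<le> ni 0 t * \<psi> t) at_top"
      using A basic lowerD[OF \<Phi> layer_0_embed[OF np[OF le0]]]
    proof eventually_elim
      case (elim t)
      have mp: "m t ^ e \<ge> 1" unfolding m_def by (rule M_power_ge)
      have "\<bar>R t (\<lambda>k. fd k t)\<bar> \<le> \<eta> t * m t ^ e" by (rule estimateD(2)[OF Rest m1 fM])
      also have "\<dots> \<le> (ni 0 t * \<psi> t) * m t ^ e" using elim mp by (intro mult_right_mono) auto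
      also have "\<dots> = ni 0 t * (\<psi> t * m t ^ e)" by simp
      also have "\<dots> \<le> ni 0 t * (\<Phi> N t / 4)"
      proof (rule mult_left_mono[OF _ ni0])
        have "4 * \<psi> t * (1 * m t ^ e) \<le> 4 * \<psi> t * (real (Suc e) * m t ^ e)"
          using elim mp by (intro mult_left_mono mult_right_mono) auto
        then show "\<psi> t * m t ^ e \<le> \<Phi> N t / 4" using elim by - (elim conjE, linarith)
      qed simp
      finally have R: "\<bar>R t (\<lambda>k. fd k t)\<bar> \<le> ni 0 t * \<Phi> N t / 4" by simp
      have 4: "4 * \<psi> t \<le> \<Phi> N t"
      proof -
        have "1 * 1 \<le> real (Suc e) * m t ^ e" using mp by (intro mult_mono) auto
        then have "4 * \<psi> t * 1 \<le> 4 * \<psi> t * (real (Suc e) * m t ^ e)" using elim by (intro mult_left_mono) auto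
        then show ?thesis using elim by - (elim conjE, linarith)
      qed
      have "\<eta> t \<le> ni 0 t * 1" 
      proof -
        have "\<psi> t \<le> 1" using elim by blast
        from mult_left_mono[OF this ni0[OF le0]] show ?thesis using elim(1) by (rule order_trans[rotated])
      qed
      then have "n t \<le> 2 * ni 0 t" by (simp add: n_eq)
      then have "n t * \<phi> t \<le> (2 * ni 0 t) * \<psi> t"
        using elim ni0[OF le0, of t] by (intro mult_mono) auto
      also have "\<dots> = ni 0 t * (4 * \<psi> t) / 2" by simp
      also have "\<dots> \<le> ni 0 t * \<Phi> N t / 2" using 4 ni0[OF le0, of t] by (intro divide_right_mono mult_left_mono) auto
      finally have "n t * \<phi> t \<le> ni 0 t * \<Phi> N t / 2" .
      moreover have "ni 0 t * \<Phi> N t - ni 0 t * \<Phi> N t / 4 \<le> \<bar>P t (\<lambda>k. fd k t)\<bar>"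
        unfolding PR using R elim by - (elim conjE, linarith)
      moreover have "ni 0 t * \<Phi> N t \<ge> 0" using elim ni0[OF le0, of t] by simp
      ultimately show ?case by linarith
    qed
    \<comment> \<open>Here P has degree d. The case is split off because \<open>caseB\<close> must
      know the leading coefficient to be nonzero at the constructed zero.\<close>
    have caseL: ?thesis if L: "eventually (\<lambda>t. ni (Suc d) t = 0) at_top"
    proof -
      have lay: "((\<lambda>t. \<Sum>i\<le>d. ni i t), (\<lambda>t x. \<Sum>i\<le>d. p i t x * x r ^ i)) \<in> layer d r (polys S N r)"
        unfolding layer_def using np by (intro CollectI exI[of _ ni] exI[of _ p]) auto
      show ?thesis using L basic lowerD[OF \<Phi> lay]
      proof eventually_elim
        case (elim t)
        have "\<bar>p (Suc d) t (\<lambda>k. fd k t)\<bar> \<le> ni (Suc d) t * m t ^ (N * r)"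
          by (rule estimateD(2)[OF estimate_polys[OF np[OF order_refl]] m1]) (auto intro: fM)
        then have "P t (\<lambda>k. fd k t) = (\<Sum>i\<le>d. p i t (\<lambda>k. fd k t) * fd r t ^ i)"
          unfolding P using elim by simp
        moreover have "n t = (\<Sum>i\<le>d. ni i t)" using elim by (simp add: n)
        moreover have "\<phi> t \<le> \<Phi> N t"
        proof -
          have "m t ^ e \<ge> 1" unfolding m_def by (rule M_power_ge)
          then have "1 * 1 \<le> real (Suc e) * m t ^ e" by (intro mult_mono) auto
          then have "4 * \<psi> t * 1 \<le> 4 * \<psi> t * (real (Suc e) * m t ^ e)" using elim by (intro mult_left_mono) auto
          then show ?thesis using elim by - (elim conjE, linarith)
        qed
        then have "n t * \<phi> t \<le> n t * \<Phi> N t" using estimateD(1)[OF Pest, of t] by (intro mult_left_mono) auto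
        ultimately show ?case using elim by simp
      qed
    qed
    \<comment> \<open>P(f) is below n * \<phi> while the separant is at least n * \<psi>2, so a
      Newton step at f has length at most \<omega>/2.\<close>
    have caseB: False
      if B: "eventually (\<lambda>t. ni 0 t * \<psi> t \<le> \<eta> t) at_top" and npos: "eventually (\<lambda>t. n t > 0) at_top"
        and small: "eventually (\<lambda>t. \<bar>P t (\<lambda>k. fd k t)\<bar> < n t * \<phi> t) at_top"
        and L: "eventually (\<lambda>t. ni (Suc d) t \<noteq> 0) at_top"
    proof -
      have sep: "eventually (\<lambda>t. n t * \<psi>2 t \<le> \<bar>Sp t (\<lambda>k. fd k t)\<bar>) at_top"
        using B basic Sf
      proof eventually_elim
        case (elim t)
        have "n t * \<psi> t \<le> \<eta> t + \<eta> t * 1"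
          unfolding n_eq distrib_right using elim \<eta>0[of t] by (intro add_mono mult_left_mono) auto
        then have "n t * \<psi> t * \<psi> t \<le> (2 * \<eta> t) * \<psi> t" using elim by (intro mult_right_mono) auto
        moreover have "n t * \<psi>2 t \<le> n t * (\<psi> t * \<psi> t)"
          using elim estimateD(1)[OF Pest, of t] by (intro mult_left_mono) auto
        moreover have "\<eta> t * (2 * \<psi> t) \<le> Sn t * \<Phi> N t"
        proof (rule mult_mono[OF Sn_ge])
          have "m t ^ e \<ge> 1" unfolding m_def by (rule M_power_ge)
          then have "1 * 1 \<le> real (Suc e) * m t ^ e" by (intro mult_mono) auto
          then have "4 * \<psi> t * 1 \<le> 4 * \<psi> t * (real (Suc e) * m t ^ e)" using elim by (intro mult_left_mono) auto
          then show "2 * \<psi> t \<le> \<Phi> N t" using elim by - (elim conjE, linarith)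
          show "0 \<le> Sn t" using \<eta>0[of t] Sn_ge[of t] by linarith
        qed (use elim in auto)
        ultimately show ?case using elim(3) by (simp only: mult_ac)
      qed
      \<comment> \<open>A common Lipschitz constant of P and its separant near f; divided by the
        separant at f it is at most 1/(4 \<rho>).\<close>
      define lip where "lip = (\<lambda>t. n t * \<psi>2 t / (4 * \<rho> t))"
      have lips: "eventually (\<lambda>t. n t * (real e * m t ^ e) \<le> lip t \<and> Sn t * (real (E N) * m t ^ E N) \<le> lip t) at_top"
        using basic
      proof eventually_elim
        case (elim t)
        have mp: "m t ^ e \<ge> 1" unfolding m_def by (rule M_power_ge)
        have n0: "n t \<ge> 0" using estimateD(1)[OF Pest] .
        have "real (Suc d) * real (Suc e) * m t ^ e \<le> \<psi>2 t / (4 * \<rho> t)"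
          using elim by (simp add: pos_le_divide_eq mult_ac)
        then have key: "n t * (real (Suc d) * real (Suc e) * m t ^ e) \<le> lip t"
          unfolding lip_def using n0 by (metis mult_left_mono times_divide_eq_right)
        have "n t * (real e * m t ^ e) \<le> n t * (real (Suc d) * real (Suc e) * m t ^ e)"
        proof (intro mult_left_mono mult_right_mono n0)
          have "1 * real e \<le> real (Suc d) * real (Suc e)" by (intro mult_mono) auto
          then show "real e \<le> real (Suc d) * real (Suc e)" by simp
        qed (use mp in simp)
        moreover have "Sn t * (real (E N) * m t ^ E N) \<le> (real (Suc d) * n t) * (real (Suc e) * m t ^ e)"
          using n0 m1[of t] Sn_le[of t] by (intro mult_mono power_increasing) (auto simp: e_def E_def)
        ultimately show ?case using key by (simp add: mult_ac)
      qed
      have fc: "eventually (\<lambda>t. \<forall>k\<le>r. (fd k has_real_derivative fd (Suc k) t) (at t)) at_top"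
        by (rule eventually_all_le) (use K.eDERIV[OF fd_mem] in simp)
      have Pc: "eventually (\<lambda>T. \<forall>x. (\<forall>k<Suc r. continuous_on {T<..} (x k)) \<longrightarrow>
          continuous_on {T<..} (\<lambda>t. P t (\<lambda>k. x k t))) at_top" by (rule layer_polys_continuous[OF nP])
      have Sc: "eventually (\<lambda>T. \<forall>x. (\<forall>k<Suc r. continuous_on {T<..} (x k)) \<longrightarrow>
          continuous_on {T<..} (\<lambda>t. Sp t (\<lambda>k. x k t))) at_top" by (rule layer_polys_continuous[OF Slay])
      obtain T0 where T0: "\<And>T. T \<ge> T0 \<Longrightarrow> (\<forall>x. (\<forall>k<Suc r. continuous_on {T<..} (x k)) \<longrightarrow>
          continuous_on {T<..} (\<lambda>t. P t (\<lambda>k. x k t))) \<and> (\<forall>x. (\<forall>k<Suc r. continuous_on {T<..} (x k)) \<longrightarrow>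
          continuous_on {T<..} (\<lambda>t. Sp t (\<lambda>k. x k t)))"
        using eventually_conj[OF Pc Sc] unfolding eventually_at_top_linorder by blast
      have "eventually (\<lambda>t. T0 \<le> t \<and> isCont \<omega> t \<and> isCont \<rho> t \<and> (\<omega> has_real_derivative deriv \<omega> t) (at t) \<and>
          deriv \<omega> t \<le> - dw t) at_top"
        using eventually_ge_at_top[of T0] K.gauge_cont[OF \<omega>] K.gauge_cont[OF \<rho>(1)] \<omega>d
        by eventually_elim (simp add: dw_def G_def)
      from eventually_conj[OF this eventually_conj[OF basic eventually_conj[OF sep eventually_conj[OF lips
          eventually_conj[OF fc eventually_conj[OF npos small]]]]]]
      obtain T where T: "\<And>t. t \<ge> T \<Longrightarrow> (T0 \<le> t \<and> isCont \<omega> t \<and> isCont \<rho> t \<and> (\<omega> has_real_derivative deriv \<omega> t) (at t) \<and>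
          deriv \<omega> t \<le> - dw t) \<and> (\<psi> t > 0 \<and> \<psi>2 t > 0 \<and> \<rho> t > 0 \<and> \<omega> t > 0 \<and> \<phi> t > 0 \<and> \<Phi> N t > 0 \<and>
      4 * \<psi> t * (real (Suc e) * m t ^ e) \<le> \<Phi> N t \<and> \<psi> t \<le> 1 \<and> \<psi>2 t \<le> \<psi> t * \<psi> t \<and>
      4 * \<rho> t * (real (Suc d) * real (Suc e) * m t ^ e) \<le> \<psi>2 t \<and> \<rho> t \<le> 1 \<and> \<rho> t < \<epsilon> t \<and>
      \<omega> t \<le> \<rho> t * \<rho> t \<and> dw t > 0 \<and> dw t \<le> \<rho> t \<and> \<omega> t \<le> dw t \<and> \<omega> t = \<rho> t * dw t \<and>
      \<phi> t \<le> \<psi> t \<and> \<phi> t \<le> \<psi>2 t * \<omega> t / 2) \<and> n t * \<psi>2 t \<le> \<bar>Sp t (\<lambda>k. fd k t)\<bar> \<and>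
      (n t * (real e * m t ^ e) \<le> lip t \<and> Sn t * (real (E N) * m t ^ E N) \<le> lip t) \<and>
      (\<forall>k\<le>r. (fd k has_real_derivative fd (Suc k) t) (at t)) \<and> n t > 0 \<and> \<bar>P t (\<lambda>k. fd k t)\<bar> < n t * \<phi> t"
        unfolding eventually_at_top_linorder by blast
      have T0T: "T0 \<le> T" using T[of T] by simp
      have dwc: "continuous_on {T<..} dw"
        unfolding dw_def
      proof (intro continuous_at_imp_continuous_on ballI)
        fix t assume "t \<in> {T<..}"
        then have "isCont \<omega> t" "isCont \<rho> t" "\<rho> t \<noteq> 0" using T[of t] by auto
        then show "isCont (\<lambda>t. \<omega> t / \<rho> t) t" by (intro continuous_intros)
      qed
      interpret W: tail_weight T \<omega> "deriv \<omega>" dw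
        by unfold_locales (use T dwc in auto)
      \<comment> \<open>Newton's map with the derivative frozen at f: as the separant does not
        vanish, x r = F t x means that P vanishes at f + x.\<close>
      define F where "F = (\<lambda>t x. x r - P t (\<lambda>k. fd k t + x k) / Sp t (\<lambda>k. fd k t))"
      have fcont: "continuous_on {T<..} (fd k)" if "k \<le> r" for k
      proof (intro continuous_at_imp_continuous_on ballI)
        fix t assume "t \<in> {T<..}"
        then have "T \<le> t" by simp
        from T[OF this] have "\<forall>k\<le>r. (fd k has_real_derivative fd (Suc k) t) (at t)" by blast
        with that show "isCont (fd k) t" by (blast intro: DERIV_isCont)
      qed
      have Sf0: "\<bar>Sp t (\<lambda>k. fd k t)\<bar> \<ge> n t * \<psi>2 t" "n t * \<psi>2 t > 0" "Sp t (\<lambda>k. fd k t) \<noteq> 0" if "t > T" for t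
      proof -
        show a: "\<bar>Sp t (\<lambda>k. fd k t)\<bar> \<ge> n t * \<psi>2 t" using T[of t] that by simp
        show b: "n t * \<psi>2 t > 0" using T[of t] that by simp
        show "Sp t (\<lambda>k. fd k t) \<noteq> 0" using a b by auto
      qed
      have Plip: "\<bar>P t x - P t x'\<bar> \<le> lip t * D"
        if "t > T" "\<And>k. k \<le> r \<Longrightarrow> \<bar>x k\<bar> \<le> m t" "\<And>k. k \<le> r \<Longrightarrow> \<bar>x' k\<bar> \<le> m t"
          "\<And>k. k \<le> r \<Longrightarrow> \<bar>x k - x' k\<bar> \<le> D" "D \<ge> 0" for t x x' D
      proof -
        have "\<bar>P t x - P t x'\<bar> \<le> n t * (real e * m t ^ e) * D"
          using that by (intro estimateD(3)[OF Pest m1]) auto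
        also have "\<dots> \<le> lip t * D" using T[of t] that by (intro mult_right_mono) auto
        finally show ?thesis .
      qed
      have Slip: "\<bar>Sp t x - Sp t x'\<bar> \<le> lip t * D"
        if "t > T" "\<And>k. k \<le> r \<Longrightarrow> \<bar>x k\<bar> \<le> m t" "\<And>k. k \<le> r \<Longrightarrow> \<bar>x' k\<bar> \<le> m t"
          "\<And>k. k \<le> r \<Longrightarrow> \<bar>x k - x' k\<bar> \<le> D" "D \<ge> 0" for t x x' D
      proof -
        have "\<bar>Sp t x - Sp t x'\<bar> \<le> Sn t * (real (E N) * m t ^ E N) * D"
          using that by (intro estimateD(3)[OF Sest m1]) auto
        also have "\<dots> \<le> lip t * D" using T[of t] that by (intro mult_right_mono) auto
        finally show ?thesis .
      qed
      have lipS: "lip t * c / \<bar>Sp t (\<lambda>k. fd k t)\<bar> \<le> c / (4 * \<rho> t)" if "t > T" "c \<ge> 0" for t c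
      proof -
        have "lip t * c / \<bar>Sp t (\<lambda>k. fd k t)\<bar> \<le> lip t * c / (n t * \<psi>2 t)"
          using Sf0[OF that(1)] that(2) T[of t] that(1) by (intro divide_left_mono mult_nonneg_nonneg) (auto simp: lip_def)
        also have "\<dots> = c / (4 * \<rho> t)"
        proof -
          define a where "a = n t * \<psi>2 t"
          have "a > 0" using Sf0(2)[OF that(1)] by (simp only: a_def)
          then show ?thesis unfolding lip_def a_def[symmetric] by simp
        qed
        finally show ?thesis .
      qed
      have nearM: "\<bar>fd k t + u\<bar> \<le> m t" if "t > T" "k \<le> r" "\<bar>u\<bar> \<le> dw t" for t k u
      proof -
        have "dw t \<le> 1" using T[of t] that(1) by simp
        then show ?thesis using that M_ge(2)[OF that(2), of t] unfolding m_def by linarith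
      qed
      \<comment> \<open>A variation by at most a quarter, from dw \<le> \<rho>, serves twice: for
        the contraction in x r and for a nonzero separant at the zero.\<close>
      have Sdiff: "\<bar>Sp t (\<lambda>k. fd k t + x k) - Sp t (\<lambda>k. fd k t)\<bar> \<le> \<bar>Sp t (\<lambda>k. fd k t)\<bar> / 4"
        if t: "t > T" and x: "\<And>k. k \<le> r \<Longrightarrow> \<bar>x k\<bar> \<le> dw t" for t x
      proof -
        have dp: "dw t > 0" using T[of t] t by simp
        have "\<bar>Sp t (\<lambda>k. fd k t + x k) - Sp t (\<lambda>k. fd k t)\<bar> \<le> lip t * dw t"
          by (rule Slip[OF t]) (use nearM[OF t] x fM dp in \<open>auto simp: less_Suc_eq_le\<close>)
        also have "\<dots> = \<bar>Sp t (\<lambda>k. fd k t)\<bar> * (lip t * dw t / \<bar>Sp t (\<lambda>k. fd k t)\<bar>)"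
          using Sf0(3)[OF t] by simp
        also have "\<dots> \<le> \<bar>Sp t (\<lambda>k. fd k t)\<bar> * (1 / 4)"
        proof (rule mult_left_mono)
          have "dw t / (4 * \<rho> t) \<le> 1 / 4" using T[of t] t by (simp add: divide_simps)
          then show "lip t * dw t / \<bar>Sp t (\<lambda>k. fd k t)\<bar> \<le> 1 / 4" by (rule order_trans[OF lipS[OF t less_imp_le[OF dp]]])
        qed simp
        finally show ?thesis by simp
      qed
      obtain z where z: "\<And>k t. k \<le> r \<Longrightarrow> t > T \<Longrightarrow> \<bar>z k t\<bar> \<le> dw t"
        "\<And>k t. k < r \<Longrightarrow> t > T \<Longrightarrow> (z k has_real_derivative z (Suc k) t) (at t)"
        "continuous_on {T<..} (z r)" "\<And>t. t \<ge> T + 1 \<Longrightarrow> z r t = F t (\<lambda>k. z k t)"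
      proof (rule W.contraction_from_infinity[of F r "T + 1"])
        show "\<bar>F t (\<lambda>_. 0)\<bar> \<le> dw t / 2" if t: "t > T" for t
        proof -
          have "\<bar>F t (\<lambda>_. 0)\<bar> = \<bar>P t (\<lambda>k. fd k t)\<bar> / \<bar>Sp t (\<lambda>k. fd k t)\<bar>" by (simp add: F_def abs_divide)
          also have "\<dots> \<le> (n t * \<phi> t) / (n t * \<psi>2 t)"
            using T[of t] t Sf0[OF t] by (intro frac_le) auto
          also have "\<dots> = \<phi> t / \<psi>2 t"
          proof -
            have "n t > 0" using T[OF less_imp_le[OF t]] by blast
            then show ?thesis by simp
          qed
          also have "\<dots> \<le> \<omega> t / 2"
          proof -
            have "\<phi> t \<le> \<psi>2 t * \<omega> t / 2" "\<psi>2 t > 0" using T[OF less_imp_le[OF t]] by blast+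
            then show ?thesis by (simp add: pos_divide_le_eq mult_ac)
          qed
          also have "\<dots> \<le> dw t / 2" using T[of t] t by simp
          finally show ?thesis .
        qed
        show "\<bar>F t x - F t x'\<bar> \<le> c / 2 * dw t"
          if t: "t > T" and c: "c \<ge> 0" and x: "\<And>k. k \<le> r \<Longrightarrow> \<bar>x k\<bar> \<le> dw t \<and> \<bar>x' k\<bar> \<le> dw t"
            and xd: "\<And>k. k < r \<Longrightarrow> \<bar>x k - x' k\<bar> \<le> c * \<omega> t" and xr: "\<bar>x r - x' r\<bar> \<le> c * dw t" for t x x' c
        proof -
          have tp: "\<omega> t > 0" "dw t > 0" "\<rho> t > 0" "\<omega> t = \<rho> t * dw t" using T[of t] t by simp_all
          let ?S = "Sp t (\<lambda>k. fd k t)"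
          \<comment> \<open>The passage from x to x' is split. Changing the lower variables first
            costs lip * c * \<omega> / |Sp|, at most c * dw / 4 because \<omega> = \<rho> * dw; then
            x r moves alone, where Newton's map has derivative at most 1/4. Together this is c * dw
            / 2.\<close>
          define v where "v = (\<lambda>u k. fd k t + (x'(r := u)) k)"
          have vb: "\<bar>(x'(r := u)) k\<bar> \<le> dw t" if "k \<le> r" "\<bar>u\<bar> \<le> dw t" for u k using x[OF that(1)] that by auto
          have 1: "\<bar>P t (\<lambda>k. fd k t + x k) - P t (v (x r))\<bar> \<le> lip t * (c * \<omega> t)"
          proof (rule Plip[OF t])
            show "\<bar>fd k t + x k\<bar> \<le> m t" if "k \<le> r" for k using nearM[OF t that] x[OF that] by blast
            show "\<bar>v (x r) k\<bar> \<le> m t" if "k \<le> r" for k unfolding v_def using nearM[OF t that vb[OF that]] x[of r] by blast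
            show "\<bar>fd k t + x k - v (x r) k\<bar> \<le> c * \<omega> t" if "k \<le> r" for k
              using xd[of k] that c tp by (cases "k = r") (auto simp: v_def)
            show "0 \<le> c * \<omega> t" using c tp by simp
          qed
          define h where "h = (\<lambda>u. u - P t (v u) / ?S)"
          have hd: "(h has_real_derivative 1 - Sp t (v u) / ?S) (at u within cball 0 (dw t))" for u
          proof -
            \<comment> \<open>The coefficients do not depend on x r, so along this line P is a
              polynomial in u, with derivative Sp.\<close>
            have pc: "p i t (v s) = p i t (v 0)" if "i \<le> Suc d" for i s
              by (rule estimate_cong[OF estimate_polys[OF np[OF that]]]) (auto simp: v_def)
            have "((\<lambda>u. P t (v u)) has_real_derivative Sp t (v u)) (at u)"
            proof -
              have eq: "(\<lambda>u. P t (v u)) = (\<lambda>u. \<Sum>i\<le>Suc d. p i t (v 0) * (fd r t + u) ^ i)"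
              proof
                fix u
                show "P t (v u) = (\<Sum>i\<le>Suc d. p i t (v 0) * (fd r t + u) ^ i)"
                  unfolding P by (intro sum.cong refl arg_cong2[where f = "(*)"] pc) (auto simp: v_def)
              qed
              have "((\<lambda>u. \<Sum>i\<le>Suc d. p i t (v 0) * (fd r t + u) ^ i) has_real_derivative
                (\<Sum>i\<le>Suc d. p i t (v 0) * (real i * (fd r t + u) ^ (i - 1)))) (at u)"
                by (intro DERIV_sum DERIV_cmult) (auto intro!: derivative_eq_intros)
              moreover have "(\<Sum>i\<le>Suc d. p i t (v 0) * (real i * (fd r t + u) ^ (i - 1))) = Sp t (v u)"
                unfolding Sp_def sum.atMost_Suc_shift[of _ d]
                using pc[of "Suc _" u] by (auto intro!: sum.cong simp: v_def)
              ultimately show ?thesis unfolding eq by simp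
            qed
            from DERIV_diff[OF DERIV_ident DERIV_cdivide[OF this, of ?S]]
            show ?thesis unfolding h_def by (rule has_field_derivative_at_within)
          qed
          have 2: "norm (h (x r) - h (x' r)) \<le> (1 / 4) * norm (x r - x' r)"
          proof (rule field_differentiable_bound[OF convex_cball hd])
            fix u :: real assume "u \<in> cball 0 (dw t)"
            then have u: "\<bar>u\<bar> \<le> dw t" by simp
            have "\<bar>Sp t (v u) - ?S\<bar> \<le> \<bar>?S\<bar> / 4"
              unfolding v_def by (rule Sdiff[OF t]) (use vb u in auto)
            then have "\<bar>(?S - Sp t (v u)) / ?S\<bar> \<le> 1 / 4"
              using Sf0(3)[OF t] by (simp add: abs_divide pos_divide_le_eq abs_minus_commute)
            also have "(?S - Sp t (v u)) / ?S = 1 - Sp t (v u) / ?S" using Sf0(3)[OF t] by (simp add: diff_divide_distrib)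
            finally show "norm (1 - Sp t (v u) / ?S) \<le> 1 / 4" by simp
          qed (use x[of r] in auto)
          have v': "v (x' r) = (\<lambda>k. fd k t + x' k)" by (auto simp: v_def)
          have "F t x - F t x' = (h (x r) - h (x' r)) - (P t (\<lambda>k. fd k t + x k) - P t (v (x r))) / ?S"
            unfolding F_def h_def v' by (simp add: diff_divide_distrib)
          then have "\<bar>F t x - F t x'\<bar> \<le> \<bar>h (x r) - h (x' r)\<bar> + \<bar>(P t (\<lambda>k. fd k t + x k) - P t (v (x r))) / ?S\<bar>"
            using abs_triangle_ineq4 by (simp only:)
          moreover have "\<bar>(P t (\<lambda>k. fd k t + x k) - P t (v (x r))) / ?S\<bar> \<le> lip t * (c * \<omega> t) / \<bar>?S\<bar>"
            unfolding abs_divide using 1 by (rule divide_right_mono) simp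
          moreover have "lip t * (c * \<omega> t) / \<bar>?S\<bar> \<le> (1 / 4) * (c * dw t)"
          proof -
            have "lip t * (c * \<omega> t) / \<bar>?S\<bar> \<le> (c * \<omega> t) / (4 * \<rho> t)"
              by (rule lipS[OF t]) (use c tp in simp)
            also have "(c * \<omega> t) / (4 * \<rho> t) = (1 / 4) * (c * dw t)" using tp(3) unfolding tp(4) by simp
            finally show ?thesis .
          qed
          moreover have "\<bar>h (x r) - h (x' r)\<bar> \<le> (1 / 4) * (c * dw t)"
            using 2 xr by simp
          ultimately show ?thesis by linarith
        qed
        show "continuous_on {T<..} (\<lambda>t. F t (\<lambda>k. x k t))" if x: "\<And>k. k \<le> r \<Longrightarrow> continuous_on {T<..} (x k)" for x
        proof -
          have "\<forall>k<Suc r. continuous_on {T<..} ((\<lambda>k t. fd k t + x k t) k)"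
            using fcont x by (auto intro!: continuous_intros)
          with T0[OF T0T, THEN conjunct1, THEN spec, of "\<lambda>k t. fd k t + x k t"]
          have "continuous_on {T<..} (\<lambda>t. P t (\<lambda>k. fd k t + x k t))" by simp
          moreover have "continuous_on {T<..} (\<lambda>t. Sp t (\<lambda>k. fd k t))"
            using T0[OF T0T, THEN conjunct2, THEN spec, of fd] fcont by simp
          moreover have "continuous_on {T<..} (x r)" using x by simp
          ultimately show ?thesis unfolding F_def
            using Sf0(3) by (intro continuous_on_diff continuous_on_divide) simp_all
        qed
      qed (simp, rule that, assumption+)
      define y where "y = (\<lambda>k t. fd k t + z k t)"
      have yd: "(y k has_real_derivative y (Suc k) t) (at t)" if "k < r" "t > T" for k t
        unfolding y_def using T[of t] that z(2)[OF that] by (intro DERIV_add) auto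
      have ynear: "\<bar>y k t - fd k t\<bar> \<le> dw t" if "k \<le> r" "t > T" for k t
        using z(1)[OF that] by (simp add: y_def)
      have yc: "isCont (y r) t" if "t > T" for t
      proof -
        have "continuous_on {T<..} (y r)" unfolding y_def using fcont[of r] z(3) by (intro continuous_intros) auto
        then show ?thesis using that by (simp add: continuous_on_eq_continuous_at)
      qed
      have zeroP: "P t (\<lambda>k. y k t) = 0" if "t \<ge> T + 1" for t
        using z(4)[OF that] Sf0(3)[of t] that by (simp add: F_def y_def)
      have sepy: "Sp t (\<lambda>k. y k t) \<noteq> 0" if "t > T" for t
        using Sdiff[OF that, of "\<lambda>k. z k t"] z(1)[OF _ that] Sf0[OF that] by (auto simp: y_def)
      have nearev: "eventually (\<lambda>t. \<forall>k\<le>r. \<bar>y k t - fd k t\<bar> \<le> dw t) at_top"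
        using eventually_gt_at_top[of T] by eventually_elim (use ynear in auto)
      have dwN: "eventually (\<lambda>t. dw t \<le> 1 \<and> 2 * (real (E N') * M r t ^ E N') * dw t \<le> \<Phi> N' t \<and> dw t \<ge> 0) at_top" for N'
        using basic \<omega>\<tau>[of N'] K.gauge_pos[OF \<Phi>g[of N']]
      proof eventually_elim
        case (elim t)
        have "\<rho> t * dw t \<le> \<rho> t * (\<Phi> N' t * cw r (2 * E N') (E N') t)" using elim by simp
        then have d: "dw t \<le> \<Phi> N' t * cw r (2 * E N') (E N') t" using elim by (simp only: mult_le_cancel_left_pos)
        have mp: "M r t ^ E N' \<ge> 1" by (rule M_power_ge)
        have "2 * (real (E N') * M r t ^ E N') * dw t \<le> (real (Suc (2 * E N')) * M r t ^ E N') * dw t"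
          using elim mp by (intro mult_right_mono) (auto simp: algebra_simps)
        also have "\<dots> \<le> (real (Suc (2 * E N')) * M r t ^ E N') * (\<Phi> N' t * cw r (2 * E N') (E N') t)"
          using d mp by (intro mult_left_mono) auto
        also have "\<dots> = \<Phi> N' t" by (subst mult.commute) (rule cw_cancel)
        finally show ?case using elim by auto
      qed
      \<comment> \<open>The zero test required by \<open>algebraic_extension\<close>: near infinity
        a polynomial of degree at most d in x r vanishes at y only if its coefficients do, whatever
        its degree in the lower variables.\<close>
      have zo: "eventually (\<lambda>t. n' t = 0 \<and> q t (\<lambda>k. y k t) = 0) at_top \<or> eventually (\<lambda>t. q t (\<lambda>k. y k t) \<noteq> 0) at_top"
        if q: "(n', q) \<in> layer d r (polys S N' r)" for n' q N'
      proof -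
        have "estimate (E N') (Suc r) (n', q)" using estimate_layer_polys[OF q] by (simp add: E_def)
        from near_zero_or[OF this layer_norm_mem[OF q] lowerD[OF \<Phi> q] K.gauge_pos[OF \<Phi>g] dwN nearev]
        show ?thesis .
      qed
      have "y 0 \<in> S"
      proof (rule algebraic_extension[where r = r and d = d and p = p])
        show "eventually (\<lambda>t. (y k has_real_derivative y (Suc k) t) (at t)) at_top" if "k < r" for k
          using eventually_gt_at_top[of T] by eventually_elim (rule yd[OF that])
        show "eventually (\<lambda>t. isCont (y r) t) at_top"
          using eventually_gt_at_top[of T] by eventually_elim (rule yc)
        show "p i \<in> pfun S r" if "i \<le> Suc d" for i using np[OF that] by (auto simp: pfun_def)
        show "eventually (\<lambda>t. (\<Sum>i\<le>Suc d. p i t (\<lambda>k. y k t) * y r t ^ i) = 0) at_top"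
          using eventually_ge_at_top[of "T + 1"] by eventually_elim (use zeroP in \<open>simp add: P\<close>)
        show "eventually (\<lambda>t. (\<Sum>i\<le>Suc d. real i * p i t (\<lambda>k. y k t) * y r t ^ (i - 1)) \<noteq> 0) at_top"
          using eventually_gt_at_top[of T]
        proof eventually_elim
          case (elim t)
          have "(\<Sum>i\<le>Suc d. real i * p i t (\<lambda>k. y k t) * y r t ^ (i - 1)) = Sp t (\<lambda>k. y k t)"
            unfolding Sp_def sum.atMost_Suc_shift[of _ d] by simp
          then show ?case using sepy[OF elim] by simp
        qed
        show "eventually (\<lambda>t. p (Suc d) t (\<lambda>k. y k t) \<noteq> 0) at_top"
          using zo[OF layer_0_embed[OF np[OF order_refl]]]
        proof
          assume "eventually (\<lambda>t. ni (Suc d) t = 0 \<and> p (Suc d) t (\<lambda>k. y k t) = 0) at_top"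
          with L have "eventually (\<lambda>t::real. False) at_top" by eventually_elim simp
          then show ?thesis by simp
        qed simp_all
        show "eventually (\<lambda>t. (\<Sum>i\<le>d. c i t (\<lambda>k. y k t) * y r t ^ i) = 0) at_top \<or>
          eventually (\<lambda>t. (\<Sum>i\<le>d. c i t (\<lambda>k. y k t) * y r t ^ i) \<noteq> 0) at_top"
          if c: "\<And>i. i \<le> d \<Longrightarrow> c i \<in> pfun S r" for c
        proof -
          obtain N' n' where "(n', (\<lambda>t x. \<Sum>i\<le>d. c i t x * x r ^ i)) \<in> layer d r (polys S N' r)"
            using layer_pfun[of d c r] c by blast
          from zo[OF this] show ?thesis by (auto elim: eventually_mono)
        qed
      qed simp
      from gap[OF this] have "\<not> eventually (\<lambda>t. \<bar>f t - y 0 t\<bar> < \<epsilon> t) at_top" .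
      moreover have "eventually (\<lambda>t. \<bar>f t - y 0 t\<bar> < \<epsilon> t) at_top"
        using eventually_gt_at_top[of T]
      proof eventually_elim
        case (elim t)
        have "\<bar>f t - y 0 t\<bar> \<le> dw t" using ynear[of 0 t] elim by (simp add: abs_minus_commute)
        also have "dw t < \<epsilon> t" using T[of t] elim by simp
        finally show ?case .
      qed
      ultimately show False by blast
    qed
    show ?thesis
      using zero_or[OF nS]
    proof
      assume "eventually (\<lambda>t. n t = 0) at_top"
      then show ?thesis by eventually_elim simp
    next
      assume "eventually (\<lambda>t. n t \<noteq> 0) at_top"
      then have npos: "eventually (\<lambda>t. n t > 0) at_top"
        by eventually_elim (use estimateD(1)[OF Pest] in \<open>auto simp: order_less_le\<close>)
      have uK: "(\<lambda>t. \<bar>P t (\<lambda>k. fd k t)\<bar> / n t) \<in> K" using PK nS SK by (intro K.divide K.abs) auto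
      \<comment> \<open>Comparability of \<phi> with K turns failure of the lower bound into a
        strict upper bound for all large t, even when \<phi> lies outside K.\<close>
      show ?thesis using K.gauge_less_or_ge[OF \<phi>(1) uK]
      proof
        assume "eventually (\<lambda>t. \<phi> t \<le> \<bar>P t (\<lambda>k. fd k t)\<bar> / n t) at_top"
        then show ?thesis using npos by eventually_elim (simp add: pos_le_divide_eq mult.commute)
      next
        assume "eventually (\<lambda>t. \<bar>P t (\<lambda>k. fd k t)\<bar> / n t < \<phi> t) at_top"
        then have small: "eventually (\<lambda>t. \<bar>P t (\<lambda>k. fd k t)\<bar> < n t * \<phi> t) at_top"
          using npos by eventually_elim (simp add: pos_divide_less_eq mult.commute)
        \<comment> \<open>Comparing \<psi> with the quotient \<eta> / \<open>ni 0\<close> gives the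
          dichotomy; where \<open>ni 0\<close> vanishes the second alternative is trivial.\<close>
        have "eventually (\<lambda>t. \<eta> t \<le> ni 0 t * \<psi> t) at_top \<or> eventually (\<lambda>t. ni 0 t * \<psi> t \<le> \<eta> t) at_top"
          using zero_or[OF n0S[OF le0]]
        proof
          assume "eventually (\<lambda>t. ni 0 t = 0) at_top"
          then have "eventually (\<lambda>t. ni 0 t * \<psi> t \<le> \<eta> t) at_top" by eventually_elim (use \<eta>0 in simp)
          then show ?thesis ..
        next
          assume "eventually (\<lambda>t. ni 0 t \<noteq> 0) at_top"
          then have pos0: "eventually (\<lambda>t. ni 0 t > 0) at_top"
            by eventually_elim (use ni0[of 0] in \<open>auto simp: order_less_le\<close>)
          have "(\<lambda>t. \<eta> t / ni 0 t) \<in> K" using \<eta>S n0S[OF le0] SK by (intro K.divide) auto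
          from K.gauge_less_or_ge[OF \<psi>(1) this] show ?thesis
          proof
            assume "eventually (\<lambda>t. \<eta> t / ni 0 t < \<psi> t) at_top"
            then have "eventually (\<lambda>t. \<eta> t \<le> ni 0 t * \<psi> t) at_top"
              using pos0 by eventually_elim (simp add: pos_divide_less_eq mult.commute)
            then show ?thesis ..
          next
            assume "eventually (\<lambda>t. \<psi> t \<le> \<eta> t / ni 0 t) at_top"
            then have "eventually (\<lambda>t. ni 0 t * \<psi> t \<le> \<eta> t) at_top"
              using pos0 by eventually_elim (simp add: pos_le_divide_eq mult.commute)
            then show ?thesis ..
          qed
        qed
        then show ?thesis
        proof
          assume B: "eventually (\<lambda>t. ni 0 t * \<psi> t \<le> \<eta> t) at_top"
          from zero_or[OF n0S[OF order_refl]] show ?thesis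
            using caseL caseB[OF B npos small] by auto
        qed (rule caseA)
      qed
    qed
  qed
  with \<phi>(1) show ?thesis unfolding lower_def by auto
qed

text \<open>Outer induction on the number of variables, inner induction on the degree in the last
  one, for all N simultaneously; \<open>polys S N (Suc r)\<close> is the layer with d = N.\<close>

lemma lower_bounds: "\<exists>\<phi>. lower \<phi> (polys S N r)"
proof (induction r arbitrary: N)
  case 0
  have "lower (\<lambda>_. 1) (polys S N 0)" using gauge_one by (auto simp: lower_def)
  then show ?case by blast
next
  case (Suc r)
  have "\<forall>N. \<exists>\<phi>. lower \<phi> (layer d r (polys S N r))" for d
  proof (induction d)
    case 0
    have "layer 0 r (polys S N r) \<subseteq> polys S N r" for N by (auto simp: layer_def)
    then show ?case using Suc.IH unfolding lower_def by (meson subsetD)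
  next
    case (Suc d)
    then show ?case using lower_step by blast
  qed
  then show ?case by simp
qed

end

thm_deps hardy_gap.lower_bounds

section \<open>Gaussian smoothing\<close>

text \<open>The continuation of the normal density with standard deviation \<sigma> to complex
  centres z; it is entire in z.\<close>

definition gauss_kernel :: "real \<Rightarrow> complex \<Rightarrow> real \<Rightarrow> complex" where
  "gauss_kernel \<sigma> z s = of_real (1 / sqrt (2 * pi * \<sigma>\<^sup>2)) * exp (- (z - of_real s)\<^sup>2 / of_real (2 * \<sigma>\<^sup>2))"

text \<open>Integration over a compact interval permits differentiation under the integral sign. For
  h supported in the interval this is convolution with the Gaussian.\<close>

definition smoothing :: "real \<Rightarrow> real \<Rightarrow> real \<Rightarrow> (real \<Rightarrow> real) \<Rightarrow> complex \<Rightarrow> complex" where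
  "smoothing \<sigma> b c h z = integral {b..c} (\<lambda>s. of_real (h s) * gauss_kernel \<sigma> z s)"

lemma gauss_kernel_of_real: "gauss_kernel \<sigma> (of_real t) s = of_real (normal_density t \<sigma> s)"
proof -
  have "- (complex_of_real t - of_real s)\<^sup>2 / of_real (2 * \<sigma>\<^sup>2) = of_real (- (s - t)\<^sup>2 / (2 * \<sigma>\<^sup>2))"
    by (simp add: power2_commute)
  then show ?thesis unfolding gauss_kernel_def normal_density_def
    by (simp only: exp_of_real of_real_mult)
qed

lemma gauss_kernel_continuous [continuous_intros]:
  assumes "continuous_on A f" "continuous_on A g"
  shows "continuous_on A (\<lambda>x. gauss_kernel \<sigma> (f x) (g x))"
  unfolding gauss_kernel_def divide_inverse using assms by (intro continuous_intros)

lemma gauss_kernel_deriv_left: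
  assumes "\<sigma> > 0"
  shows "((\<lambda>z. gauss_kernel \<sigma> z s) has_field_derivative
    gauss_kernel \<sigma> z s * (- (z - of_real s) / of_real (\<sigma>\<^sup>2))) (at z within A)"
  unfolding gauss_kernel_def using assms
  by (auto intro!: derivative_eq_intros simp: field_simps)

lemma gauss_kernel_deriv_right:
  assumes "\<sigma> > 0"
  shows "((\<lambda>s. gauss_kernel \<sigma> z s) has_vector_derivative
    - (gauss_kernel \<sigma> z s * (- (z - of_real s) / of_real (\<sigma>\<^sup>2)))) (at s within A)"
proof -
  have "((\<lambda>w. of_real (1 / sqrt (2 * pi * \<sigma>\<^sup>2)) * exp (- (z - w)\<^sup>2 / of_real (2 * \<sigma>\<^sup>2))) has_field_derivative
    - (gauss_kernel \<sigma> z s * (- (z - of_real s) / of_real (\<sigma>\<^sup>2)))) (at (of_real s))"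
    unfolding gauss_kernel_def using assms
    by (auto intro!: derivative_eq_intros simp: field_simps)
  from has_vector_derivative_real_field[OF this] show ?thesis
    unfolding gauss_kernel_def by (rule has_vector_derivative_at_within)
qed

text \<open>The kernel depends on z - s only, so its z-derivative is minus its s-derivative.
  Integration by parts moves it to h, and the boundary terms vanish with h.\<close>

lemma smoothing_deriv:
  assumes \<sigma>: "\<sigma> > 0" and bc: "b < c" and h: "\<And>s. s \<in> {b..c} \<Longrightarrow> (h has_real_derivative h' s) (at s)"
    and h': "continuous_on {b..c} h'" and ends: "h b = 0" "h c = 0"
  shows "(smoothing \<sigma> b c h has_field_derivative smoothing \<sigma> b c h' z) (at z)"
proof -
  define k' where "k' = (\<lambda>z s. gauss_kernel \<sigma> z s * (- (z - of_real s) / of_real (\<sigma>\<^sup>2)))"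
  have hc: "continuous_on {b..c} h"
    by (intro continuous_at_imp_continuous_on ballI) (rule DERIV_isCont[OF h])
  have hcc: "continuous_on (UNIV \<times> {b..c}) (\<lambda>(z::complex, s). complex_of_real (h s))"
    unfolding split_beta by (intro continuous_intros continuous_on_compose2[OF hc]) auto
  have D: "(smoothing \<sigma> b c h has_field_derivative integral {b..c} (\<lambda>s. of_real (h s) * k' z s)) (at z)"
    unfolding smoothing_def box_real(2)[symmetric]
  proof (rule leibniz_rule_field_derivative[where U = UNIV])
    show "((\<lambda>z. of_real (h s) * gauss_kernel \<sigma> z s) has_field_derivative of_real (h s) * k' z s) (at z within UNIV)" for z s
      unfolding k'_def by (rule DERIV_cmult[OF gauss_kernel_deriv_left[OF \<sigma>]])
    show "(\<lambda>s. of_real (h s) * gauss_kernel \<sigma> z s) integrable_on cbox b c" for z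
      unfolding box_real by (intro integrable_continuous_real continuous_intros hc)
    show "continuous_on (UNIV \<times> cbox b c) (\<lambda>(z, s). of_real (h s) * k' z s)"
      unfolding split_beta k'_def box_real divide_inverse
      by (intro continuous_intros continuous_on_compose2[OF hc]) auto
  qed auto
  have "((\<lambda>s. of_real (h s) * gauss_kernel \<sigma> z s) has_vector_derivative
      of_real (h s) * (- k' z s) + of_real (h' s) * gauss_kernel \<sigma> z s) (at s within {b..c})" if "s \<in> {b..c}" for s
  proof (rule has_vector_derivative_mult)
    show "((\<lambda>s. complex_of_real (h s)) has_vector_derivative of_real (h' s)) (at s within {b..c})"
      using h[OF that] by (intro has_vector_derivative_of_real has_vector_derivative_at_within)
        (simp add: has_real_derivative_iff_has_vector_derivative)
    show "((\<lambda>s. gauss_kernel \<sigma> z s) has_vector_derivative - k' z s) (at s within {b..c})"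
      unfolding k'_def by (rule gauss_kernel_deriv_right[OF \<sigma>])
  qed
  from fundamental_theorem_of_calculus[OF less_imp_le[OF bc] this]
  have "((\<lambda>s. of_real (h s) * (- k' z s) + of_real (h' s) * gauss_kernel \<sigma> z s) has_integral 0) {b..c}"
    by (simp add: ends)
  then have "integral {b..c} (\<lambda>s. of_real (h' s) * gauss_kernel \<sigma> z s - of_real (h s) * k' z s) = 0"
    by (simp add: integral_unique algebra_simps)
  also have "integral {b..c} (\<lambda>s. of_real (h' s) * gauss_kernel \<sigma> z s - of_real (h s) * k' z s) =
      smoothing \<sigma> b c h' z - integral {b..c} (\<lambda>s. of_real (h s) * k' z s)"
    unfolding smoothing_def k'_def divide_inverse
    by (intro integral_diff integrable_continuous_real continuous_intros hc h')
  finally show ?thesis using D by simp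
qed

lemma smoothing_of_real:
  assumes "continuous_on UNIV h" "\<And>s. s < b \<or> s > c \<Longrightarrow> h s = 0" "\<sigma> > 0"
  shows "smoothing \<sigma> b c h (of_real t) = of_real (LINT s|lborel. h s * normal_density t \<sigma> s)"
proof -
  have c: "continuous_on {b..c} (\<lambda>s. h s * normal_density t \<sigma> s)"
    unfolding normal_density_def divide_inverse using assms(1,3)
    by (intro continuous_intros continuous_on_subset[OF assms(1)]) auto
  have "smoothing \<sigma> b c h (of_real t) = integral {b..c} (\<lambda>s. of_real (h s * normal_density t \<sigma> s))"
    by (simp add: smoothing_def gauss_kernel_of_real)
  also have "\<dots> = of_real (integral {b..c} (\<lambda>s. h s * normal_density t \<sigma> s))"
    using has_integral_of_real[OF integrable_integral[OF integrable_continuous_real[OF c]]]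
    by (rule integral_unique)
  also have "integral {b..c} (\<lambda>s. h s * normal_density t \<sigma> s) = (LINT s:{b..c}|lborel. h s * normal_density t \<sigma> s)"
    by (rule set_borel_integral_eq_integral(2)[OF borel_integrable_atLeastAtMost'[OF c], symmetric])
  also have "\<dots> = (LINT s|lborel. h s * normal_density t \<sigma> s)"
    unfolding set_lebesgue_integral_def
  proof (intro Bochner_Integration.integral_cong refl)
    show "indicator {b..c} s *\<^sub>R (h s * normal_density t \<sigma> s) = h s * normal_density t \<sigma> s" for s
      by (cases "s < b \<or> s > c") (auto simp: assms(2) indicator_def)
  qed
  finally show ?thesis .
qed

text \<open>The quadratic modulus is integrated against the normal density: total mass 1 yields
  \<eta>, the variance yields B * \<sigma>^2.\<close>

lemma smoothing_error:
  assumes h: "continuous_on UNIV h" "\<And>s. s < b \<or> s > c \<Longrightarrow> h s = 0" and \<sigma>: "\<sigma> > 0"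
    and bd: "\<And>s t. \<bar>h s - h t\<bar> \<le> \<eta> + B * (s - t)\<^sup>2"
  shows "\<bar>Re (smoothing \<sigma> b c h (of_real t)) - h t\<bar> \<le> \<eta> + B * \<sigma>\<^sup>2"
proof -
  let ?n = "normal_density t \<sigma>"
  have m0: "has_bochner_integral lborel ?n 1"
    using normal_moment_even[OF \<sigma>, of t 0] by simp
  have m2: "has_bochner_integral lborel (\<lambda>s. ?n s * (s - t)\<^sup>2) (\<sigma>\<^sup>2)"
    using normal_moment_even[OF \<sigma>, of t 1] by (simp add: numeral_2_eq_2)
  have hm: "h \<in> borel_measurable borel" using h(1) by (rule borel_measurable_continuous_onI)
  have dom: "has_bochner_integral lborel (\<lambda>s. \<eta> * ?n s + B * (?n s * (s - t)\<^sup>2)) (\<eta> * 1 + B * \<sigma>\<^sup>2)"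
    by (intro has_bochner_integral_add has_bochner_integral_mult_right m0 m2)
  have pw: "\<bar>(h s - h t) * ?n s\<bar> \<le> \<eta> * ?n s + B * (?n s * (s - t)\<^sup>2)" for s
  proof -
    have "\<bar>(h s - h t) * ?n s\<bar> = \<bar>h s - h t\<bar> * ?n s" by (simp add: abs_mult)
    also have "\<dots> \<le> (\<eta> + B * (s - t)\<^sup>2) * ?n s" by (intro mult_right_mono bd) simp
    finally show ?thesis by (simp add: algebra_simps)
  qed
  have int: "integrable lborel (\<lambda>s. (h s - h t) * ?n s)"
  proof (rule Bochner_Integration.integrable_bound[OF integrable.intros[OF dom]])
    show "(\<lambda>s. (h s - h t) * ?n s) \<in> borel_measurable lborel" using hm by simp
    show "AE s in lborel. norm ((h s - h t) * ?n s) \<le> norm (\<eta> * ?n s + B * (?n s * (s - t)\<^sup>2))"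
      unfolding real_norm_def by (intro AE_I2 order_trans[OF pw abs_ge_self])
  qed
  have int1: "integrable lborel (\<lambda>s. h t * ?n s)"
    by (intro integrable_mult_right integrable.intros[OF m0])
  have "(LINT s|lborel. h s * ?n s) = (LINT s|lborel. (h s - h t) * ?n s + h t * ?n s)"
    by (simp add: algebra_simps)
  also have "\<dots> = (LINT s|lborel. (h s - h t) * ?n s) + h t"
    using Bochner_Integration.integral_add[OF int int1] has_bochner_integral_integral_eq[OF m0] by simp
  finally have "(LINT s|lborel. h s * ?n s) - h t = (LINT s|lborel. (h s - h t) * ?n s)"
    by linarith
  moreover have "Re (smoothing \<sigma> b c h (of_real t)) = (LINT s|lborel. h s * ?n s)"
    by (subst smoothing_of_real[OF h \<sigma>]) (simp_all only: Re_complex_of_real)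
  ultimately have "Re (smoothing \<sigma> b c h (of_real t)) - h t = (LINT s|lborel. (h s - h t) * ?n s)"
    by (simp only:)
  also have "\<bar>\<dots>\<bar> \<le> (LINT s|lborel. \<bar>(h s - h t) * ?n s\<bar>)" by (rule integral_abs_bound)
  also have "\<dots> \<le> (LINT s|lborel. \<eta> * ?n s + B * (?n s * (s - t)\<^sup>2))"
    by (rule integral_mono[OF integrable_abs[OF int] integrable.intros[OF dom] pw])
  also have "\<dots> = \<eta> * 1 + B * \<sigma>\<^sup>2" by (rule has_bochner_integral_integral_eq[OF dom])
  finally show ?thesis by simp
qed

text \<open>Nearby points are handled by uniform continuity. For |s - t| \<ge> d the trivial bound
  2U is at most (2U/d^2) (s - t)^2.\<close>

lemma modulus_quadratic:
  fixes h :: "real \<Rightarrow> real"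
  assumes h: "continuous_on UNIV h" "\<And>s. s < b \<or> s > c \<Longrightarrow> h s = 0" and \<eta>: "\<eta> > 0"
  obtains B where "B \<ge> 0" "\<And>s t. \<bar>h s - h t\<bar> \<le> \<eta> + B * (s - t)\<^sup>2"
proof -
  have hc: "continuous_on {b - 1..c + 1} h" using h(1) continuous_on_subset by blast
  then have "bounded (h ` {b - 1..c + 1})" by (intro compact_imp_bounded compact_continuous_image) auto
  then obtain U0 where "\<forall>x\<in>h ` {b - 1..c + 1}. norm x \<le> U0" unfolding bounded_iff by blast
  then have U0: "\<And>s. s \<in> {b - 1..c + 1} \<Longrightarrow> \<bar>h s\<bar> \<le> U0" by simp
  define U where "U = max 0 U0"
  have U: "\<bar>h s\<bar> \<le> U" for s using U0[of s] h(2)[of s] by (cases "s < b \<or> s > c") (auto simp: U_def)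
  have "uniformly_continuous_on {b - 1..c + 1} h"
    using compact_uniformly_continuous[OF hc] by simp
  then obtain d0 where d0: "d0 > 0" "\<And>s t. s \<in> {b - 1..c + 1} \<Longrightarrow> t \<in> {b - 1..c + 1} \<Longrightarrow> dist t s < d0 \<Longrightarrow> dist (h t) (h s) < \<eta>"
    using \<eta> unfolding uniformly_continuous_on_def by metis
  \<comment> \<open>With d \<le> 1, two points closer than d that do not both lie in [b - 1, c + 1]
    both lie outside the support.\<close>
  define d where "d = min d0 1"
  have d: "d > 0" "d \<le> d0" "d \<le> 1" using d0(1) by (auto simp: d_def)
  have near: "\<bar>h s - h t\<bar> \<le> \<eta>" if "\<bar>s - t\<bar> < d" for s t
  proof (cases "s \<in> {b - 1..c + 1} \<and> t \<in> {b - 1..c + 1}")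
    case True
    then show ?thesis using d0(2)[of t s] that d by (auto simp: dist_real_def)
  next
    case False
    then have "(s < b \<or> s > c) \<and> (t < b \<or> t > c)" using that d by auto
    then show ?thesis using h(2) \<eta> by simp
  qed
  have "\<bar>h s - h t\<bar> \<le> \<eta> + (2 * U / d\<^sup>2) * (s - t)\<^sup>2" for s t
  proof (cases "\<bar>s - t\<bar> < d")
    case True
    then show ?thesis using near[OF True] by (simp add: U_def add_increasing2)
  next
    case False
    then have "d\<^sup>2 \<le> (s - t)\<^sup>2" using d by (metis abs_le_square_iff abs_of_pos not_less)
    then have "(2 * U / d\<^sup>2) * d\<^sup>2 \<le> (2 * U / d\<^sup>2) * (s - t)\<^sup>2" by (intro mult_left_mono) (auto simp: U_def)
    moreover have "(2 * U / d\<^sup>2) * d\<^sup>2 = 2 * U" using d by simp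
    moreover have "\<bar>h s - h t\<bar> \<le> 2 * U" using U[of s] U[of t] by linarith
    ultimately show ?thesis using \<eta> by linarith
  qed
  moreover have "2 * U / d\<^sup>2 \<ge> 0" by (simp add: U_def)
  ultimately show ?thesis by (rule that[rotated])
qed

text \<open>For |z| \<le> b/4 and s \<ge> b the real part of (z - s)^2 is at least (3b/4)^2 -
  (b/4)^2 = b^2/2. The Gaussian is then small, and the crude bound exp (- x) \<le> 1/x already beats
  the factor 1/\<sigma> and leaves a factor \<sigma>.\<close>

lemma smoothing_small:
  assumes h: "continuous_on {b..c} h" "\<And>s. s \<in> {b..c} \<Longrightarrow> \<bar>h s\<bar> \<le> U" and bc: "0 < b" "b < c" and \<sigma>: "\<sigma> > 0"
    and z: "cmod z \<le> b / 4"
  shows "cmod (smoothing \<sigma> b c h z) \<le> U * (c - b) * (4 / b\<^sup>2) * \<sigma>"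
proof -
  have U: "U \<ge> 0" using h(2)[of b] bc by force
  have ker: "cmod (gauss_kernel \<sigma> z s) \<le> (4 / b\<^sup>2) * \<sigma>" if "s \<in> {b..c}" for s
  proof -
    define x where "x = Re z" define y where "y = Im z"
    have xy: "\<bar>x\<bar> \<le> b / 4" "\<bar>y\<bar> \<le> b / 4" using z abs_Re_le_cmod[of z] abs_Im_le_cmod[of z] by (auto simp: x_def y_def)
    have "(3 * b / 4)\<^sup>2 \<le> (s - x)\<^sup>2" using xy that bc by (intro power_mono) auto
    moreover have "y\<^sup>2 \<le> (b / 4)\<^sup>2" using xy(2) bc by (metis abs_le_square_iff abs_of_pos zero_less_divide_iff zero_less_numeral)
    ultimately have re: "(s - x)\<^sup>2 - y\<^sup>2 \<ge> b\<^sup>2 / 2" by (simp add: power2_eq_square field_simps)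
    have "Re (- (z - of_real s)\<^sup>2 / of_real (2 * \<sigma>\<^sup>2)) = - ((s - x)\<^sup>2 - y\<^sup>2) / (2 * \<sigma>\<^sup>2)"
      by (simp only: Re_divide_of_real) (simp add: x_def y_def power2_eq_square algebra_simps)
    also have "\<dots> \<le> - (b\<^sup>2 / (4 * \<sigma>\<^sup>2))"
    proof -
      have "(b\<^sup>2 / 2) / (2 * \<sigma>\<^sup>2) \<le> ((s - x)\<^sup>2 - y\<^sup>2) / (2 * \<sigma>\<^sup>2)" using re by (intro divide_right_mono) auto
      moreover have "- ((s - x)\<^sup>2 - y\<^sup>2) / (2 * \<sigma>\<^sup>2) = - (((s - x)\<^sup>2 - y\<^sup>2) / (2 * \<sigma>\<^sup>2))"
        by (rule minus_divide_left[symmetric])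
      moreover have "(b\<^sup>2 / 2) / (2 * \<sigma>\<^sup>2) = b\<^sup>2 / (4 * \<sigma>\<^sup>2)" by simp
      ultimately show ?thesis by linarith
    qed
    finally have e: "exp (Re (- (z - of_real s)\<^sup>2 / of_real (2 * \<sigma>\<^sup>2))) \<le> exp (- (b\<^sup>2 / (4 * \<sigma>\<^sup>2)))" by simp
    have p: "b\<^sup>2 / (4 * \<sigma>\<^sup>2) > 0" using bc \<sigma> by simp
    have "exp (- (b\<^sup>2 / (4 * \<sigma>\<^sup>2))) \<le> 1 / (b\<^sup>2 / (4 * \<sigma>\<^sup>2))"
    proof -
      have "b\<^sup>2 / (4 * \<sigma>\<^sup>2) \<le> exp (b\<^sup>2 / (4 * \<sigma>\<^sup>2))" using exp_ge_add_one_self[of "b\<^sup>2 / (4 * \<sigma>\<^sup>2)"] by linarith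
      then have "1 / exp (b\<^sup>2 / (4 * \<sigma>\<^sup>2)) \<le> 1 / (b\<^sup>2 / (4 * \<sigma>\<^sup>2))" using p by (intro divide_left_mono mult_pos_pos exp_gt_zero) auto
      then show ?thesis by (simp add: exp_minus inverse_eq_divide)
    qed
    also have "\<dots> = 4 * \<sigma>\<^sup>2 / b\<^sup>2" by simp
    finally have e2: "exp (- (b\<^sup>2 / (4 * \<sigma>\<^sup>2))) \<le> 4 * \<sigma>\<^sup>2 / b\<^sup>2" .
    have s1: "1 / sqrt (2 * pi * \<sigma>\<^sup>2) \<le> 1 / \<sigma>"
    proof -
      have "\<sigma> = sqrt (1 * \<sigma>\<^sup>2)" using \<sigma> by simp
      also have "\<dots> \<le> sqrt (2 * pi * \<sigma>\<^sup>2)" using pi_gt3 by (intro real_sqrt_le_mono mult_right_mono) auto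
      finally show ?thesis using \<sigma> by (intro divide_left_mono) auto
    qed
    have "cmod (gauss_kernel \<sigma> z s) = (1 / sqrt (2 * pi * \<sigma>\<^sup>2)) * exp (Re (- (z - of_real s)\<^sup>2 / of_real (2 * \<sigma>\<^sup>2)))"
      unfolding gauss_kernel_def norm_mult norm_exp_eq_Re norm_of_real by simp
    also have "\<dots> \<le> (1 / \<sigma>) * (4 * \<sigma>\<^sup>2 / b\<^sup>2)"
      using \<sigma> by (intro mult_mono s1 order_trans[OF e e2]) simp_all
    also have "\<dots> = (4 / b\<^sup>2) * \<sigma>" using \<sigma> by (simp add: power2_eq_square)
    finally show ?thesis .
  qed
  have "cmod (smoothing \<sigma> b c h z) \<le> (U * ((4 / b\<^sup>2) * \<sigma>)) * (c - b)"
    unfolding smoothing_def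
  proof (rule integral_bound)
    show "continuous_on {b..c} (\<lambda>s. of_real (h s) * gauss_kernel \<sigma> z s)" by (intro continuous_intros h(1))
    show "cmod (of_real (h s) * gauss_kernel \<sigma> z s) \<le> U * ((4 / b\<^sup>2) * \<sigma>)" if "s \<in> {b..c}" for s
      unfolding norm_mult norm_of_real using h(2)[OF that] ker[OF that] U by (intro mult_mono) auto
  qed (use bc in auto)
  then show ?thesis by (simp add: mult_ac)
qed

text \<open>Smoothing commutes with differentiation, so a single small \<sigma> serves all
  derivatives up to order n on the line and the smallness on the disc. The extra order in the
  hypothesis makes the n-th derivative continuous.\<close>

lemma entire_approximation:
  fixes u :: "real \<Rightarrow> real"
  assumes u: "kdiff (Suc n) u UNIV" and bc: "0 < b" "b < c"
    and supp: "\<And>t. t < b1 \<or> t > c1 \<Longrightarrow> u t = 0" "b < b1" "c1 < c" and \<eta>: "\<eta> > 0"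
  obtains G :: "complex \<Rightarrow> complex" and g :: "real \<Rightarrow> real"
  where "G holomorphic_on UNIV" "\<And>t. G (of_real t) = of_real (g t)"
    "\<And>z. cmod z \<le> b / 4 \<Longrightarrow> cmod (G z) \<le> \<eta>"
    "\<And>k t. k \<le> n \<Longrightarrow> \<bar>(deriv ^^ k) g t - (deriv ^^ k) u t\<bar> \<le> \<eta>"
proof -
  define h where "h = (\<lambda>k. (deriv ^^ k) u)"
  have supp': "h k t = 0" if "t \<le> b \<or> t \<ge> c" for k t
  proof -
    have "h k t = (deriv ^^ k) (\<lambda>_. 0) t" unfolding h_def
      by (rule deriv_funpow_cong[of "{..<b1} \<union> {c1<..}"]) (use supp that in auto)
    then show ?thesis by (simp add: deriv_funpow_const)
  qed
  have hc: "continuous_on UNIV (h k)" if "k \<le> n" for k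
    unfolding h_def using kdiff_continuous_on[OF u] that by simp
  have hd: "(h k has_real_derivative h (Suc k) t) (at t)" if "k \<le> n" for k t
    unfolding h_def using kdiff_deriv_funpow[OF u, of k t] that by simp
  have "\<exists>B. B \<ge> 0 \<and> (\<forall>s t. \<bar>h k s - h k t\<bar> \<le> \<eta> / 2 + B * (s - t)\<^sup>2)" if "k \<le> n" for k
  proof -
    obtain B where "B \<ge> 0" "\<And>s t. \<bar>h k s - h k t\<bar> \<le> \<eta> / 2 + B * (s - t)\<^sup>2"
      by (rule modulus_quadratic[of "h k" b c "\<eta> / 2"]) (use hc[OF \<open>k \<le> n\<close>] supp' \<eta> in auto)
    then show ?thesis by blast
  qed
  then obtain B where B: "\<And>k. k \<le> n \<Longrightarrow> B k \<ge> 0" "\<And>k s t. k \<le> n \<Longrightarrow> \<bar>h k s - h k t\<bar> \<le> \<eta> / 2 + B k * (s - t)\<^sup>2"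
    by metis
  have "bounded (h 0 ` {b..c})"
    by (intro compact_imp_bounded compact_continuous_image continuous_on_subset[OF hc[OF le0]]) auto
  then obtain U where "\<forall>x\<in>h 0 ` {b..c}. norm x \<le> U" unfolding bounded_iff by blast
  then have U: "\<And>s. s \<in> {b..c} \<Longrightarrow> \<bar>h 0 s\<bar> \<le> U" by simp
  have U0: "U \<ge> 0" using U[of b] bc by force
  define C where "C = U * (c - b) * (4 / b\<^sup>2) + 2 * (\<Sum>k\<le>n. B k)"
  have C0: "C \<ge> 0" unfolding C_def using U0 bc B(1) by (intro add_nonneg_nonneg mult_nonneg_nonneg sum_nonneg) auto
  \<comment> \<open>Chosen to give both \<sigma> \<le> 1 and \<sigma> * C \<le> \<eta>; the first
    reduces \<sigma>^2 to \<sigma>.\<close>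
  define \<sigma> where "\<sigma> = \<eta> / (\<eta> + C)"
  have \<sigma>: "\<sigma> > 0" "\<sigma> \<le> 1" "\<sigma> * C \<le> \<eta>"
    using \<eta> C0 by (auto simp: \<sigma>_def divide_simps)
  define G where "G = (\<lambda>k. smoothing \<sigma> b c (h k))"
  define g where "g = (\<lambda>k t. Re (G k (of_real t)))"
  have Gr: "G k (of_real t) = of_real (g k t)" if "k \<le> n" for k t
    unfolding g_def G_def by (subst (1 2) smoothing_of_real) (use hc[OF that] supp' \<sigma> in auto)
  have Gd: "(G k has_field_derivative G (Suc k) z) (at z)" if "k < n" for k z
    unfolding G_def by (rule smoothing_deriv)
      (use \<sigma> bc hd supp' that hc[of "Suc k"] continuous_on_subset[of UNIV "h (Suc k)" "{b..c}"] in auto)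
  \<comment> \<open>For n = 0 the derivative of u need not be continuous and
    \<open>smoothing_deriv\<close> is out of reach, so the kernel is differentiated instead.\<close>
  have Gd0: "G 0 holomorphic_on UNIV"
  proof -
    have "continuous_on {b..c} (h 0)" using hc[OF le0] continuous_on_subset by blast
    have "(G 0 has_field_derivative integral {b..c} (\<lambda>s. of_real (h 0 s) * (gauss_kernel \<sigma> z s * (- (z - of_real s) / of_real (\<sigma>\<^sup>2))))) (at z)" for z
      unfolding G_def smoothing_def box_real(2)[symmetric]
    proof (rule leibniz_rule_field_derivative[where U = UNIV])
      show "((\<lambda>z. of_real (h 0 s) * gauss_kernel \<sigma> z s) has_field_derivative of_real (h 0 s) *
          (gauss_kernel \<sigma> z s * (- (z - of_real s) / of_real (\<sigma>\<^sup>2)))) (at z within UNIV)" for z s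
        by (rule DERIV_cmult[OF gauss_kernel_deriv_left[OF \<sigma>(1)]])
      show "(\<lambda>s. of_real (h 0 s) * gauss_kernel \<sigma> z s) integrable_on cbox b c" for z
        unfolding box_real by (intro integrable_continuous_real continuous_intros) fact
      show "continuous_on (UNIV \<times> cbox b c) (\<lambda>(z, s). of_real (h 0 s) * (gauss_kernel \<sigma> z s * (- (z - of_real s) / of_real (\<sigma>\<^sup>2))))"
        unfolding split_beta box_real divide_inverse
        by (intro continuous_intros continuous_on_compose2[OF \<open>continuous_on {b..c} (h 0)\<close>]) auto
    qed auto
    then show ?thesis by (auto simp: holomorphic_on_def field_differentiable_def)
  qed
  have gd: "(g k has_real_derivative g (Suc k) t) (at t)" if "k < n" for k t
  proof -
    have "((\<lambda>t. Re (G k (of_real t))) has_vector_derivative Re (G (Suc k) (of_real t))) (at t)"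
      by (rule bounded_linear.has_vector_derivative[OF bounded_linear_Re has_vector_derivative_real_field[OF Gd[OF that]]])
    then show ?thesis by (simp add: g_def has_real_derivative_iff_has_vector_derivative)
  qed
  have gk: "(deriv ^^ k) (g 0) = g k" if "k \<le> n" for k
    using that
  proof (induction k)
    case (Suc k)
    then show ?case using gd[of k] by (auto simp: DERIV_imp_deriv)
  qed simp
  show ?thesis
  proof (rule that[of "G 0" "g 0"])
    show "G 0 (of_real t) = of_real (g 0 t)" for t by (rule Gr) simp
    show "cmod (G 0 z) \<le> \<eta>" if "cmod z \<le> b / 4" for z
    proof -
      have "cmod (G 0 z) \<le> U * (c - b) * (4 / b\<^sup>2) * \<sigma>"
        unfolding G_def using that U bc \<sigma> continuous_on_subset[OF hc[OF le0]] by (intro smoothing_small) auto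
      also have "\<dots> \<le> C * \<sigma>"
        using \<sigma> B(1) by (intro mult_right_mono) (auto simp: C_def intro!: sum_nonneg)
      finally show ?thesis using \<sigma>(3) by (simp add: mult.commute)
    qed
    show "\<bar>(deriv ^^ k) (g 0) t - (deriv ^^ k) u t\<bar> \<le> \<eta>" if "k \<le> n" for k t
    proof -
      have "\<bar>g k t - h k t\<bar> \<le> \<eta> / 2 + B k * \<sigma>\<^sup>2"
        unfolding g_def G_def using hc[OF that] supp' \<sigma>(1) B(2)[OF that] by (intro smoothing_error) auto
      also have "B k * \<sigma>\<^sup>2 \<le> (\<Sum>k\<le>n. B k) * \<sigma>"
      proof (rule mult_mono)
        show "B k \<le> (\<Sum>k\<le>n. B k)" using that B(1) by (intro member_le_sum) auto
        show "\<sigma>\<^sup>2 \<le> \<sigma>" using \<sigma> by (simp add: power2_eq_square mult_left_le)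
      qed (use B(1) in \<open>auto intro: sum_nonneg\<close>)
      also have "(\<Sum>k\<le>n. B k) * \<sigma> \<le> (C / 2) * \<sigma>"
        using \<sigma> U0 bc by (intro mult_right_mono) (auto simp: C_def)
      also have "(C / 2) * \<sigma> \<le> \<eta> / 2" using \<sigma>(3) by (simp add: mult.commute)
      finally show ?thesis by (simp add: gk[OF that] h_def)
    qed
  qed (rule Gd0)
qed

text \<open>Steklov averaging: the mean of s over [x, x + h] is one order smoother than s. The
  steeper step is placed on [a + h, b], so that the averages are still 0 up to a and 1 from b
  on.\<close>

lemma step_function:
  assumes "a < (b::real)"
  shows "\<exists>s. kdiff n s UNIV \<and> continuous_on UNIV s \<and> (\<forall>x\<le>a. s x = 0) \<and> (\<forall>x\<ge>b. s x = 1)"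
  using assms
proof (induction n arbitrary: a b)
  case 0
  show ?case
    using 0 by (intro exI[of _ "\<lambda>x. max 0 (min 1 ((x - a) / (b - a)))"])
      (auto intro!: continuous_intros simp: divide_simps)
next
  case (Suc n)
  define h where "h = (b - a) / 2"
  have h: "h > 0" "a + h < b" using Suc.prems by (auto simp: h_def field_simps)
  obtain s where s: "kdiff n s UNIV" "continuous_on UNIV s" "\<And>x. x \<le> a + h \<Longrightarrow> s x = 0" "\<And>x. x \<ge> b \<Longrightarrow> s x = 1"
    using Suc.IH[OF h(2)] by blast
  have "\<exists>F. \<forall>x. - \<infinity> < ereal x \<longrightarrow> ereal x < \<infinity> \<longrightarrow> (F has_vector_derivative s x) (at x)"
    using s(2) by (intro einterval_antiderivative) (auto simp: continuous_on_eq_continuous_at)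
  then obtain F where F: "\<And>x. (F has_real_derivative s x) (at x)"
    by (auto simp: has_real_derivative_iff_has_vector_derivative)
  have F': "((\<lambda>x. F (x + h)) has_real_derivative s (x + h)) (at x)" for x
    using F[of "x + h"] by (simp add: DERIV_shift)
  define S where "S = (\<lambda>x. (1 / h) * F (x + h) + (- (1 / h)) * F x)"
  have Sd: "(S has_real_derivative (1 / h) * s (x + h) + (- (1 / h)) * s x) (at x)" for x
    unfolding S_def by (intro DERIV_add DERIV_cmult F F')
  have mvt: "\<exists>\<xi>. x < \<xi> \<and> \<xi> < x + h \<and> S x = s \<xi>" for x
  proof -
    obtain \<xi> where "x < \<xi>" "\<xi> < x + h" "F (x + h) - F x = (x + h - x) * s \<xi>"
      using MVT2[of x "x + h" F s] F h(1) by auto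
    then show ?thesis using h(1) by (intro exI[of _ \<xi>]) (simp add: S_def field_simps)
  qed
  have shift: "kdiff m s UNIV \<Longrightarrow> kdiff m (\<lambda>x. s (x + h)) UNIV" for m and s :: "real \<Rightarrow> real"
  proof (induction m arbitrary: s)
    case (Suc m)
    have "((\<lambda>x. s (x + h)) has_real_derivative deriv s (x + h)) (at x)" for x
      using kdiff_deriv[OF Suc.prems, of "x + h"] by (simp add: DERIV_shift)
    then show ?case using Suc by (intro has_deriv_kdiff_Suc) (auto simp: kdiff_Suc)
  qed simp
  have "kdiff (Suc n) S UNIV"
    by (rule has_deriv_kdiff_Suc[OF open_UNIV Sd]) (intro kdiff_lincomb open_UNIV s shift)
  moreover have "continuous_on UNIV S"
    using Sd by (intro continuous_at_imp_continuous_on) (auto intro: DERIV_isCont)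
  moreover have "S x = 0" if "x \<le> a" for x using mvt[of x] s(3) that by force
  moreover have "S x = 1" if "x \<ge> b" for x using mvt[of x] s(4) that by force
  ultimately show ?case by blast
qed

thm_deps step_function

section \<open>Analytic approximation of all derivatives\<close>

lemma kdiff_shift: "kdiff n f UNIV \<Longrightarrow> kdiff n (\<lambda>t. f (t - a)) UNIV \<and>
    (\<forall>k\<le>n. \<forall>t. (deriv ^^ k) (\<lambda>t. f (t - a)) t = (deriv ^^ k) f (t - a))"
proof (induction n arbitrary: f)
  case (Suc n)
  have d: "((\<lambda>t. f (t - a)) has_real_derivative deriv f (t - a)) (at t)" for t
    using kdiff_deriv[OF Suc.prems, of "t - a"] DERIV_shift[of f "deriv f (t - a)" t "- a"] by simp
  have dd: "deriv (\<lambda>t. f (t - a)) = (\<lambda>t. deriv f (t - a))"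
    using d by (intro ext DERIV_imp_deriv)
  have IH: "kdiff n (\<lambda>t. deriv f (t - a)) UNIV"
    "\<forall>k\<le>n. \<forall>t. (deriv ^^ k) (\<lambda>t. deriv f (t - a)) t = (deriv ^^ k) (deriv f) (t - a)"
    using Suc by (auto simp: kdiff_Suc)
  have "(deriv ^^ k) (\<lambda>t. f (t - a)) t = (deriv ^^ k) f (t - a)" if "k \<le> Suc n" for k t
    using IH(2) that by (cases k) (auto simp: funpow_deriv_Suc dd simp del: funpow.simps)
  with has_deriv_kdiff_Suc[OF open_UNIV d IH(1)] show ?case by blast
qed auto

lemma bounded_deriv_funpow:
  assumes "kdiff (Suc n) s UNIV"
  obtains C where "C \<ge> 0" "\<And>i x. i \<le> n \<Longrightarrow> x \<in> {0..1} \<Longrightarrow> \<bar>(deriv ^^ i) s x\<bar> \<le> C"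
proof -
  have "\<exists>C. \<forall>x\<in>{0..1}. \<bar>(deriv ^^ i) s x\<bar> \<le> C" if "i \<le> n" for i
  proof -
    have "continuous_on {0..1} ((deriv ^^ i) s)"
      using kdiff_continuous_on[OF assms, of i] that continuous_on_subset by auto
    then have "bounded ((deriv ^^ i) s ` {0..1})" by (intro compact_imp_bounded compact_continuous_image) auto
    then obtain C where "\<forall>x\<in>(deriv ^^ i) s ` {0..1}. norm x \<le> C" unfolding bounded_iff by blast
    then show ?thesis by auto
  qed
  then obtain C where C: "\<And>i x. i \<le> n \<Longrightarrow> x \<in> {0..1} \<Longrightarrow> \<bar>(deriv ^^ i) s x\<bar> \<le> C i" by metis
  have "\<bar>(deriv ^^ i) s x\<bar> \<le> (\<Sum>i\<le>n. \<bar>C i\<bar>)" if "i \<le> n" "x \<in> {0..1}" for i x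
  proof -
    have "\<bar>C i\<bar> \<le> (\<Sum>i\<le>n. \<bar>C i\<bar>)" using that by (intro member_le_sum) auto
    then show ?thesis using C[OF that] by linarith
  qed
  then show ?thesis by (intro that[of "\<Sum>i\<le>n. \<bar>C i\<bar>"]) (auto intro: sum_nonneg)
qed

definition real_part :: "(complex \<Rightarrow> complex) \<Rightarrow> real \<Rightarrow> real" where
  "real_part F t = Re (F (of_real t))"

definition entire_real :: "(complex \<Rightarrow> complex) \<Rightarrow> bool" where
  "entire_real F \<longleftrightarrow> F holomorphic_on UNIV \<and> (\<forall>t. F (of_real t) = of_real (real_part F t))"

lemma entire_real_deriv:
  assumes "entire_real F"
  shows "(deriv ^^ k) F (of_real t) = of_real ((deriv ^^ k) (real_part F) t)" "kdiff k (real_part F) UNIV"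
  using deriv_funpow_of_real[of UNIV F UNIV "real_part F"] assms
  by (auto simp: entire_real_def kdiff_def)

text \<open>
  One step of Whitney's construction. The correction \<open>G\<close> is negligible on a disc and to the left of
  \<open>b\<close>; it approximates \<open>R\<close> on \<open>[b + 1, c + 1]\<close>, and on \<open>[b, b + 1]\<close> it is as small as \<open>R\<close> is there.
\<close>

lemma correction_step:
  fixes R :: "real \<Rightarrow> real"
  assumes R: "kdiff (Suc n) R {a<..}" and ab: "a < b" "0 < b" "b + 1 \<le> c" and \<eta>: "\<eta> > 0"
    and s: "kdiff (Suc n) s UNIV" "\<And>x. x \<le> 1/4 \<Longrightarrow> s x = 0" "\<And>x. x \<ge> 3/4 \<Longrightarrow> s x = 1"
    and C: "\<And>i x. i \<le> n \<Longrightarrow> x \<in> {0..1} \<Longrightarrow> \<bar>(deriv ^^ i) s x\<bar> \<le> C" "C \<ge> 0"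
  obtains G where "entire_real G" "\<And>z. cmod z \<le> b / 4 \<Longrightarrow> cmod (G z) \<le> \<eta>"
    "\<And>k t. k \<le> n \<Longrightarrow> t \<le> b \<Longrightarrow> \<bar>(deriv ^^ k) (real_part G) t\<bar> \<le> \<eta>"
    "\<And>k t. k \<le> n \<Longrightarrow> t \<in> {b + 1..c + 1} \<Longrightarrow> \<bar>(deriv ^^ k) R t - (deriv ^^ k) (real_part G) t\<bar> \<le> \<eta>"
    "\<And>k t E. k \<le> n \<Longrightarrow> t \<in> {b..b + 1} \<Longrightarrow> \<forall>i\<le>k. \<bar>(deriv ^^ i) R t\<bar> \<le> E \<Longrightarrow>
      \<bar>(deriv ^^ k) (real_part G) t\<bar> \<le> 2 ^ n * C * E + \<eta>"
proof -
  \<comment> \<open>The first cutoff rises between b + 1/4 and b + 3/4, the second falls between c +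
    5/4 and c + 7/4. The margins make their product constant on neighbourhoods of [b + 1, c + 1] and
    of t \<le> b, where derivatives are compared.\<close>
  define s1 where "s1 = (\<lambda>t. s (t - b))"
  define s2 where "s2 = (\<lambda>t. 1 - s (t - (c + 1)))"
  have s1: "kdiff (Suc n) s1 UNIV" "\<And>k t. k \<le> Suc n \<Longrightarrow> (deriv ^^ k) s1 t = (deriv ^^ k) s (t - b)"
    unfolding s1_def using kdiff_shift[OF s(1)] by blast+
  have s2: "kdiff (Suc n) s2 UNIV" unfolding s2_def
    using kdiff_shift[OF s(1)] by (intro kdiff_diff) auto
  define u where "u = (\<lambda>t. (s1 t * s2 t) * R t)"
  have u0: "u t = 0" if "t < b + 1/4 \<or> t > c + 7/4" for t
    using that s(2)[of "t - b"] s(3)[of "t - (c + 1)"] by (auto simp: u_def s1_def s2_def)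
  have u1: "kdiff (Suc n) u {a<..}"
    unfolding u_def by (intro kdiff_mult R kdiff_mono[OF s1(1)] kdiff_mono[OF s2]) auto
  have u2: "kdiff (Suc n) u {..<b + 1/4}"
    by (rule kdiff_cong[of _ "\<lambda>_. 0"]) (use u0 in auto)
  \<comment> \<open>R is differentiable only beyond a; to the left of b + 1/4 the product vanishes,
    and the two open half-lines cover the line.\<close>
  have u: "kdiff (Suc n) u UNIV"
    unfolding kdiff_def
  proof (intro allI impI ballI)
    fix k x assume "k < Suc n"
    have "x \<in> {a<..} \<or> x \<in> {..<b + 1/4}" using ab by auto
    then show "(deriv ^^ k) u field_differentiable (at x)"
      using u1 u2 \<open>k < Suc n\<close> unfolding kdiff_def by blast
  qed
  obtain G g where G: "G holomorphic_on UNIV" "\<And>t. G (of_real t) = of_real (g t)"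
    "\<And>z. cmod z \<le> b / 4 \<Longrightarrow> cmod (G z) \<le> \<eta>"
    "\<And>k t. k \<le> n \<Longrightarrow> \<bar>(deriv ^^ k) g t - (deriv ^^ k) u t\<bar> \<le> \<eta>"
  proof (rule entire_approximation[OF u, of b "c + 2" "b + 1/4" "c + 7/4" \<eta>])
    show "u t = 0" if "t < b + 1/4 \<or> t > c + 7/4" for t by (rule u0[OF that])
  qed (use ab \<eta> in simp_all)
  have g: "real_part G = g" using G(2) by (auto simp: real_part_def)
  show ?thesis
  proof (rule that[of G])
    show "entire_real G" using G(1,2) by (simp add: entire_real_def g)
    show "cmod (G z) \<le> \<eta>" if "cmod z \<le> b / 4" for z using G(3)[OF that] .
    show "\<bar>(deriv ^^ k) (real_part G) t\<bar> \<le> \<eta>" if "k \<le> n" "t \<le> b" for k t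
    proof -
      have "(deriv ^^ k) u t = (deriv ^^ k) (\<lambda>_. 0) t"
        by (rule deriv_funpow_cong[of "{..<b + 1/4}"]) (use u0 that in auto)
      then show ?thesis using G(4)[OF that(1), of t] by (simp add: g deriv_funpow_const)
    qed
    show "\<bar>(deriv ^^ k) R t - (deriv ^^ k) (real_part G) t\<bar> \<le> \<eta>" if "k \<le> n" "t \<in> {b + 1..c + 1}" for k t
    proof -
      have "(deriv ^^ k) u t = (deriv ^^ k) R t"
      proof (rule deriv_funpow_cong[of "{b + 3/4<..<c + 5/4}"])
        show "u x = R x" if "x \<in> {b + 3/4<..<c + 5/4}" for x
          using that s(3)[of "x - b"] s(2)[of "x - (c + 1)"] by (simp add: u_def s1_def s2_def)
      qed (use that in auto)
      then show ?thesis using G(4)[OF that(1), of t] by (simp add: g abs_minus_commute)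
    qed
    show "\<bar>(deriv ^^ k) (real_part G) t\<bar> \<le> 2 ^ n * C * E + \<eta>"
      if k: "k \<le> n" and t: "t \<in> {b..b + 1}" and E': "\<forall>i\<le>k. \<bar>(deriv ^^ i) R t\<bar> \<le> E" for k t E
    proof -
      have E: "\<bar>(deriv ^^ i) R t\<bar> \<le> E" if "i \<le> k" for i using E' that by blast
      have E0: "E \<ge> 0" using E[OF le0] by linarith
      have "(deriv ^^ k) u t = (deriv ^^ k) (\<lambda>t. s1 t * R t) t"
      proof (rule deriv_funpow_cong[of "{..<c + 5/4}"])
        show "u x = s1 x * R x" if "x \<in> {..<c + 5/4}" for x
          using that s(2)[of "x - (c + 1)"] by (simp add: u_def s2_def)
      qed (use t ab in auto)
      also have "\<dots> = (\<Sum>i\<le>k. real (k choose i) * (deriv ^^ i) s1 t * (deriv ^^ (k - i)) R t)"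
        by (rule deriv_funpow_mult[of "{a<..}" "Suc n"]) (use k t ab R kdiff_mono[OF s1(1)] in auto)
      finally have eq: "\<bar>(deriv ^^ k) u t\<bar> = \<bar>\<Sum>i\<le>k. real (k choose i) * (deriv ^^ i) s1 t * (deriv ^^ (k - i)) R t\<bar>"
        by (rule arg_cong)
      have "\<bar>\<Sum>i\<le>k. real (k choose i) * (deriv ^^ i) s1 t * (deriv ^^ (k - i)) R t\<bar> \<le> (\<Sum>i\<le>k. real (k choose i) * (C * E))"
      proof (rule order_trans[OF sum_abs sum_mono])
        fix i assume "i \<in> {..k}"
        then have i: "i \<le> k" by simp
        have "\<bar>(deriv ^^ i) s1 t\<bar> \<le> C" using C(1)[of i "t - b"] s1(2)[of i t] i k t by auto
        then have "\<bar>(deriv ^^ i) s1 t\<bar> * \<bar>(deriv ^^ (k - i)) R t\<bar> \<le> C * E"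
          using E[of "k - i"] C(2) by (intro mult_mono) auto
        then have "real (k choose i) * (\<bar>(deriv ^^ i) s1 t\<bar> * \<bar>(deriv ^^ (k - i)) R t\<bar>) \<le> real (k choose i) * (C * E)"
          by (rule mult_left_mono) simp
        then show "\<bar>real (k choose i) * (deriv ^^ i) s1 t * (deriv ^^ (k - i)) R t\<bar> \<le> real (k choose i) * (C * E)"
          by (simp add: abs_mult mult.assoc)
      qed
      also have "\<dots> = real (\<Sum>i\<le>k. k choose i) * (C * E)" by (simp add: sum_distrib_right)
      also have "\<dots> = 2 ^ k * (C * E)" by (simp add: choose_row_sum)
      also have "\<dots> \<le> 2 ^ n * (C * E)"
        using k C(2) E0 by (intro mult_right_mono power_increasing) auto
      finally have "\<bar>(deriv ^^ k) u t\<bar> \<le> 2 ^ n * C * E" unfolding eq by simp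
      then show ?thesis using G(4)[OF k, of t] unfolding g by linarith
    qed
  qed
qed

text \<open>The k-th derivative of f may exist only from a point depending on k on, so the n-th step
  controls orders up to n and acts beyond a point b n suited to them. The corrections are entire and
  small on growing discs, hence sum to an entire function.\<close>

theorem whitney_approximation:
  fixes f \<delta> :: "real \<Rightarrow> real"
  assumes f: "\<And>k. \<exists>a. kdiff k f {a<..}" and \<delta>: "eventually (\<lambda>t. isCont \<delta> t \<and> \<delta> t > 0) at_top"
  obtains g where "real_analytic_on g UNIV"
    "\<And>k. eventually (\<lambda>t. \<bar>(deriv ^^ k) g t - (deriv ^^ k) f t\<bar> \<le> \<delta> t) at_top"
proof -
  obtain a where a: "\<And>k. kdiff k f {a k<..}" using f by metis
  obtain T0 where T0: "\<And>t. t \<ge> T0 \<Longrightarrow> isCont \<delta> t \<and> \<delta> t > 0"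
    using \<delta> unfolding eventually_at_top_linorder by blast
  \<comment> \<open>Beyond b n the function f is n + 1 times differentiable and \<delta> is
    continuous and positive. Steps of length at least 1 leave room for the cutoffs, and b n \<ge> n
    + 1 makes the discs of radius b n / 4 exhaust the plane.\<close>
  define b where "b = (\<lambda>n. 1 + \<bar>T0\<bar> + (\<Sum>i\<le>n. \<bar>a (Suc i)\<bar> + 1))"
  have bSuc: "b n + 1 \<le> b (Suc n)" for n by (simp add: b_def)
  have ba: "a (Suc n) < b n" for n
  proof -
    have "\<bar>a (Suc n)\<bar> + 1 \<le> (\<Sum>i\<le>n. \<bar>a (Suc i)\<bar> + 1)"
      by (rule member_le_sum[of n "{..n}" "\<lambda>i. \<bar>a (Suc i)\<bar> + 1"]) auto
    then show ?thesis by (simp add: b_def)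
  qed
  have bn: "b n \<ge> real n + 1" for n
  proof -
    have "(\<Sum>i\<le>n. 1) \<le> (\<Sum>i\<le>n. \<bar>a (Suc i)\<bar> + 1)" by (intro sum_mono) simp
    then show ?thesis by (simp add: b_def)
  qed
  have bT: "b n \<ge> T0" for n
  proof -
    have "0 \<le> (\<Sum>i\<le>n. \<bar>a (Suc i)\<bar> + 1)" by (intro sum_nonneg) simp
    then show ?thesis unfolding b_def by linarith
  qed
  have b0: "b n > 0" for n using bn[of n] by linarith
  have "b n \<le> b (Suc n)" for n using bSuc[of n] by linarith
  then have bmono: "m \<le> n \<Longrightarrow> b m \<le> b n" for m n
    by (rule lift_Suc_mono_le)
  have "\<exists>s. kdiff (Suc n) s UNIV \<and> continuous_on UNIV s \<and> (\<forall>x\<le>1/4. s x = 0) \<and> (\<forall>x\<ge>3/4. s x = 1)" for n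
    by (rule step_function) simp
  then obtain s where s: "\<And>n. kdiff (Suc n) (s n) UNIV" "\<And>n x. x \<le> 1/4 \<Longrightarrow> s n x = (0::real)" "\<And>n x. x \<ge> 3/4 \<Longrightarrow> s n x = 1"
    by metis
  have "\<exists>C. C \<ge> 0 \<and> (\<forall>i x. i \<le> n \<longrightarrow> x \<in> {0..1} \<longrightarrow> \<bar>(deriv ^^ i) (s n) x\<bar> \<le> C)" for n
    using bounded_deriv_funpow[OF s(1)[of n]] by metis
  then obtain C where C: "\<And>n. C n \<ge> 0" "\<And>n i x. i \<le> n \<Longrightarrow> x \<in> {0..1} \<Longrightarrow> \<bar>(deriv ^^ i) (s n) x\<bar> \<le> C n" by metis
  \<comment> \<open>The factor by which a cutoff can enlarge an error: 1 for the error itself, 2^n *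
    C n from Leibniz's formula.\<close>
  define D where "D = (\<lambda>n. 1 + 2 ^ n * C n)"
  have D: "D n \<ge> 1" for n using C(1)[of n] by (simp add: D_def)
  have "\<exists>q>0. \<forall>t\<in>{b n..b (Suc n)}. q \<le> \<delta> t" for n
  proof -
    have "continuous_on {b n..b (Suc n)} \<delta>"
      using T0 bT[of n] by (intro continuous_at_imp_continuous_on) auto
    then obtain t0 where "t0 \<in> {b n..b (Suc n)}" "\<forall>t\<in>{b n..b (Suc n)}. \<delta> t0 \<le> \<delta> t"
      using continuous_attains_inf[of "{b n..b (Suc n)}" \<delta>] bSuc[of n] by auto
    then show ?thesis using T0[of t0] bT[of n] by (intro exI[of _ "\<delta> t0"]) auto
  qed
  then obtain q where q: "\<And>n. q n > 0" "\<And>n t. t \<in> {b n..b (Suc n)} \<Longrightarrow> q n \<le> \<delta> t" by metis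
  \<comment> \<open>The minimum runs over all earlier intervals because later corrections disturb
    them too; D anticipates the next cutoff, and the powers of 2 keep the total below q.\<close>
  define \<eta> where "\<eta> = (\<lambda>n. Min (q ` {..Suc n}) / (2 ^ (n + 2) * D (Suc n)))"
  have Minq: "Min (q ` {..Suc n}) > 0" for n using q(1) by simp
  have \<eta>0: "\<eta> n > 0" for n
    unfolding \<eta>_def using Minq[of n] D[of "Suc n"] by (intro divide_pos_pos mult_pos_pos) auto
  have \<eta>q: "\<eta> j \<le> q n / 2 ^ (j + 2)" if "n \<le> Suc j" for n j
  proof -
    have "\<eta> j \<le> Min (q ` {..Suc j}) / (2 ^ (j + 2) * 1)"
      unfolding \<eta>_def using D[of "Suc j"] by (intro divide_left_mono mult_left_mono mult_pos_pos less_imp_le[OF Minq]) auto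
    also have "\<dots> \<le> q n / 2 ^ (j + 2)"
      using that by (simp add: divide_right_mono)
    finally show ?thesis .
  qed
  have D\<eta>: "D (Suc n) * \<eta> n \<le> q (Suc n) / 2" for n
  proof -
    have "D (Suc n) * \<eta> n = Min (q ` {..Suc n}) / 2 ^ (n + 2)" using D[of "Suc n"] by (simp add: \<eta>_def)
    also have "\<dots> \<le> q (Suc n) / 2 ^ (n + 2)" by (intro divide_right_mono Min_le) auto
    also have "\<dots> \<le> q (Suc n) / 2 ^ 1" using q(1)[of "Suc n"]
      by (intro divide_left_mono power_increasing) auto
    finally show ?thesis by simp
  qed
  define E where "E = (\<lambda>k S t. (deriv ^^ k) f t - (deriv ^^ k) (real_part S) t)"
  \<comment> \<open>The invariant concerns only the collar [b n, b n + 1] on which the next cutoff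
    acts. It asks nothing about errors for n = 0, so the zero function starts the recursion.\<close>
  define P where "P = (\<lambda>n S. entire_real S \<and> (\<forall>k<n. \<forall>t\<in>{b n..b n + 1}. \<bar>E k S t\<bar> \<le> \<eta> (n - 1)))"
  define Q where "Q = (\<lambda>n S S'. (\<forall>z. cmod z \<le> b n / 4 \<longrightarrow> cmod (S' z - S z) \<le> \<eta> n) \<and>
    (\<forall>k\<le>n. \<forall>t\<le>b n. \<bar>E k S' t - E k S t\<bar> \<le> \<eta> n) \<and>
    (\<forall>k<n. \<forall>t\<in>{b n..b (Suc n)}. \<bar>E k S' t\<bar> \<le> D n * \<eta> (n - 1) + \<eta> n))"
  have "\<exists>S. P 0 S"
    by (intro exI[of _ "\<lambda>_. 0"]) (simp add: P_def entire_real_def real_part_def)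
  moreover have "\<exists>S'. P (Suc n) S' \<and> Q n S S'" if PS: "P n S" for n S
  proof -
    have eS: "entire_real S" using PS by (simp add: P_def)
    define R where "R = (\<lambda>t. f t - real_part S t)"
    have R: "kdiff (Suc n) R {a (Suc n)<..}"
      unfolding R_def by (intro kdiff_diff a kdiff_mono[OF entire_real_deriv(2)[OF eS]]) auto
    have RE: "(deriv ^^ k) R t = E k S t" if "k \<le> Suc n" "t > a (Suc n)" for k t
      unfolding R_def E_def
      by (rule deriv_funpow_diff[of "{a (Suc n)<..}" "Suc n"]) (use a that kdiff_mono[OF entire_real_deriv(2)[OF eS]] in auto)
    obtain G where G: "entire_real G" "\<And>z. cmod z \<le> b n / 4 \<Longrightarrow> cmod (G z) \<le> \<eta> n"
      "\<And>k t. k \<le> n \<Longrightarrow> t \<le> b n \<Longrightarrow> \<bar>(deriv ^^ k) (real_part G) t\<bar> \<le> \<eta> n"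
      "\<And>k t. k \<le> n \<Longrightarrow> t \<in> {b n + 1..b (Suc n) + 1} \<Longrightarrow> \<bar>(deriv ^^ k) R t - (deriv ^^ k) (real_part G) t\<bar> \<le> \<eta> n"
      "\<And>k t E. k \<le> n \<Longrightarrow> t \<in> {b n..b n + 1} \<Longrightarrow> \<forall>i\<le>k. \<bar>(deriv ^^ i) R t\<bar> \<le> E \<Longrightarrow>
        \<bar>(deriv ^^ k) (real_part G) t\<bar> \<le> 2 ^ n * C n * E + \<eta> n"
      by (rule correction_step[OF R ba b0 bSuc \<eta>0 s(1) s(2) s(3) C(2) C(1)]) (assumption | rule that, assumption+)+
    define S' where "S' = (\<lambda>z. S z + G z)"
    have rp: "real_part S' = (\<lambda>t. real_part S t + real_part G t)" by (auto simp: S'_def real_part_def)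
    have eS': "entire_real S'"
      using eS G(1) unfolding entire_real_def rp by (auto simp: S'_def intro: holomorphic_on_add)
    have ES': "E k S' t = E k S t - (deriv ^^ k) (real_part G) t" for k t
      unfolding E_def rp
      using deriv_funpow_add[OF open_UNIV entire_real_deriv(2)[OF eS] entire_real_deriv(2)[OF G(1)], of k k t] by simp
    have right: "\<bar>E k S' t\<bar> \<le> \<eta> n" if "k \<le> n" "t \<in> {b n + 1..b (Suc n) + 1}" for k t
      using G(4)[OF that] RE[of k t] that ba[of n] by (simp add: ES')
    have "P (Suc n) S'"
      unfolding P_def using eS' right bSuc[of n] by (auto simp: less_Suc_eq_le)
    moreover have "Q n S S'"
      unfolding Q_def
    proof (intro conjI allI impI ballI)
      show "cmod (S' z - S z) \<le> \<eta> n" if "cmod z \<le> b n / 4" for z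
        using G(2)[OF that] by (simp add: S'_def)
      show "\<bar>E k S' t - E k S t\<bar> \<le> \<eta> n" if "k \<le> n" "t \<le> b n" for k t
        using G(3)[OF that] by (simp add: ES')
      show "\<bar>E k S' t\<bar> \<le> D n * \<eta> (n - 1) + \<eta> n" if k: "k < n" and t: "t \<in> {b n..b (Suc n)}" for k t
      proof (cases "t \<le> b n + 1")
        case True
        have small: "\<bar>E i S t\<bar> \<le> \<eta> (n - 1)" if "i \<le> k" for i
          using PS that k t True by (auto simp: P_def)
        have "\<bar>(deriv ^^ k) (real_part G) t\<bar> \<le> 2 ^ n * C n * \<eta> (n - 1) + \<eta> n"
        proof (rule G(5))
          show "\<forall>i\<le>k. \<bar>(deriv ^^ i) R t\<bar> \<le> \<eta> (n - 1)"
            using small RE[of _ t] k t ba[of n] by simp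
        qed (use k t True in auto)
        with small[of k] show ?thesis by (simp add: ES' D_def distrib_right)
      next
        case False
        have "\<bar>E k S' t\<bar> \<le> \<eta> n" using False k t by (intro right) auto
        moreover have "D n * \<eta> (n - 1) \<ge> 0" using D[of n] \<eta>0[of "n - 1"] by simp
        ultimately show ?thesis by linarith
      qed
    qed
    ultimately show ?thesis by blast
  qed
  ultimately obtain S where S: "\<And>n. P n (S n)" "\<And>n. Q n (S n) (S (Suc n))"
    using dependent_nat_choice[of P Q] by blast
  have eS: "entire_real (S n)" for n using S(1)[of n] by (simp add: P_def)
  define F where "F = (\<lambda>z. S 0 z + (\<Sum>i. S (Suc i) z - S i z))"
  have ulim: "uniform_limit (ball 0 r) S F sequentially" for r
  proof -
    have "eventually (\<lambda>n. \<forall>z\<in>ball 0 r. norm (S (Suc n) z - S n z) \<le> q 0 * (1/2) ^ n) sequentially"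
    proof -
      obtain N where N: "4 * r < real N" using reals_Archimedean2 by blast
      have "norm (S (Suc n) z - S n z) \<le> q 0 * (1/2) ^ n" if "n \<ge> N" "z \<in> ball 0 r" for n z
      proof -
        have "cmod z \<le> b n / 4" using that N bn[of n] by (auto simp: dist_norm)
        then have "cmod (S (Suc n) z - S n z) \<le> \<eta> n" using S(2)[of n] by (auto simp: Q_def)
        also have "\<dots> \<le> q 0 / 2 ^ (n + 2)" by (rule \<eta>q) simp
        also have "\<dots> \<le> q 0 / 2 ^ n" using q(1)[of 0] by (intro divide_left_mono power_increasing) auto
        finally show ?thesis by (simp add: power_one_over)
      qed
      then show ?thesis unfolding eventually_sequentially by blast
    qed
    moreover have "summable (\<lambda>n. q 0 * (1/2) ^ n)" by (intro summable_mult summable_geometric) simp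
    ultimately have "uniform_limit (ball 0 r) (\<lambda>n z. \<Sum>i<n. S (Suc i) z - S i z) (\<lambda>z. \<Sum>i. S (Suc i) z - S i z) sequentially"
      by (rule Weierstrass_m_test_ev)
    then have "uniform_limit (ball 0 r) (\<lambda>n z. S 0 z + (\<Sum>i<n. S (Suc i) z - S i z)) F sequentially"
      unfolding F_def by (intro uniform_limit_add uniform_limit_const)
    moreover have "S 0 z + (\<Sum>i<n. S (Suc i) z - S i z) = S n z" for n z
      using sum_lessThan_telescope[of "\<lambda>i. S i z" n] by simp
    ultimately show ?thesis by simp
  qed
  have holS: "S n holomorphic_on A" for n A using eS[of n] holomorphic_on_subset by (auto simp: entire_real_def)
  have "F holomorphic_on UNIV"
  proof (rule holomorphic_uniform_sequence[of UNIV S])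
    fix z :: complex
    have "cball z 1 \<subseteq> ball 0 (cmod z + 2)"
    proof
      fix w assume "w \<in> cball z 1"
      then show "w \<in> ball 0 (cmod z + 2)" using norm_triangle_sub[of w z] by (simp add: dist_norm norm_minus_commute)
    qed
    then have "uniform_limit (cball z 1) S F sequentially" using ulim uniform_limit_on_subset by blast
    then show "\<exists>d>0. cball z d \<subseteq> UNIV \<and> uniform_limit (cball z d) S F sequentially"
      by (intro exI[of _ 1]) simp
  qed (auto intro: holS)
  have dlim: "(\<lambda>n. (deriv ^^ k) (S n) z) \<longlonglongrightarrow> (deriv ^^ k) F z" for k z
    by (rule higher_deriv_complex_uniform_limit[OF ulim[of "cmod z + 1"]]) (auto intro!: always_eventually holS simp: dist_norm)
  have "F (of_real t) = of_real (real_part F t)" for t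
  proof -
    have lim: "(\<lambda>n. S n (of_real t)) \<longlonglongrightarrow> F (of_real t)" using dlim[of 0 "of_real t"] by simp
    have "S n (of_real t) = of_real (real_part (S n) t)" for n using eS[of n] unfolding entire_real_def by blast
    then have "S n (of_real t) \<in> \<real>" for n by (metis Reals_of_real)
    from closed_sequentially[OF closed_complex_Reals this lim] have "F (of_real t) \<in> \<real>" .
    then show ?thesis by (simp add: real_part_def of_real_Re)
  qed
  then have eF: "entire_real F" using \<open>F holomorphic_on UNIV\<close> by (simp add: entire_real_def)
  have rlim: "(\<lambda>n. E k (S n) t) \<longlonglongrightarrow> E k F t" for k t
  proof -
    have "(\<lambda>n. Re ((deriv ^^ k) (S n) (of_real t))) \<longlonglongrightarrow> Re ((deriv ^^ k) F (of_real t))"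
      by (intro tendsto_Re dlim)
    then have "(\<lambda>n. (deriv ^^ k) (real_part (S n)) t) \<longlonglongrightarrow> (deriv ^^ k) (real_part F) t"
      by (simp only: entire_real_deriv(1)[OF eS] entire_real_deriv(1)[OF eF] Re_complex_of_real)
    then show ?thesis unfolding E_def by (rule tendsto_diff[OF tendsto_const])
  qed
  have qle: "q (Suc n) * (1 - 1 / 2 ^ (m + 1)) \<le> q (Suc n)" for n m :: nat
    using q(1)[of "Suc n"] by (simp add: mult_left_le)
  have bound: "\<bar>E k F t\<bar> \<le> q (Suc n)" if k: "k \<le> n" and t: "t \<in> {b (Suc n)..b (Suc (Suc n))}" for k n t
  proof -
    \<comment> \<open>The step treating this interval leaves at most D * \<eta> n plus one further
      \<eta>; all later corrections add a geometric series, so the error stays below q (Suc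
      n).\<close>
    have b: "\<bar>E k (S m) t\<bar> \<le> q (Suc n) * (1 - 1 / 2 ^ (m + 1))" if "m \<ge> Suc (Suc n)" for m
      using that
    proof (induction m rule: dec_induct)
      case base
      have "\<bar>E k (S (Suc (Suc n))) t\<bar> \<le> D (Suc n) * \<eta> n + \<eta> (Suc n)"
        using S(2)[of "Suc n"] k t by (auto simp: Q_def)
      also have "\<dots> \<le> q (Suc n) / 2 + q (Suc n) / 2 ^ (Suc n + 2)"
        by (intro add_mono D\<eta> \<eta>q) simp
      also have "\<dots> = q (Suc n) * (1 / 2 + 1 / 2 ^ (n + 3))" by (simp add: power_add distrib_left)
      also have "\<dots> \<le> q (Suc n) * (1 - 1 / 2 ^ (n + 3))"
      proof (intro mult_left_mono)
        have "1 / 2 ^ (n + 3) \<le> (1::real) / 2 ^ 3" by (intro divide_left_mono power_increasing) auto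
        then have "1 / 2 ^ (n + 3) \<le> (1::real) / 8" by simp
        then show "1 / 2 + 1 / 2 ^ (n + 3) \<le> 1 - (1::real) / 2 ^ (n + 3)" by linarith
      qed (use q(1)[of "Suc n"] in simp)
      finally show ?case by (simp add: power_add mult.commute)
    next
      case (step m)
      have "t \<le> b m" using t bmono[of "Suc (Suc n)" m] step by auto
      then have "\<bar>E k (S (Suc m)) t - E k (S m) t\<bar> \<le> \<eta> m"
        using S(2)[of m] k step by (auto simp: Q_def)
      also have "\<eta> m \<le> q (Suc n) / 2 ^ (m + 2)" using step by (intro \<eta>q) simp
      finally have "\<bar>E k (S (Suc m)) t\<bar> \<le> q (Suc n) * (1 - 1 / 2 ^ (m + 1)) + q (Suc n) / 2 ^ (m + 2)"
        using step.IH by linarith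
      also have "\<dots> = q (Suc n) * (1 - 1 / 2 ^ (Suc m + 1))" by (simp add: field_simps)
      finally show ?case .
    qed
    have "\<forall>m\<ge>Suc (Suc n). \<bar>E k (S m) t\<bar> \<le> q (Suc n)"
      using order_trans[OF b qle] by simp
    then show ?thesis by (intro LIMSEQ_le_const2[OF tendsto_rabs[OF rlim]] exI)
  qed
  show ?thesis
  proof (rule that[of "real_part F"])
    show "real_analytic_on (real_part F) UNIV"
      unfolding real_analytic_on_iff_holomorphic
    proof
      fix x
      show "\<exists>H. \<exists>e>0. H holomorphic_on ball (of_real x) e \<and> (\<forall>y. \<bar>y - x\<bar> < e \<longrightarrow> H (of_real y) = of_real (real_part F y))"
      proof (intro exI conjI allI impI)
        show "F holomorphic_on ball (of_real x) 1"
          using eF holomorphic_on_subset[of F UNIV "ball (of_real x) 1"] unfolding entire_real_def by simp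
        show "F (of_real y) = of_real (real_part F y)" for y
          using eF unfolding entire_real_def by blast
      qed simp
    qed
    show "eventually (\<lambda>t. \<bar>(deriv ^^ k) (real_part F) t - (deriv ^^ k) f t\<bar> \<le> \<delta> t) at_top" for k
      using eventually_ge_at_top[of "b (Suc k)"]
    proof eventually_elim
      case (elim t)
      have ex: "\<exists>m. t < b m"
      proof -
        obtain m where "t < real m" using reals_Archimedean2 by blast
        then show ?thesis using bn[of m] by (intro exI[of _ m]) linarith
      qed
      define m where "m = (LEAST m. t < b m)"
      have m: "t < b m" unfolding m_def using ex by (rule LeastI_ex)
      have "m > Suc k"
      proof (rule ccontr)
        assume "\<not> m > Suc k"
        then have "b m \<le> b (Suc k)" by (intro bmono) simp
        with m elim show False by simp
      qed
      \<comment> \<open>The point t lies between b (m - 1) and b m, which is the interval of index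
        Suc n, and m > Suc k gives k \<le> n as \<open>bound\<close> asks.\<close>
      define n where "n = m - 2"
      have n: "m = Suc (Suc n)" "k \<le> n" using \<open>m > Suc k\<close> by (simp_all add: n_def)
      have "\<not> t < b (Suc n)" using not_less_Least[of "Suc n" "\<lambda>m. t < b m"] n by (simp add: m_def)
      then have t: "t \<in> {b (Suc n)..b (Suc (Suc n))}" using m n by simp
      have "\<bar>E k F t\<bar> \<le> \<delta> t" using bound[OF n(2) t] q(2)[OF t] by linarith
      then show ?case by (simp add: E_def abs_minus_commute)
    qed
  qed
qed

thm_deps whitney_approximation

section \<open>Density\<close>

lemma (in hfun) kdiff_tail: "f \<in> S \<Longrightarrow> \<exists>a. kdiff n f {a<..}"
proof -
  assume f: "f \<in> S"
  have "eventually (\<lambda>t. \<forall>k\<in>{..n}. (deriv ^^ k) f field_differentiable (at t)) at_top"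
    by (rule eventually_ball_finite) (use ediff[OF der_funpow[OF f]] in auto)
  then obtain a where "\<And>t. t \<ge> a \<Longrightarrow> \<forall>k\<in>{..n}. (deriv ^^ k) f field_differentiable (at t)"
    unfolding eventually_at_top_linorder by blast
  then show ?thesis unfolding kdiff_def by (intro exI[of _ a]) auto
qed

lemma (in hardy_gap) gap_impossible: False
proof -
  have "\<exists>\<phi>. lower \<phi> (polys S N (Suc r))" for N r using lower_bounds .
  then obtain \<Phi> where \<Phi>: "\<And>N r. lower (\<Phi> N r) (polys S N (Suc r))" by metis
  have \<Phi>g: "K.gauge (\<Phi> N r)" for N r using \<Phi> by (simp add: lower_def)
  have "\<exists>\<tau>. K.gauge \<tau> \<and> eventually (\<lambda>t. \<tau> t \<le> \<Phi> N r t * cw r (2 * (N * Suc r)) (N * Suc r) t) at_top" for N r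
    using K.gauge_mult[OF \<Phi>g gauge_cw] .
  then obtain \<tau> where \<tau>: "\<And>N r. K.gauge (\<tau> N r)"
    "\<And>N r. eventually (\<lambda>t. \<tau> N r t \<le> \<Phi> N r t * cw r (2 * (N * Suc r)) (N * Suc r) t) at_top" by metis
  have half\<epsilon>: "K.gauge (\<lambda>t. \<epsilon> t / 2)"
    by (rule K.gauge_mem) (use \<epsilon>K K.numeral K.divide \<epsilon>_pos in auto)
  \<comment> \<open>A single sequence containing \<epsilon>/2, the constant 1 and the bounds for all
    pairs (N, r), enumerated through \<open>prod_decode\<close>.\<close>
  define G where "G = (\<lambda>i. case i of 0 \<Rightarrow> (\<lambda>t. \<epsilon> t / 2) | Suc 0 \<Rightarrow> (\<lambda>_. 1) | Suc (Suc j) \<Rightarrow> \<tau> (fst (prod_decode j)) (snd (prod_decode j)))"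
  have "K.gauge (G i)" for i using half\<epsilon> gauge_one \<tau>(1) by (auto simp: G_def split: nat.split)
  then obtain \<delta> where \<delta>: "K.gauge \<delta>" "\<And>i. eventually (\<lambda>t. \<delta> t \<le> G i t) at_top"
    using gauge_below[of G] by blast
  obtain g where g: "real_analytic_on g UNIV"
    "\<And>k. eventually (\<lambda>t. \<bar>(deriv ^^ k) g t - fd k t\<bar> \<le> \<delta> t) at_top"
  proof (rule whitney_approximation[of f \<delta>])
    show "\<exists>a. kdiff k f {a<..}" for k by (rule K.kdiff_tail[OF fK])
    show "eventually (\<lambda>t. isCont \<delta> t \<and> \<delta> t > 0) at_top"
      using K.gauge_cont[OF \<delta>(1)] K.gauge_pos[OF \<delta>(1)] by eventually_elim simp
  qed (rule that)
  have "g \<in> S"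
  proof (rule transcendental_extension)
    have "regular_on an g {0<..}"
      using real_analytic_on_subset[OF g(1)] by (intro real_analytic_on_imp_regular) auto
    then show "regular an g" unfolding regular_def by blast
    fix r p assume "p \<in> pfun S r"
    \<comment> \<open>\<open>near_zero_or\<close> concerns the variables x 0, ..., x r, hence the
      passage to Suc r.\<close>
    then have "p \<in> pfun S (Suc r)" by (rule pfun_lift)
    then obtain N n where np: "(n, p) \<in> polys S N (Suc r)" by (auto simp: pfun_def)
    have x: "eventually (\<lambda>t. \<forall>k\<le>r. \<bar>(deriv ^^ k) g t - fd k t\<bar> \<le> \<delta> t) at_top"
      by (rule eventually_all_le) (rule g(2))
    have \<delta>N: "eventually (\<lambda>t. \<delta> t \<le> 1 \<and> 2 * (real (N * Suc r) * M r t ^ (N * Suc r)) * \<delta> t \<le> \<Phi> N r t \<and> \<delta> t \<ge> 0) at_top"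
      using \<delta>(2)[of 1] \<delta>(2)[of "Suc (Suc (prod_encode (N, r)))"] \<tau>(2)[of N r] K.gauge_pos[OF \<delta>(1)]
    proof eventually_elim
      case (elim t)
      define e where "e = N * Suc r"
      have d: "\<delta> t \<le> \<Phi> N r t * cw r (2 * e) e t" using elim by (simp add: G_def e_def)
      have mp: "M r t ^ e \<ge> 1" by (rule M_power_ge)
      have "2 * (real e * M r t ^ e) * \<delta> t \<le> (real (Suc (2 * e)) * M r t ^ e) * \<delta> t"
        using elim mp by (intro mult_right_mono) (auto simp: algebra_simps)
      also have "\<dots> \<le> (real (Suc (2 * e)) * M r t ^ e) * (\<Phi> N r t * cw r (2 * e) e t)"
        using d mp by (intro mult_left_mono) auto
      also have "\<dots> = \<Phi> N r t" by (subst mult.commute) (rule cw_cancel)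
      finally show ?case using elim unfolding e_def[symmetric] by (simp add: G_def)
    qed
    from near_zero_or[OF estimate_polys[OF np] polys_norm_mem[OF np] lowerD[OF \<Phi> np] K.gauge_pos[OF \<Phi>g] \<delta>N x]
    show "eventually (\<lambda>t. p t (\<lambda>k. (deriv ^^ k) g t) = 0) at_top \<or>
      eventually (\<lambda>t. p t (\<lambda>k. (deriv ^^ k) g t) \<noteq> 0) at_top"
      by (auto elim: eventually_mono)
  qed
  then have "\<not> eventually (\<lambda>t. \<bar>f t - g t\<bar> < \<epsilon> t) at_top" by (rule gap)
  moreover have "eventually (\<lambda>t. \<bar>f t - g t\<bar> < \<epsilon> t) at_top"
    using g(2)[of 0] \<delta>(2)[of 0] \<epsilon>_pos by eventually_elim (simp add: G_def abs_minus_commute)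
  ultimately show False by blast
qed

section \<open>Translation between germs and functions\<close>

definition funs :: "germ set \<Rightarrow> (real \<Rightarrow> real) set" where
  "funs H = {f. germ_of f \<in> H}"

lemma germ_of_eq_iff: "germ_of f = germ_of g \<longleftrightarrow> eventually (\<lambda>t. f t = g t) at_top"
  by (rule germ.abs_eq_iff)

lemma germ_of_cases: obtains f where "x = germ_of f"
  using Quotient_abs_rep[OF Quotient_germ] by metis

lemmas germ_of_ops = zero_germ.abs_eq one_germ.abs_eq minus_germ.abs_eq times_germ.abs_eq
  germ_deriv.abs_eq less_germ.abs_eq abs_germ.abs_eq

text \<open>A representative is only known to agree near infinity with a differentiable function,
  and differentiability is local.\<close>

lemma kdiff_imp_ediff:
  assumes "kdiff (Suc 0) h {a<..}" "eventually (\<lambda>t. f t = h t) at_top"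
  shows "eventually (\<lambda>t. f field_differentiable (at t)) at_top"
  using eventually_nhds_at_top[OF assms(2)] eventually_gt_at_top[of a]
proof eventually_elim
  case (elim t)
  have "(h has_real_derivative deriv h t) (at t)" using kdiff_deriv[OF assms(1), of t] elim by simp
  then have "(f has_real_derivative deriv h t) (at t)" using has_real_derivative_cong_ev[OF elim(1)] by simp
  then show ?case by (auto simp: field_differentiable_def)
qed

lemma hfun_funs:
  assumes "hardy_field H"
  shows "hfun (funs H)"
proof -
  have fin: "H \<subseteq> germs_C_fin" and sub: "germ_subfield H" and "\<forall>f\<in>H. germ_deriv f \<in> H"
    using assms unfolding hardy_field_def by simp_all
  then have der: "germ_deriv f \<in> H" if "f \<in> H" for f using that by simp
  have one: "1 \<in> H" and "\<forall>f\<in>H. \<forall>g\<in>H. f - g \<in> H" "\<forall>f\<in>H. \<forall>g\<in>H. f * g \<in> H"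
    and "\<forall>f\<in>H. f \<noteq> 0 \<longrightarrow> (\<exists>g\<in>H. f * g = 1)"
    using sub unfolding germ_subfield_def by simp_all
  then have diff: "f - g \<in> H" and mult: "f * g \<in> H" and inv: "f \<noteq> 0 \<Longrightarrow> \<exists>g\<in>H. f * g = 1"
    if "f \<in> H" "g \<in> H" for f g using that by simp_all
  \<comment> \<open>A product that is eventually 1 excludes zeros near infinity; this is how the
    field axiom yields \<open>zero_or\<close>.\<close>
  have inv': "eventually (\<lambda>t. f t = 0) at_top \<or> (\<exists>g. germ_of g \<in> H \<and> eventually (\<lambda>t. f t * g t = 1) at_top)"
    if "germ_of f \<in> H" for f
  proof (cases "germ_of f = 0")
    case True
    then show ?thesis by (simp add: germ_of_ops germ_of_eq_iff)
  next
    case False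
    then obtain x where x: "x \<in> H" "germ_of f * x = 1" using inv[OF \<open>germ_of f \<in> H\<close> one] by blast
    obtain g where "x = germ_of g" by (rule germ_of_cases)
    with x show ?thesis by (auto simp: germ_of_ops germ_of_eq_iff)
  qed
  show ?thesis
  proof
    fix f assume "f \<in> funs H"
    then have f: "germ_of f \<in> H" by (simp add: funs_def)
    show "g \<in> funs H" if "eventually (\<lambda>t. f t = g t) at_top" for g
      using f that by (simp add: funs_def flip: germ_of_eq_iff)
    show "eventually (\<lambda>t. f t = 0) at_top \<or> eventually (\<lambda>t. f t \<noteq> 0) at_top"
      using inv'[OF f]
    proof
      assume "\<exists>g. germ_of g \<in> H \<and> eventually (\<lambda>t. f t * g t = 1) at_top"
      then obtain g where "eventually (\<lambda>t. f t * g t = 1) at_top" by blast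
      then have "eventually (\<lambda>t. f t \<noteq> 0) at_top" by eventually_elim auto
      then show ?thesis ..
    qed simp
    show "(\<lambda>t. inverse (f t)) \<in> funs H"
      using inv'[OF f]
    proof
      assume "eventually (\<lambda>t. f t = 0) at_top"
      then have "eventually (\<lambda>t. inverse (f t) = 0) at_top" by eventually_elim simp
      then have "germ_of (\<lambda>t. inverse (f t)) = 1 - 1" by (simp add: germ_of_ops germ_of_eq_iff)
      then show ?thesis using diff[OF one one] by (simp add: funs_def)
    next
      assume "\<exists>g. germ_of g \<in> H \<and> eventually (\<lambda>t. f t * g t = 1) at_top"
      then obtain g where g: "germ_of g \<in> H" "eventually (\<lambda>t. f t * g t = 1) at_top" by blast
      have "eventually (\<lambda>t. inverse (f t) = g t) at_top" using g(2) by eventually_elim (rule inverse_unique)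
      then show ?thesis using g(1) by (simp add: funs_def flip: germ_of_eq_iff)
    qed
    show "deriv f \<in> funs H" using der[OF f] by (simp add: funs_def germ_of_ops)
    have "germ_of f \<in> germs_C (enat 1)" using f fin by (auto simp: germs_C_fin_def)
    then obtain h a where h: "germ_of f = germ_of h" "cont_diff_on (enat 1) h {a<..}" by (auto simp: germs_C_def)
    then have "kdiff (Suc 0) h {a<..}" by (simp add: cont_diff_on_iff_kdiff)
    then show "eventually (\<lambda>t. f field_differentiable (at t)) at_top"
      using h(1) by (intro kdiff_imp_ediff[of h a]) (simp_all add: germ_of_eq_iff)
  next
    show "(\<lambda>_. 1) \<in> funs H" using one by (simp add: funs_def germ_of_ops)
  next
    fix f g assume "f \<in> funs H" "g \<in> funs H"
    then show "(\<lambda>t. f t - g t) \<in> funs H" "(\<lambda>t. f t * g t) \<in> funs H"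
      using diff[of "germ_of f" "germ_of g"] mult[of "germ_of f" "germ_of g"] by (simp_all add: funs_def germ_of_ops)
  qed
qed

text \<open>The way back to germs, where maximality is assumed. For each finite order the iterated
  derivatives exist on a common tail, which may depend on the order.\<close>

lemma hardy_field_of_hfun:
  assumes "hfun S"
  shows "hardy_field (germ_of ` S)"
proof -
  interpret hfun S by fact
  have "germ_of f \<in> germs_C_fin" if f: "f \<in> S" for f
  proof -
    have "germ_of f \<in> germs_C (enat n)" for n
    proof -
      obtain a where "kdiff (Suc n) f {a<..}" using kdiff_tail[OF f] by blast
      then have "cont_diff_on (enat n) f {a<..}"
        using kdiff_mono[of "Suc n" f "{a<..}" n] kdiff_continuous_on[of "Suc n" f "{a<..}" n]
        by (simp add: cont_diff_on_iff_kdiff)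
      then show ?thesis unfolding germs_C_def by blast
    qed
    then show ?thesis by (simp add: germs_C_fin_def)
  qed
  moreover have "\<exists>g\<in>S. germ_of f * germ_of g = 1" if f: "f \<in> S" "germ_of f \<noteq> 0" for f
  proof (intro bexI[of _ "\<lambda>t. inverse (f t)"] inv f)
    have "eventually (\<lambda>t. f t \<noteq> 0) at_top" using zero_or[OF f(1)] f(2) by (auto simp: germ_of_ops germ_of_eq_iff)
    then have "eventually (\<lambda>t. f t * inverse (f t) = 1) at_top" by eventually_elim simp
    then show "germ_of f * germ_of (\<lambda>t. inverse (f t)) = 1" by (simp add: germ_of_ops germ_of_eq_iff)
  qed
  ultimately show ?thesis
    unfolding hardy_field_def germ_subfield_def
    using one diff mult der by (auto simp: germ_of_ops intro!: imageI)
qed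

definition regular_germs :: "bool \<Rightarrow> germ set" where
  "regular_germs an = {germ_of f |f. regular an f}"

lemma regular_germs_eq: "regular_germs True = germs_C_analytic" "regular_germs False = germs_C \<infinity>"
  by (auto simp: regular_germs_def germs_C_analytic_def germs_C_def regular_def regular_on_def cont_diff_on_infinity_iff)

lemma regular_germ_iff: "germ_of f \<in> regular_germs an \<longleftrightarrow> regular an f"
proof
  assume "germ_of f \<in> regular_germs an"
  then obtain g where "germ_of g = germ_of f" "regular an g" by (auto simp: regular_germs_def)
  then show "regular an f" by (intro regular_cong[of an g f]) (simp_all add: germ_of_eq_iff)
next
  assume "regular an f"
  then show "germ_of f \<in> regular_germs an" unfolding regular_germs_def by blast
qed

text \<open>Every germ has a representative, so a larger set of functions gives a set of germs
  containing H; it cannot be strictly larger, and therefore brings no new function.\<close>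

lemma max_hfun_funs:
  assumes H: "hardy_field H" "H \<subseteq> regular_germs an"
    and max: "\<And>K. hardy_field K \<Longrightarrow> K \<subseteq> regular_germs an \<Longrightarrow> \<not> H \<subset> K"
  shows "max_hfun (funs H) an"
proof -
  interpret hfun "funs H" by (rule hfun_funs[OF H(1)])
  show ?thesis
  proof
    show "regular an f" if "f \<in> funs H" for f
      using that H(2) regular_germ_iff by (auto simp: funs_def)
    fix S' assume S': "hfun S'" "\<And>f. f \<in> S' \<Longrightarrow> regular an f" "funs H \<subseteq> S'"
    have "H \<subseteq> germ_of ` S'"
    proof
      fix x assume x: "x \<in> H"
      obtain f where "x = germ_of f" by (rule germ_of_cases)
      with x S'(3) show "x \<in> germ_of ` S'" by (auto simp: funs_def)
    qed
    moreover have "\<not> H \<subset> germ_of ` S'"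
      using S'(2) by (intro max hardy_field_of_hfun S'(1)) (auto simp: regular_germ_iff)
    ultimately show "S' \<subseteq> funs H" by (auto simp: funs_def)
  qed
qed

theorem theorem4p15:
  fixes H K :: "germ set"
  assumes "maximal_analytic_hardy_field H \<or> maximal_smooth_hardy_field H"
    and "hardy_field K" and "H \<subseteq> K"
  shows "dense_in_hardy_field H K"
proof -
  have "\<exists>an. max_hfun (funs H) an"
    using assms(1)
  proof
    assume "maximal_analytic_hardy_field H"
    then have "max_hfun (funs H) True"
      unfolding maximal_analytic_hardy_field_def analytic_hardy_field_def
      by (intro max_hfun_funs) (auto simp: regular_germs_eq)
    then show ?thesis ..
  next
    assume "maximal_smooth_hardy_field H"
    then have "max_hfun (funs H) False"
      unfolding maximal_smooth_hardy_field_def smooth_hardy_field_def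
      by (intro max_hfun_funs) (auto simp: regular_germs_eq)
    then show ?thesis ..
  qed
  then obtain an where an: "max_hfun (funs H) an" ..
  show ?thesis
    unfolding dense_in_hardy_field_def
  proof (intro ballI impI)
    fix x e assume x: "x \<in> K" and e: "e \<in> K" "0 < e"
    obtain f where f: "x = germ_of f" by (rule germ_of_cases)
    obtain \<epsilon> where \<epsilon>: "e = germ_of \<epsilon>" by (rule germ_of_cases)
    show "\<exists>h\<in>H. \<bar>x - h\<bar> < e"
    proof (rule ccontr)
      assume no: "\<not> (\<exists>h\<in>H. \<bar>x - h\<bar> < e)"
      interpret max_hfun "funs H" an by (rule an)
      interpret hfun_K: hfun "funs K" by (rule hfun_funs[OF assms(2)])
      interpret hardy_gap "funs H" an "funs K" f \<epsilon>
      proof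
        show "funs H \<subseteq> funs K" using assms(3) by (auto simp: funs_def)
        show "f \<in> funs K" "\<epsilon> \<in> funs K" using x e f \<epsilon> by (auto simp: funs_def)
        show "eventually (\<lambda>t. \<epsilon> t > 0) at_top" using e(2) by (simp add: \<epsilon> germ_of_ops)
        show "\<not> eventually (\<lambda>t. \<bar>f t - h t\<bar> < \<epsilon> t) at_top" if "h \<in> funs H" for h
          using that no by (auto simp: funs_def f \<epsilon> germ_of_ops)
      qed
      show False by (rule gap_impossible)
    qed
  qed
qed


end
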